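(* Let $m\ge1$, let $w_1,\dots,w_{m}$ be weights on $\mathbb R^n$, and let $1\le r_{m+1}<\infty$. (a) Let $1\le r_i\le p_i<\infty$ for $1\le i\le m-1$, let $1\le r_m<\infty$ and $p_m=r_m$, and assume $\frac1p=\sum_{i=1}^m\frac1{p_i}>\frac1{r_{m+1}'}$. Then $\vec w=(w_1,\dots,w_m)\in A_{\vec p,\vec r}^{\mathcal R}$ if and only if $(w_1,\dots,w_{m-1},1)\in A_{\vec p,\vec r}^{\mathcal R}$ and $w_m^{\varrho/r_m}\in A_1(\mu)$. (b) Let $1\le r_i\le p_i<\infty$ for $1\le i\le m$ and assume $\frac1p=\sum_{i=1}^m\frac1{p_i}>\frac1{r_{m+1}'}$. Assume that $(w_1,\dots,w_{m-1},1)\in A_{(p_1,\dots,p_{m-1},r_m),\vec r}^{\mathcal R}$ and that $W$ is a weight with $W^{\delta_{m+1}/r_m}\in\widehat A_{1+\frac{\delta_{m+1}}{\delta_m}}(\mu)$. If $w_m=W^{\frac{p_m}{r_m}}\mu^{-\frac{p_m}{\delta_m}}$, then $(w_1,\dots,w_m)\in A_{\vec p,\vec r}^{\mathcal R}$. Here $$\frac1\varrho=\frac1{r_m}-\frac1{r_{m+1}'}+\sum_{i=1}^{m-1}\frac1{p_i},\qquad \mu=\Big(\prod_{i=1}^{m-1}w_i^{\frac1{p_i}}\Big)^{\varrho},$$ and $\delta_m,\delta_{m+1}$ are given by $\frac1{\delta_m}=\frac1{r_m}-\frac1{p_m}$ and $\frac1{\delta_{m+1}}=\frac1p-\frac1{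r_{m+1}'}$.
   Context: A weight is an a.e. positive measurable function on $\mathbb R^n$. $r'$ is the conjugate exponent of $r$, with $1'=\infty$, $1/\infty=0$. Empty products equal $1$. $\|f\|_{L^{\delta,\infty}(\nu)}=\sup_{t>0}t\,\nu(\{|f|>t\})^{1/\delta}$. Class $A_{\vec p,\vec r}^{\mathcal R}$: let $\vec p=(p_1,\dots,p_m)$, $\vec r=(r_1,\dots,r_{m+1})$ with $1\le r_1,\dots,r_{m+1}<\infty$, $r_i\le p_i<\infty$ for $1\le i\le m$, $\frac1p=\sum_{i=1}^m\frac1{p_i}$, $p<r_{m+1}'$. Put $\frac1{p_{m+1}}=1-\frac1p$ and $\frac1{\delta_i}=\frac1{r_i}-\frac1{p_i}$ for $1\le i\le m+1$. For a vector of weights $\vec w=(w_1,\dots,w_m)$ set $w=\prod_{i=1}^m w_i^{p/p_i}$. Then $\vec w\in A_{\vec p,\vec r}^{\mathcal R}$ if $$\sup_Q\Big(\frac1{|Q|}\int_Q w^{\frac{\delta_{m+1}}p}\Big)^{\frac1{\delta_{m+1}}}\prod_{i=1}^m\big\|\chi_Q w_i^{-\frac1{p_i}}\big\|_{L^{\delta_i,\infty}\left(\frac{dx}{|Q|}\right)}<\infty,$$ the supremum being over all cubes $Q$ in $\mathbb R^n$, where, if $r_i=p_i$ (i.e. $\delta_i=\infty$), the $i$-th factor is $\operatorname{ess\,sup}_Q w_i^{-1/p_i}$. The class $A_{(p_1,\dots,p_{m-1},r_m),\vec r}^{\mathcal R}$ is this class with $p_m$ replaced by $r_m$ (and $p$,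 $\delta_i$ changed accordingly in its definition). For a weight $\mu$, viewed as the measure $\mu\,dx$: $M_\mu g(x)=\sup_{Q\ni x}\frac1{\mu(Q)}\int_Q|g|\,d\mu$; $u\in A_1(\mu)$ if $\sup_Q\frac{\frac1{\mu(Q)}\int_Q u\,d\mu}{\operatorname{ess\,inf}_Q u}<\infty$. For $1\le r<\infty$, a weight $v$ belongs to $\widehat A_r(\mu)$ if there are $u_1\in A_1(\mu)$ and a function $g$ with $M_\mu g(x)<\infty$ for a.e. $x$ such that $v=u_1(M_\mu g)^{1-r}$ (so $\widehat A_1(\mu)=A_1(\mu)$). *)

theory Defs
  imports "HOL-Probability.Essential_Supremum"
begin

definition weight :: "(real^'n \<Rightarrow> real) \<Rightarrow> bool" where
  "weight w \<longleftrightarrow> w \<in> borel_measurable lebesgue \<and> (AE x in lebesgue. 0 < w x)"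

text \<open>Non-degenerate cubes with sides parallel to the axes. Closed cubes are used; for a
  locally integrable \<open>\<mu>\<close> the notions below are the same with open cubes.\<close>

definition cubes :: "(real^'n) set set" where
  "cubes = {cbox a (\<chi> i. a $ i + l) | a l. 0 < l}"

text \<open>Real powers on \<open>[0, \<infinity>]\<close>, with \<open>x\<^sup>0 = 1\<close> for all \<open>x\<close> and \<open>0\<^sup>a = \<infinity>\<close>, \<open>\<infinity>\<^sup>a = 0\<close> for
  \<open>a < 0\<close>. Note that \<open>0 powr 0 = 0\<close> for the library's \<open>powr\<close>.\<close>

definition epow :: "ennreal \<Rightarrow> real \<Rightarrow> ennreal" where
  "epow x a =
     (if a = 0 then 1
      else if x = 0 then (if 0 < a then 0 else \<infinity>)
      else if x = \<infinity> then (if 0 < a then \<infinity> else 0)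
      else ennreal (enn2real x powr a))"

definition essinf :: "'a measure \<Rightarrow> ('a \<Rightarrow> ennreal) \<Rightarrow> ennreal" where
  "essinf M f = Sup {z. AE x in M. z \<le> f x}"

definition weak_norm :: "'a measure \<Rightarrow> real \<Rightarrow> ('a \<Rightarrow> real) \<Rightarrow> ennreal" where
  "weak_norm \<nu> \<delta> f =
     (SUP t\<in>{0<..}. ennreal t * epow (emeasure \<nu> {x \<in> space \<nu>. t < \<bar>f x\<bar>}) (1 / \<delta>))"

definition avg :: "(real^'n) measure \<Rightarrow> (real^'n) set \<Rightarrow> (real^'n \<Rightarrow> ennreal) \<Rightarrow> ennreal" where
  "avg \<nu> Q f = (\<integral>\<^sup>+x\<in>Q. f x \<partial>\<nu>) / emeasure \<nu> Q"

text \<open>Vectors such as \<open>(p\<^sub>1, \<dots>, p\<^sub>m)\<close> are functions on \<open>nat\<close> of which only the entries with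
  index in \<open>{1..m}\<close> (\<open>{1..m+1}\<close> for \<open>r\<close>) are used. Exponents that can be infinite enter only
  through their reciprocals: \<open>inv_p m p i\<close> is \<open>1/p\<^sub>i\<close> and \<open>inv_delta m p r i\<close> is \<open>1/\<delta>\<^sub>i\<close>, for
  \<open>1 \<le> i \<le> m + 1\<close>, where \<open>1/p\<^bsub>m+1\<^esub> = 1 - 1/p\<close> may be zero or negative. Since \<open>1/p = \<Sum> 1/p\<^sub>i\<close>,
  \<open>1/\<delta>\<^bsub>m+1\<^esub> = 1/r\<^bsub>m+1\<^esub> - 1 + 1/p = 1/p - 1/r'\<^bsub>m+1\<^esub>\<close>.\<close>

definition total_p :: "nat \<Rightarrow> (nat \<Rightarrow> real) \<Rightarrow> real" where
  "total_p m p = 1 / (\<Sum>i\<in>{1..m}. 1 / p i)"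

definition inv_p :: "nat \<Rightarrow> (nat \<Rightarrow> real) \<Rightarrow> nat \<Rightarrow> real" where
  "inv_p m p i = (if i = m + 1 then 1 - 1 / total_p m p else 1 / p i)"

definition inv_delta :: "nat \<Rightarrow> (nat \<Rightarrow> real) \<Rightarrow> (nat \<Rightarrow> real) \<Rightarrow> nat \<Rightarrow> real" where
  "inv_delta m p r i = 1 / r i - inv_p m p i"

text \<open>The reciprocal \<open>1/s'\<close> of the conjugate exponent, so that \<open>1/1' = 1/\<infinity> = 0\<close>.\<close>

definition inv_conj :: "real \<Rightarrow> real" where
  "inv_conj s = 1 - 1 / s"

definition prod_weight ::
  "nat \<Rightarrow> (nat \<Rightarrow> real) \<Rightarrow> (nat \<Rightarrow> real^'n \<Rightarrow> real) \<Rightarrow> real^'n \<Rightarrow> real" where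
  "prod_weight m p w x = (\<Prod>i\<in>{1..m}. w i x powr (total_p m p / p i))"

definition AR_factor ::
  "nat \<Rightarrow> (nat \<Rightarrow> real) \<Rightarrow> (nat \<Rightarrow> real) \<Rightarrow> (nat \<Rightarrow> real^'n \<Rightarrow> real) \<Rightarrow> (real^'n) set \<Rightarrow> nat \<Rightarrow> ennreal" where
  "AR_factor m p r w Q i =
     (if r i = p i
      then esssup (restrict_space lebesgue Q) (\<lambda>x. ennreal (w i x powr (- 1 / p i)))
      else weak_norm (scale_measure (1 / emeasure lebesgue Q) lebesgue)
             (1 / inv_delta m p r i) (\<lambda>x. indicator Q x * w i x powr (- 1 / p i)))"

text \<open>The conditions on the exponents
  (\<open>1 \<le> r\<^sub>i \<le> p\<^sub>i\<close> for \<open>i \<le> m\<close>, \<open>1 \<le> r\<^bsub>m+1\<^esub>\<close> and \<open>1/p > 1/r'\<^bsub>m+1\<^esub>\<close>) are not part of the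
  predicate and have to be assumed separately.\<close>

definition AR_class ::
  "nat \<Rightarrow> (nat \<Rightarrow> real) \<Rightarrow> (nat \<Rightarrow> real) \<Rightarrow> (nat \<Rightarrow> real^'n \<Rightarrow> real) set" where
  "AR_class m p r =
     {w. (\<forall>i\<in>{1..m}. weight (w i)) \<and>
         (SUP Q\<in>cubes.
            epow (avg lebesgue Q
                    (\<lambda>x. ennreal (prod_weight m p w x powr
                            ((1 / inv_delta m p r (m + 1)) / total_p m p))))
                 (inv_delta m p r (m + 1))
            * (\<Prod>i\<in>{1..m}. AR_factor m p r w Q i)) < \<infinity>}"

definition weight_measure :: "(real^'n \<Rightarrow> real) \<Rightarrow> (real^'n) measure" where
  "weight_measure \<mu> = density lebesgue (\<lambda>x. ennreal (\<mu> x))"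

definition maximal :: "(real^'n \<Rightarrow> real) \<Rightarrow> (real^'n \<Rightarrow> real) \<Rightarrow> real^'n \<Rightarrow> ennreal" where
  "maximal \<mu> g x = (SUP Q\<in>{Q \<in> cubes. x \<in> Q}. avg (weight_measure \<mu>) Q (\<lambda>y. ennreal \<bar>g y\<bar>))"

definition A1 :: "(real^'n \<Rightarrow> real) \<Rightarrow> (real^'n \<Rightarrow> real) set" where
  "A1 \<mu> =
     {u. weight u \<and>
         (SUP Q\<in>cubes. avg (weight_measure \<mu>) Q (\<lambda>y. ennreal (u y))
            / essinf (restrict_space lebesgue Q) (\<lambda>y. ennreal (u y))) < \<infinity>}"

definition A_hat :: "real \<Rightarrow> (real^'n \<Rightarrow> real) \<Rightarrow> (real^'n \<Rightarrow> real) set" where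
  "A_hat s \<mu> =
     {v. weight v \<and>
         (\<exists>u\<^sub>1\<in>A1 \<mu>. \<exists>g\<in>borel_measurable lebesgue.
            (AE x in lebesgue. maximal \<mu> g x < \<infinity>) \<and>
            (AE x in lebesgue. ennreal (v x) = ennreal (u\<^sub>1 x) * epow (maximal \<mu> g x) (1 - s)))}"

definition rho_exp :: "nat \<Rightarrow> (nat \<Rightarrow> real) \<Rightarrow> (nat \<Rightarrow> real) \<Rightarrow> real" where
  "rho_exp m p r = 1 / (1 / r m - inv_conj (r (m + 1)) + (\<Sum>i\<in>{1..<m}. 1 / p i))"

definition mu_weight ::
  "nat \<Rightarrow> (nat \<Rightarrow> real) \<Rightarrow> (nat \<Rightarrow> real) \<Rightarrow> (nat \<Rightarrow> real^'n \<Rightarrow> real) \<Rightarrow> real^'n \<Rightarrow> real" where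
  "mu_weight m p r w x = (\<Prod>i\<in>{1..<m}. w i x powr (1 / p i)) powr rho_exp m p r"

end

theory Submission
  imports Defs
begin

text \<open>Write \<open>u = w\<^sub>m\<^sup>\<rho>\<^sup>/\<^sup>r\<close> with \<open>r = r\<^sub>m\<close>. When \<open>p\<^sub>m = r\<^sub>m\<close>, the weight in the first factor is \<open>\<mu> u\<close> and the
  last factor is \<open>(ess inf\<^bsub>Q\<^esub> u)\<^bsup>-1/\<rho>\<^esup>\<close>; part (a) follows because a weak-type Hoelder inequality
  bounds \<open>(\<mu>(Q)/|Q|)\<^bsup>1/\<rho>\<^esup>\<close> times the first \<open>m - 1\<close> factors from below. The same inequality on subsets
  of \<open>Q\<close> shows that \<open>\<mu>\<close> is an \<open>A\<^sub>\<infinity>\<close> weight.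

  For part (b), write the given weight as \<open>u (M\<^sub>\<mu> g)\<^sup>-\<^sup>a\<close> with \<open>u\<close> in \<open>A\<^sub>1(\<mu>)\<close>, and let \<open>A\<close> be the infimum of
  \<open>M\<^sub>\<mu> g\<close> on \<open>Q\<close>. In the first factor \<open>M\<^sub>\<mu> g\<close> is bounded below by \<open>A\<close>. The last factor is controlled by the
  mixed weak-type estimate \<open>|{x \<in> Q. \<mu> M\<^sub>\<mu> g > t}| \<le> C A \<mu>(Q) / t\<close> of Sawyer type, and the powers of \<open>A\<close>
  cancel. The mixed estimate is proved by sorting the points by the size of \<open>M\<^sub>\<mu> g\<close> and by the
  density of \<open>g \<mu>\<close> on a nearly optimal cube; the sum over the densities converges because of the
  reverse Hoelder inequality for \<open>\<mu>\<close>.\<close>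

section \<open>Cubes\<close>

text \<open>Each factor is only an inequality, so every bound has to keep the exact power of each
  quantity; 1/\<rho> = 1/\<delta>_{m+1} + 1/\<delta>_m is the identity that makes the powers match.
  The converse in (a) is the case \<open>p m = r m\<close>, \<open>W = w m\<close> of (b), where the
  maximal function enters with exponent 0.

  The obstacle in (b) is that the level sets of the product \<mu> M_\<mu> g are measured by Lebesgue
  measure: the weak type of M_\<mu> is a bound in \<mu>-measure, and Chebyshev for \<mu> sees only
  one of the two factors. The infimum A makes the problem local. A cube containing Q has average at
  most M_\<mu> g(x) for every x in Q, hence at most A, so where M_\<mu> g exceeds a doubling
  multiple of A the relevant cubes are no larger than Q and lie in a dilate of Q.

  Level sets of M_\<mu> g are enclosed in measurable sets \<open>T\<close>, so the estimates for
  them are outer measure estimates and measurability of M_\<mu> g does not enter.\<close>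

definition cube :: "real^'n \<Rightarrow> real \<Rightarrow> (real^'n) set" where
  "cube a l = cbox a (\<chi> i. a $ i + l)"

lemma mem_cube: "x \<in> cube a l \<longleftrightarrow> (\<forall>i. a $ i \<le> x $ i \<and> x $ i \<le> a $ i + l)"
  by (simp add: cube_def mem_box_cart)

lemma cubes_eq: "cubes = {cube a l | a l. 0 < l}"
  by (simp add: cubes_def cube_def)

lemma cube_sets [measurable, simp]: "cube a l \<in> sets lebesgue"
  by (simp add: cube_def)

lemma emeasure_cube:
  fixes a :: "real^'n"
  assumes "0 \<le> l"
  shows "emeasure lebesgue (cube a l) = ennreal (l ^ CARD('n))"
proof -
  have "emeasure lborel (cube a l) = ennreal (\<Prod>b\<in>Basis. ((\<chi> i. a $ i + l) - a) \<bullet> b)"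
    unfolding cube_def using assms
    by (intro emeasure_lborel_cbox) (auto simp: Basis_vec_def inner_axis)
  also have "(\<Prod>b\<in>Basis. ((\<chi> i. a $ i + l) - a) \<bullet> b) = (\<Prod>b\<in>(Basis::(real^'n) set). l)"
    by (intro prod.cong) (auto simp: Basis_vec_def inner_axis)
  finally show ?thesis
    by (simp add: cube_def)
qed

lemma measure_cube:
  fixes a :: "real^'n"
  assumes "0 \<le> l"
  shows "measure lebesgue (cube a l) = l ^ CARD('n)"
  using assms by (intro measure_eq_emeasure_eq_ennreal emeasure_cube) auto

lemma measure_cube_pos: "0 < l \<Longrightarrow> 0 < measure lebesgue (cube a l)"
  by (simp add: measure_cube)

text \<open>Substitute for the dyadic parent: the corner moves down by \<open>h\<close> in each
  coordinate, but not past the face of the large cube. Iterating it gives the stopping argument in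
  \<open>stopping_cube\<close>.\<close>

lemma cube_subset_double:
  fixes a c :: "real^'n"
  assumes sub: "cube c h \<subseteq> cube a l" and h: "0 \<le> h" "2 * h \<le> l"
  obtains c' where "cube c h \<subseteq> cube c' (2 * h)" "cube c' (2 * h) \<subseteq> cube a l"
proof -
  have "c \<in> cube c h" "(\<chi> i. c $ i + h) \<in> cube c h"
    using h by (auto simp: mem_cube)
  then have "c \<in> cube a l" "(\<chi> i. c $ i + h) \<in> cube a l"
    using sub by blast+
  then have *: "a $ i \<le> c $ i" "c $ i + h \<le> a $ i + l" for i
    by (auto simp: mem_cube)
  define c' :: "real^'n" where "c' = (\<chi> i. max (a $ i) (c $ i - h))"
  have c': "c' $ i \<le> c $ i" "c $ i - h \<le> c' $ i" "a $ i \<le> c' $ i" "c' $ i + 2 * h \<le> a $ i + l" for i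
    using *[of i] h by (auto simp: c'_def max_def)
  show thesis
  proof
    show "cube c h \<subseteq> cube c' (2 * h)"
      unfolding subset_iff mem_cube using c' by (smt (verit))
    show "cube c' (2 * h) \<subseteq> cube a l"
      unfolding subset_iff mem_cube using c' by (smt (verit))
  qed
qed

text \<open>The size is such that \<open>dilated_cube a l\<close> contains the ball of radius \<open>5nl\<close> around \<open>a\<close>, and the
  ball of radius \<open>nl\<close> contains \<open>cube a l\<close>, so that the Vitali covering lemma for balls applies.\<close>

definition dilated_cube :: "real^'n \<Rightarrow> real \<Rightarrow> (real^'n) set" where
  "dilated_cube a l = cube (\<chi> i. a $ i - 5 * real CARD('n) * l) (10 * real CARD('n) * l)"

lemma dilated_cube_sets [measurable, simp]: "dilated_cube a l \<in> sets lebesgue"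
  by (simp add: dilated_cube_def)

lemma mem_dilated_cubeI:
  fixes a :: "real^'n"
  assumes "\<And>i. \<bar>x $ i - a $ i\<bar> \<le> 5 * real CARD('n) * l"
  shows "x \<in> dilated_cube a l"
  unfolding dilated_cube_def mem_cube
proof
  fix i show "(\<chi> i. a $ i - 5 * real CARD('n) * l) $ i \<le> x $ i \<and>
    x $ i \<le> (\<chi> i. a $ i - 5 * real CARD('n) * l) $ i + 10 * real CARD('n) * l"
    using assms[of i] by (simp add: abs_le_iff algebra_simps)
qed

lemma cube_subset_dilated_cube_meets:
  fixes a :: "real^'n"
  assumes "x \<in> cube a l" "x \<in> cube b h" "h \<le> l"
  shows "cube b h \<subseteq> dilated_cube a l"
proof
  fix y assume y: "y \<in> cube b h"
  have n: "1 \<le> real CARD('n)" by (simp add: Suc_leI)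
  show "y \<in> dilated_cube a l"
  proof (rule mem_dilated_cubeI)
    fix i
    have "\<bar>y $ i - a $ i\<bar> \<le> 2 * l"
      using assms y by (auto simp: mem_cube abs_le_iff) (smt (verit))+
    moreover have "2 * l \<le> 5 * real CARD('n) * l"
    proof -
      have "0 \<le> l" using assms(1) unfolding mem_cube by (meson order_trans le_add_same_cancel1)
      moreover have "2 \<le> 5 * real CARD('n)" using n by linarith
      ultimately show ?thesis by (intro mult_right_mono)
    qed
    ultimately show "\<bar>y $ i - a $ i\<bar> \<le> 5 * real CARD('n) * l" by linarith
  qed
qed

lemma cube_subset_dilated_cube: "cube a l \<subseteq> dilated_cube a l"
proof
  fix x assume "x \<in> cube a l"
  then show "x \<in> dilated_cube a l"
    using cube_subset_dilated_cube_meets[of x a l a l] by auto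
qed

lemma measure_dilated_cube:
  fixes a :: "real^'n"
  assumes "0 \<le> l"
  shows "measure lebesgue (dilated_cube a l)
    = (10 * real CARD('n)) ^ CARD('n) * measure lebesgue (cube a l)"
  using assms by (simp add: dilated_cube_def measure_cube power_mult_distrib)

lemma Vitali_covering_cubes:
  fixes a :: "'i \<Rightarrow> real^'n"
  assumes "\<And>i. i \<in> I \<Longrightarrow> 0 < l i \<and> l i \<le> B"
  obtains J where "countable J" "J \<subseteq> I" "disjoint_family_on (\<lambda>i. cube (a i) (l i)) J"
    "\<And>i. i \<in> I \<Longrightarrow> \<exists>j\<in>J. cube (a i) (l i) \<subseteq> dilated_cube (a j) (l j)"
proof -
  let ?n = "real CARD('n)"
  have "1 \<le> ?n" by (simp add: Suc_leI)
  then have r: "0 < ?n * l i \<and> ?n * l i \<le> ?n * B" if "i \<in> I" for i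
    using assms[OF that] by auto
  obtain J where J: "countable J" "J \<subseteq> I"
      "pairwise (\<lambda>i j. disjnt (cball (a i) (?n * l i)) (cball (a j) (?n * l j))) J"
      "\<And>i. i \<in> I \<Longrightarrow> \<exists>j. j \<in> J \<and> \<not> disjnt (cball (a i) (?n * l i)) (cball (a j) (?n * l j))
        \<and> cball (a i) (?n * l i) \<subseteq> ball (a j) (5 * (?n * l j))"
    by (rule Vitali_covering_lemma_cballs_balls[where a = a, OF r]) blast+
  have sub1: "cube b h \<subseteq> cball b (?n * h)" for b :: "real^'n" and h
  proof
    fix x assume x: "x \<in> cube b h"
    have "norm (x - b) \<le> (\<Sum>i\<in>UNIV. \<bar>(x - b) $ i\<bar>)" by (rule norm_le_l1_cart)
    also have "\<dots> \<le> (\<Sum>i\<in>(UNIV::'n set). h)"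
      using x by (intro sum_mono) (auto simp: mem_cube abs_le_iff, smt (verit))
    finally show "x \<in> cball b (?n * h)" by (simp add: dist_norm norm_minus_commute)
  qed
  have sub2: "ball b (5 * (?n * h)) \<subseteq> dilated_cube b h" for b :: "real^'n" and h
  proof
    fix x assume x: "x \<in> ball b (5 * (?n * h))"
    show "x \<in> dilated_cube b h"
    proof (rule mem_dilated_cubeI)
      fix i
      have "\<bar>(x - b) $ i\<bar> \<le> norm (x - b)" by (rule component_le_norm_cart)
      with x show "\<bar>x $ i - b $ i\<bar> \<le> 5 * ?n * h"
        by (simp add: dist_norm norm_minus_commute)
    qed
  qed
  show thesis
  proof
    show "disjoint_family_on (\<lambda>i. cube (a i) (l i)) J"
      using J(3) sub1 unfolding disjoint_family_on_def pairwise_def disjnt_def by blast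
    show "\<exists>j\<in>J. cube (a i) (l i) \<subseteq> dilated_cube (a j) (l j)" if "i \<in> I" for i
      using J(4)[OF that] sub1 sub2 by blast
  qed (use J in auto)
qed

text \<open>The summation step after every Vitali selection: subadditivity for the possibly
  overlapping \<open>T j\<close>, additivity for the disjoint \<open>X j\<close>. The two measures
  differ because volume, \<mu> and \<nu> are traded for one another.\<close>

lemma emeasure_UN_le_disjoint:
  assumes J: "countable J" and disj: "disjoint_family_on X J"
    and X: "\<And>j. j \<in> J \<Longrightarrow> X j \<in> sets N" and T: "\<And>j. j \<in> J \<Longrightarrow> T j \<in> sets M"
    and le: "\<And>j. j \<in> J \<Longrightarrow> emeasure M (T j) \<le> c * emeasure N (X j)"
  shows "emeasure M (\<Union>j\<in>J. T j) \<le> c * emeasure N (\<Union>j\<in>J. X j)"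
proof -
  let ?K = "to_nat_on J ` J"
  define T' where "T' n = (if n \<in> ?K then T (from_nat_into J n) else {})" for n
  define X' where "X' n = (if n \<in> ?K then X (from_nat_into J n) else {})" for n
  have TU: "(\<Union>j\<in>J. T j) = (\<Union>n. T' n)" and XU: "(\<Union>j\<in>J. X j) = (\<Union>n. X' n)"
    using J by (auto simp: T'_def X'_def)
  have T's: "range T' \<subseteq> sets M" and X's: "range X' \<subseteq> sets N"
    using J X T by (auto simp: T'_def X'_def)
  have "disjoint_family X'"
    unfolding disjoint_family_on_def
  proof (intro ballI impI)
    fix m n :: nat assume "m \<noteq> n"
    then show "X' m \<inter> X' n = {}"
      using J disj unfolding X'_def disjoint_family_on_def
      by (auto, metis disjoint_iff)
  qed
  have "emeasure M (\<Union>n. T' n) \<le> (\<Sum>n. emeasure M (T' n))"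
    by (rule emeasure_subadditive_countably[OF T's])
  also have "\<dots> \<le> (\<Sum>n. c * emeasure N (X' n))"
    using J le by (intro suminf_le) (auto simp: T'_def X'_def)
  also have "\<dots> = c * (\<Sum>n. emeasure N (X' n))" by simp
  also have "(\<Sum>n. emeasure N (X' n)) = emeasure N (\<Union>n. X' n)"
    by (rule suminf_emeasure[OF X's]) fact
  finally show ?thesis using TU XU by simp
qed

lemma emeasure_UN_nat_geometric_le:
  fixes T :: "nat \<Rightarrow> 'a set"
  assumes T: "\<And>n. T n \<in> sets M" and le: "\<And>n. emeasure M (T n) \<le> ennreal (c * x ^ n)"
    and x: "0 \<le> x" "x < 1" and c: "0 \<le> c"
  shows "emeasure M (\<Union>n. T n) \<le> ennreal (c / (1 - x))"
proof -
  have "emeasure M (\<Union>n. T n) \<le> (\<Sum>n. emeasure M (T n))"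
    using T by (intro emeasure_subadditive_countably) auto
  also have "\<dots> \<le> (\<Sum>n. ennreal (c * x ^ n))"
    using le by (intro suminf_le) auto
  also have "\<dots> = ennreal (c * (1 / (1 - x)))"
    using x c by (intro suminf_ennreal_eq sums_mult geometric_sums) auto
  finally show ?thesis by simp
qed

section \<open>A quantitative \<open>A\<^sub>\<infinity>\<close> condition\<close>

declare emeasure_completion [simp del]

lemma interior_cube: "interior (cube a l) = box a (\<chi> i. a $ i + l)"
  by (simp add: cube_def interior_cbox)

lemma emeasure_interior_cube:
  fixes a :: "real^'n"
  assumes "0 \<le> l"
  shows "emeasure lebesgue (interior (cube a l)) = ennreal (l ^ CARD('n))"
proof -
  have "emeasure lborel (box a (\<chi> i. a $ i + l)) = emeasure lborel (cbox a (\<chi> i. a $ i + l))"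
    by (simp add: emeasure_lborel_box_eq emeasure_lborel_cbox_eq)
  then show ?thesis
    using emeasure_cube[OF assms, of a] by (simp add: interior_cube cube_def emeasure_completion)
qed

lemma emeasure_subset_cube:
  assumes "E \<in> sets lebesgue" "E \<subseteq> cube a l" "0 \<le> l"
  shows "emeasure lebesgue E = ennreal (measure lebesgue E)"
proof -
  have "emeasure lebesgue E \<le> emeasure lebesgue (cube a l)"
    using assms by (intro emeasure_mono) auto
  also have "\<dots> < \<infinity>" using assms by (simp add: emeasure_cube)
  finally show ?thesis by (intro emeasure_eq_ennreal_measure) auto
qed

lemma sets_weight_measure [simp, measurable_cong]: "sets (weight_measure \<mu>) = sets lebesgue"
  and space_weight_measure [simp]: "space (weight_measure \<mu>) = UNIV"
  by (simp_all add: weight_measure_def)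

text \<open>The quantitative \<open>A\<^sub>\<infinity>\<close> condition below is the one of the restricted class \<open>A\<^sub>q\<^sup>\<R>\<close>.\<close>

locale A_infinity_weight =
  fixes \<mu> :: "real^'n \<Rightarrow> real" and C q :: real
  assumes weight: "weight \<mu>"
    and finite_cube: "\<And>a l. 0 < l \<Longrightarrow> emeasure (weight_measure \<mu>) (cube a l) < \<infinity>"
    and C_pos: "0 < C" and q_pos: "0 < q"
    and A_infinity: "\<And>a l E. \<lbrakk>0 < l; E \<in> sets lebesgue; E \<subseteq> cube a l\<rbrakk> \<Longrightarrow>
      measure lebesgue E powr q * measure (weight_measure \<mu>) (cube a l)
        \<le> C * measure lebesgue (cube a l) powr q * measure (weight_measure \<mu>) E"
begin

abbreviation vol :: "(real^'n) set \<Rightarrow> real" where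
  "vol \<equiv> measure lebesgue"

abbreviation m :: "(real^'n) set \<Rightarrow> real" where
  "m \<equiv> measure (weight_measure \<mu>)"

lemma measurable_mu [measurable]: "\<mu> \<in> borel_measurable lebesgue"
  using weight by (simp add: weight_def)

lemma AE_pos: "AE x in lebesgue. 0 < \<mu> x"
  using weight by (simp add: weight_def)

lemma emeasure_m: "E \<in> sets lebesgue \<Longrightarrow>
    emeasure (weight_measure \<mu>) E = (\<integral>\<^sup>+x\<in>E. ennreal (\<mu> x) \<partial>lebesgue)"
  unfolding weight_measure_def by (rule emeasure_density) auto

lemma emeasure_eq_m:
  assumes "E \<in> sets lebesgue" "E \<subseteq> cube a l" "0 < l"
  shows "emeasure (weight_measure \<mu>) E = ennreal (m E)"
proof -
  have "emeasure (weight_measure \<mu>) E \<le> emeasure (weight_measure \<mu>) (cube a l)"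
    using assms by (intro emeasure_mono) auto
  also have "\<dots> < \<infinity>" using assms finite_cube by simp
  finally show ?thesis by (intro emeasure_eq_ennreal_measure) auto
qed

lemma m_mono:
  assumes "E \<in> sets lebesgue" "E \<subseteq> F" "F \<in> sets lebesgue" "F \<subseteq> cube a l" "0 < l"
  shows "m E \<le> m F"
proof -
  have "ennreal (m E) \<le> ennreal (m F)"
    using assms by (subst (1 2) emeasure_eq_m[symmetric, of _ a l]) (auto intro: emeasure_mono)
  then show ?thesis by simp
qed

lemma vol_mono:
  assumes "E \<in> sets lebesgue" "E \<subseteq> F" "F \<in> sets lebesgue" "F \<subseteq> cube a l" "0 < l"
  shows "vol E \<le> vol F"
proof -
  have "ennreal (vol E) \<le> ennreal (vol F)"
    using assms by (subst (1 2) emeasure_subset_cube[symmetric, of _ a l]) (auto intro: emeasure_mono)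
  then show ?thesis by simp
qed

lemma m_Diff:
  assumes "E \<in> sets lebesgue" "E \<subseteq> F" "F \<in> sets lebesgue" "F \<subseteq> cube a l" "0 < l"
  shows "m (F - E) = m F - m E"
  using assms by (intro measure_Diff) (auto simp: emeasure_eq_m[of F a l])

lemma vol_Diff:
  assumes "E \<in> sets lebesgue" "E \<subseteq> F" "F \<in> sets lebesgue" "F \<subseteq> cube a l" "0 < l"
  shows "vol (F - E) = vol F - vol E"
  using assms by (intro measure_Diff) (auto simp: emeasure_subset_cube[of F a l])

lemma level_le:
  assumes E: "E \<in> sets lebesgue" "E \<subseteq> cube a l" "0 < l" and le: "\<And>x. x \<in> E \<Longrightarrow> \<mu> x \<le> t" "0 \<le> t"
  shows "m E \<le> t * vol E"
proof -
  have "ennreal (m E) = (\<integral>\<^sup>+x\<in>E. ennreal (\<mu> x) \<partial>lebesgue)"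
    using E emeasure_m emeasure_eq_m[of E a l] by simp
  also have "\<dots> \<le> (\<integral>\<^sup>+x\<in>E. ennreal t \<partial>lebesgue)"
    using le by (intro nn_integral_mono) (auto simp: indicator_def intro: ennreal_leI)
  also have "\<dots> = ennreal (t * vol E)"
    using E le emeasure_subset_cube[of E a l] by (simp add: nn_integral_cmult_indicator ennreal_mult)
  finally show ?thesis using le(2) by simp
qed

lemma level_ge:
  assumes E: "E \<in> sets lebesgue" "E \<subseteq> cube a l" "0 < l" and le: "\<And>x. x \<in> E \<Longrightarrow> t \<le> \<mu> x" "0 \<le> t"
  shows "t * vol E \<le> m E"
proof -
  have "ennreal (t * vol E) = (\<integral>\<^sup>+x\<in>E. ennreal t \<partial>lebesgue)"
    using E le emeasure_subset_cube[of E a l] by (simp add: nn_integral_cmult_indicator ennreal_mult)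
  also have "\<dots> \<le> (\<integral>\<^sup>+x\<in>E. ennreal (\<mu> x) \<partial>lebesgue)"
    using le by (intro nn_integral_mono) (auto simp: indicator_def intro: ennreal_leI)
  also have "\<dots> = ennreal (m E)"
    using E emeasure_m emeasure_eq_m[of E a l] by simp
  finally show ?thesis by simp
qed

lemma m_cube_pos:
  assumes "0 < l"
  shows "0 < m (cube a l)"
proof (rule ccontr)
  assume "\<not> 0 < m (cube a l)"
  then have "m (cube a l) = 0" using measure_nonneg[of "weight_measure \<mu>" "cube a l"] by linarith
  then have "emeasure (weight_measure \<mu>) (cube a l) = 0"
    using emeasure_eq_m[of "cube a l" a l] assms by simp
  then have "(\<integral>\<^sup>+x\<in>cube a l. ennreal (\<mu> x) \<partial>lebesgue) = 0"
    by (simp add: emeasure_m)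
  then have "AE x in lebesgue. ennreal (\<mu> x) * indicator (cube a l) x = 0"
    by (subst (asm) nn_integral_0_iff_AE) auto
  with AE_pos have "AE x in lebesgue. x \<notin> cube a l"
    by eventually_elim (auto simp: indicator_def split: if_splits)
  then have "emeasure lebesgue (cube a l) = 0"
    by (subst (asm) AE_iff_measurable[of "cube a l"]) auto
  then show False using assms by (simp add: emeasure_cube)
qed

section \<open>Doubling, comparison of volume with the weight, and stopping cubes\<close>

definition doubling_const :: real where
  "doubling_const = C * ((10 * real CARD('n)) ^ CARD('n)) powr q"

lemma doubling_const_pos: "0 < doubling_const"
  using C_pos by (simp add: doubling_const_def)

text \<open>The defining inequality with a cube as the subset of its own dilate; the volume ratio,
  raised to \<open>q\<close>, becomes part of the constant.\<close>

lemma doubling: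
  assumes "0 < l"
  shows "m (dilated_cube a l) \<le> doubling_const * m (cube a l)"
proof -
  let ?a = "\<chi> i. a $ i - 5 * real CARD('n) * l" and ?l = "10 * real CARD('n) * l"
  have l: "0 < ?l" using assms by simp
  have "vol (cube a l) powr q * m (dilated_cube a l)
      \<le> C * vol (dilated_cube a l) powr q * m (cube a l)"
    using A_infinity[OF l, of "cube a l" ?a] cube_subset_dilated_cube[of a l]
    by (simp add: dilated_cube_def)
  also have "vol (dilated_cube a l) powr q
      = ((10 * real CARD('n)) ^ CARD('n)) powr q * vol (cube a l) powr q"
    using assms by (simp add: measure_dilated_cube powr_mult)
  finally have "vol (cube a l) powr q * m (dilated_cube a l)
      \<le> vol (cube a l) powr q * (doubling_const * m (cube a l))"
    by (simp add: doubling_const_def mult_ac)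
  moreover have "0 < vol (cube a l) powr q" using measure_cube_pos[OF assms, of a] by simp
  ultimately show ?thesis by (rule mult_left_le_imp_le)
qed

text \<open>The defining inequality solved for the volume: a small \<mu>-fraction forces a small
  volume fraction. This produces the geometric decay in
  \<open>cover_within_dilated_cube\<close>.\<close>

lemma vol_le_m:
  assumes "0 < l" "E \<in> sets lebesgue" "E \<subseteq> cube a l"
  shows "vol E \<le> (C * m E / m (cube a l)) powr (1 / q) * vol (cube a l)"
proof -
  note p = m_cube_pos[OF assms(1), of a] measure_cube_pos[OF assms(1), of a]
  have "vol E powr q \<le> C * m E / m (cube a l) * vol (cube a l) powr q"
    using A_infinity[OF assms] p by (simp add: field_simps)
  then have "(vol E powr q) powr (1 / q) \<le> (C * m E / m (cube a l) * vol (cube a l) powr q) powr (1 / q)"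
    using q_pos by (intro powr_mono2) auto
  also have "\<dots> = (C * m E / m (cube a l)) powr (1 / q) * vol (cube a l)"
    using p C_pos q_pos by (subst powr_mult) (auto simp: powr_powr)
  finally show ?thesis using q_pos by (simp add: powr_powr)
qed

lemma m_ge_of_half:
  assumes "0 < l" "E \<in> sets lebesgue" "E \<subseteq> cube a l" "vol (cube a l) \<le> 2 * vol E"
  shows "m (cube a l) \<le> C * 2 powr q * m E"
proof -
  note p = measure_cube_pos[OF assms(1), of a]
  have "(vol (cube a l) / 2) powr q * m (cube a l) \<le> vol E powr q * m (cube a l)"
    using assms q_pos by (intro mult_right_mono powr_mono2) auto
  also have "\<dots> \<le> C * vol (cube a l) powr q * m E"
    by (rule A_infinity[OF assms(1-3)])
  finally have "vol (cube a l) powr q * m (cube a l) \<le> vol (cube a l) powr q * (C * 2 powr q * m E)"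
    by (simp add: powr_divide field_simps)
  moreover have "0 < vol (cube a l) powr q" using p by simp
  ultimately show ?thesis by (rule mult_left_le_imp_le)
qed

text \<open>Double the cube inside the large one as long as the density stays above
  \<open>t\<close>. This ends within \<open>k\<close> steps, because after \<open>k\<close>
  doublings the cube would be the large one, whose density is at most \<open>t\<close>. When it
  ends, the double has density at most \<open>t\<close> and 2^n times the volume, hence the upper
  bound.\<close>

lemma stopping_cube:
  assumes "0 < l" "cube c h \<subseteq> cube a l" "h = l / 2 ^ k" "t * vol (cube c h) < m (cube c h)"
    and top: "m (cube a l) \<le> t * vol (cube a l)"
  shows "\<exists>c' h'. 0 < h' \<and> h' \<le> l \<and> cube c h \<subseteq> cube c' h' \<and> cube c' h' \<subseteq> cube a l \<and>
    t * vol (cube c' h') < m (cube c' h') \<and> m (cube c' h') \<le> 2 ^ CARD('n) * t * vol (cube c' h')"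
  using assms(2-4)
proof (induction k arbitrary: c h)
  case 0
  have "c \<in> cube c h" "(\<chi> i. c $ i + h) \<in> cube c h"
    using 0 \<open>0 < l\<close> by (auto simp: mem_cube)
  with 0 have "c \<in> cube a l" "(\<chi> i. c $ i + l) \<in> cube a l"
    by auto
  \<comment> \<open>Two cubes of equal side, one inside the other, coincide; so the density
    hypothesis contradicts \<open>top\<close>.\<close>
  then have "c = a" by (auto simp: mem_cube vec_eq_iff intro!: antisym)
  with 0 top show ?case by simp
next
  case (Suc k)
  have "0 < h" using Suc.prems(2) \<open>0 < l\<close> by simp
  have "(1::real) \<le> 2 ^ k" by simp
  then have "l / 2 ^ k \<le> l / 1" using \<open>0 < l\<close> by (intro divide_left_mono) auto
  with Suc.prems(2) \<open>0 < h\<close> have h: "0 < h" "h \<le> l" and h2: "2 * h = l / 2 ^ k" "2 * h \<le> l"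
    by auto
  obtain d where d: "cube c h \<subseteq> cube d (2 * h)" "cube d (2 * h) \<subseteq> cube a l"
    using cube_subset_double[OF Suc.prems(1)] h h2 by auto
  show ?case
  proof (cases "t * vol (cube d (2 * h)) < m (cube d (2 * h))")
    case True
    from Suc.IH[OF d(2) h2(1) True] d(1) show ?thesis by (meson order_trans)
  next
    case False
    have "m (cube c h) \<le> m (cube d (2 * h))"
      using d h by (intro m_mono[of _ _ d "2 * h"]) auto
    also have "\<dots> \<le> t * vol (cube d (2 * h))" using False by simp
    also have "vol (cube d (2 * h)) = 2 ^ CARD('n) * vol (cube c h)"
      using h by (simp add: measure_cube power_mult_distrib)
    finally show ?thesis using Suc.prems h
      by (intro exI[of _ c] exI[of _ h]) (simp add: mult_ac)
  qed
qed


section \<open>The reverse Hoelder inequality\<close>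

text \<open>Constants of the hole-filling argument at level \<open>t\<close>.
  \<open>stop_const\<close> is twice the loss in \<open>m_ge_of_half\<close>, so that the mass of
  the points with \<mu> \<le> t can be absorbed. \<open>level_ratio\<close> is twice the upper
  density bound of a stopping cube at level \<open>stop_const * t\<close>, so that \<mu> exceeds
  \<open>level_ratio * t\<close> on at most half of its volume.\<close>

definition stop_const :: real where "stop_const = 2 * (C * 2 powr q)"
definition level_ratio :: real where "level_ratio = 2 ^ CARD('n) * 2 * stop_const"
definition hole_const :: real where "hole_const = doubling_const * stop_const"

lemma C_ge_1: "1 \<le> C"
proof -
  let ?Q = "cube (0::real^'n) 1"
  have p: "0 < m ?Q" "0 < vol ?Q" by (auto intro: m_cube_pos measure_cube_pos)
  have "1 * (vol ?Q powr q * m ?Q) \<le> C * (vol ?Q powr q * m ?Q)"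
    using A_infinity[of 1 ?Q 0] by (simp add: mult_ac)
  moreover have "0 < vol ?Q powr q * m ?Q" using p by simp
  ultimately show ?thesis by (rule mult_right_le_imp_le)
qed

lemma stop_const_ge: "2 \<le> stop_const"
proof -
  have "1 * 1 \<le> C * 2 powr q"
    using C_ge_1 q_pos by (intro mult_mono ge_one_powr_ge_zero) auto
  then show ?thesis by (simp add: stop_const_def)
qed

lemma level_ratio_gt: "1 < level_ratio"
proof -
  have "1 * 1 * 2 \<le> level_ratio"
    unfolding level_ratio_def using stop_const_ge by (intro mult_mono) auto
  then show ?thesis by simp
qed

lemma hole_const_pos: "0 < hole_const"
  using stop_const_ge doubling_const_pos by (simp add: hole_const_def)

lemma stop_const_le_level_ratio: "2 * stop_const \<le> level_ratio"
proof -
  have "1 * (2 * stop_const) \<le> 2 ^ CARD('n) * (2 * stop_const)"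
    using stop_const_ge by (intro mult_right_mono) auto
  then show ?thesis by (simp add: level_ratio_def mult_ac)
qed

text \<open>By Chebyshev the points with \<mu> > \<open>level_ratio * t\<close> fill at most half of
  the volume, so the others carry at least the fraction 2/\<open>stop_const\<close> of the mass.
  Those with \<mu> \<le> t carry at most the fraction 1/\<open>stop_const\<close>, since the density
  exceeds \<open>stop_const * t\<close>. The difference remains for the middle layer, and doubling
  passes to the dilate.\<close>

lemma hole_filling_cube:
  assumes "0 < h" "0 < t" "stop_const * t * vol (cube c h) < m (cube c h)"
    "m (cube c h) \<le> 2 ^ CARD('n) * (stop_const * t) * vol (cube c h)"
  shows "m (dilated_cube c h) \<le> hole_const * m {x \<in> cube c h. t < \<mu> x \<and> \<mu> x \<le> level_ratio * t}"
proof -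
  let ?P = "cube c h"
  let ?F = "{x \<in> ?P. level_ratio * t < \<mu> x}" and ?L = "{x \<in> ?P. \<mu> x \<le> t}"
  have sets: "?F \<in> sets lebesgue" "?L \<in> sets lebesgue" "{x \<in> ?P. t < \<mu> x \<and> \<mu> x \<le> level_ratio * t} \<in> sets lebesgue"
    by measurable
  have "level_ratio * t * vol ?F \<le> m ?F"
    using assms level_ratio_gt sets by (intro level_ge[of _ c h]) auto
  also have "\<dots> \<le> m ?P"
    using assms sets by (intro m_mono[of _ _ c h]) auto
  also have "\<dots> \<le> level_ratio * t * (vol ?P / 2)"
    using assms(4) by (simp add: level_ratio_def field_simps)
  finally have "level_ratio * t * vol ?F \<le> level_ratio * t * (vol ?P / 2)" .
  moreover have "0 < level_ratio * t" using level_ratio_gt assms by simp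
  ultimately have "vol ?F \<le> vol ?P / 2" by (rule mult_left_le_imp_le)
  moreover have "vol (?P - ?F) = vol ?P - vol ?F"
    using assms sets by (intro vol_Diff[of _ _ c h]) auto
  ultimately have "vol ?P \<le> 2 * vol (?P - ?F)" by simp
  then have "m ?P \<le> C * 2 powr q * m (?P - ?F)"
    using assms sets by (intro m_ge_of_half) auto
  also have "\<dots> = stop_const / 2 * m (?P - ?F)" by (simp add: stop_const_def)
  finally have 1: "2 * m ?P \<le> stop_const * m (?P - ?F)" by simp
  have eq: "?P - ?F = ?L \<union> {x \<in> ?P. t < \<mu> x \<and> \<mu> x \<le> level_ratio * t}"
  proof -
    have "t \<le> level_ratio * t" using level_ratio_gt assms by simp
    then show ?thesis by auto
  qed
  have "stop_const * m ?L \<le> stop_const * (t * vol ?L)"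
    using assms sets stop_const_ge by (intro mult_left_mono level_le[of _ c h]) auto
  also have "\<dots> \<le> stop_const * (t * vol ?P)"
    using assms sets stop_const_ge by (intro mult_left_mono vol_mono[of _ _ c h]) auto
  also have "\<dots> \<le> m ?P" using assms(3) by (simp add: mult_ac)
  finally have 2: "stop_const * m ?L \<le> m ?P" .
  have "m (?P - ?F) \<le> m ?L + m {x \<in> ?P. t < \<mu> x \<and> \<mu> x \<le> level_ratio * t}"
    unfolding eq using sets by (intro measure_Un_le) auto
  then have "stop_const * m (?P - ?F) \<le> stop_const * (m ?L + m {x \<in> ?P. t < \<mu> x \<and> \<mu> x \<le> level_ratio * t})"
    using stop_const_ge by (intro mult_left_mono) auto
  with 1 2 have "m ?P \<le> stop_const * m {x \<in> ?P. t < \<mu> x \<and> \<mu> x \<le> level_ratio * t}"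
    by (simp add: distrib_left)
  then have "doubling_const * m ?P \<le> hole_const * m {x \<in> ?P. t < \<mu> x \<and> \<mu> x \<le> level_ratio * t}"
    using doubling_const_pos by (simp add: hole_const_def mult.assoc)
  with doubling[OF assms(1), of c] show ?thesis by linarith
qed

text \<open>Up to a set of small \<open>\<mu>\<close>-measure, the set where \<open>\<mu>\<close> exceeds \<open>level_ratio * t\<close> is covered by small
  cubes of high density, which are enlarged to stopping cubes. Vitali covering loses a factor; it is
  absorbed by putting only the part with \<open>\<mu> \<le> level_ratio * t\<close> on the right-hand side.\<close>

lemma hole_filling:
  assumes l: "0 < l" and t: "m (cube a l) \<le> t * vol (cube a l)"
  shows "m {x \<in> cube a l. level_ratio * t < \<mu> x} \<le> hole_const * m {x \<in> cube a l. t < \<mu> x \<and> \<mu> x \<le> level_ratio * t}"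
proof (rule field_le_epsilon)
  fix e :: real assume e: "0 < e"
  let ?Q = "cube a l"
  define F where "F = {x \<in> ?Q. level_ratio * t < \<mu> x}"
  define G where "G = {x \<in> ?Q. t < \<mu> x \<and> \<mu> x \<le> level_ratio * t}"
  have t0: "0 < t"
  proof (rule ccontr)
    assume "\<not> 0 < t"
    then have "t * vol ?Q \<le> 0" by (intro mult_nonpos_nonneg) auto
    with t m_cube_pos[OF l, of a] show False by simp
  qed
  have sets: "F \<in> sets lebesgue" "G \<in> sets lebesgue"
    unfolding F_def G_def by measurable
  \<comment> \<open>Chosen so that the final bound \<open>2 * stop_const * t * d\<close> for the
    low-density cubes is exactly \<open>e\<close>.\<close>
  define d where "d = e / (2 * stop_const * t)"
  have d: "0 < d" using e t0 stop_const_ge by (simp add: d_def)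
  obtain U where U: "open U" "F \<subseteq> U" "U - F \<in> lmeasurable" "emeasure lebesgue (U - F) < ennreal d"
    using sets_lebesgue_outer_open[OF sets(1) d] .
  \<comment> \<open>Each covering cube lies in \<open>g x\<close> for one of its points
    \<open>x\<close> in \<open>F\<close>. This gauge thus forces all of them into the open set
    \<open>U\<close>, which exceeds \<open>F\<close> by little.\<close>
  define g where "g x = (if x \<in> U then U else UNIV)" for x
  have "gauge g" using U(1) by (auto simp: gauge_def g_def)
  have box: "box a (\<chi> i. a $ i + l) \<noteq> {}"
    using l by (simp add: box_ne_empty inner_axis Basis_vec_def)
  obtain \<D> where D: "countable \<D>" "\<Union>\<D> \<subseteq> cbox a (\<chi> i. a $ i + l)"
      "\<And>K. K \<in> \<D> \<Longrightarrow> interior K \<noteq> {} \<and> (\<exists>c d. K = cbox c d)"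
      "pairwise (\<lambda>A B. interior A \<inter> interior B = {}) \<D>"
      "\<And>K. K \<in> \<D> \<Longrightarrow> \<exists>x \<in> F \<inter> K. K \<subseteq> g x"
      "\<And>u v. cbox u v \<in> \<D> \<Longrightarrow> \<exists>n. \<forall>i \<in> Basis. v \<bullet> i - u \<bullet> i = ((\<chi> i. a $ i + l) \<bullet> i - a \<bullet> i) / 2^n"
      "F \<subseteq> \<Union>\<D>"
    by (rule covering_lemma[OF _ box \<open>gauge g\<close>, of F]) (auto simp: F_def cube_def)
  have cubeD: "\<exists>c n. K = cube c (l / 2 ^ n)" if K: "K \<in> \<D>" for K
  proof -
    obtain c d where cd: "K = cbox c d" using D(3)[OF K] by auto
    with D(6) K obtain n where n: "\<forall>i \<in> Basis. d \<bullet> i - c \<bullet> i = ((\<chi> i. a $ i + l) \<bullet> i - a \<bullet> i) / 2^n"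
      by blast
    have "d $ i - c $ i = l / 2 ^ n" for i
      using n[rule_format, of "axis i 1"] by (simp add: inner_axis axis_in_Basis_iff)
    then have "d = (\<chi> i. c $ i + l / 2 ^ n)"
      by (simp add: vec_eq_iff) (metis add.commute diff_add_cancel)
    with cd show ?thesis by (auto simp: cube_def)
  qed
  have subQ: "K \<subseteq> ?Q" if "K \<in> \<D>" for K
    using D(2) that by (auto simp: cube_def)
  have subU: "K \<subseteq> U" if "K \<in> \<D>" for K
  proof -
    obtain x where "x \<in> F" "K \<subseteq> g x" using D(5)[OF \<open>K \<in> \<D>\<close>] by blast
    moreover from this U(2) have "g x = U" by (auto simp: g_def)
    ultimately show ?thesis by simp
  qed
  have Kset: "K \<in> sets lebesgue" if "K \<in> \<D>" for K
    using cubeD[OF that] by auto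
  \<comment> \<open>Cubes of low density. In them \<open>F\<close> fills at most half of the volume,
    by Chebyshev, so their volume is at most twice that of their part in \<open>U - F\<close>, which
    is small; their contribution is the error \<open>e\<close>.\<close>
  define \<B> where "\<B> = {K \<in> \<D>. m K \<le> stop_const * t * vol K}"
  have "emeasure (weight_measure \<mu>) (\<Union>K\<in>\<B>. K \<inter> F)
      \<le> ennreal (2 * stop_const * t) * emeasure lebesgue (\<Union>K\<in>\<B>. interior K - F)"
  proof (rule emeasure_UN_le_disjoint)
    show "countable \<B>" using D(1) by (auto simp: \<B>_def)
    show "disjoint_family_on (\<lambda>K. interior K - F) \<B>"
      using D(4) unfolding disjoint_family_on_def pairwise_def \<B>_def by blast
    fix K assume K: "K \<in> \<B>"
    then have KD: "K \<in> \<D>" by (simp add: \<B>_def)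
    show "interior K - F \<in> sets lebesgue" "K \<inter> F \<in> sets (weight_measure \<mu>)"
      using Kset[OF KD] sets by auto
    obtain c n where cn: "K = cube c (l / 2 ^ n)" using cubeD[OF KD] by auto
    define h where "h = l / 2 ^ n"
    have h: "0 < h" and K_eq: "K = cube c h" using l cn by (auto simp: h_def)
    \<comment> \<open>The covering cubes may share faces; only their interiors are disjoint, so the
      volume is measured there.\<close>
    have volint: "vol (interior K) = vol K"
      using h unfolding K_eq
      by (subst measure_eq_emeasure_eq_ennreal[OF _ emeasure_interior_cube]) (auto simp: measure_cube)
    have intK: "interior K \<subseteq> cube c h" using K_eq interior_subset by auto
    have intsets: "interior K \<in> sets lebesgue" by auto
    have mK: "m (K \<inter> F) \<le> stop_const * t * vol K"
    proof -
      have "m (K \<inter> F) \<le> m K" using K_eq sets h by (intro m_mono[of _ _ c h]) auto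
      with K show ?thesis by (simp add: \<B>_def)
    qed
    have "level_ratio * t * vol (K \<inter> F) \<le> m (K \<inter> F)"
      using K_eq sets h t0 level_ratio_gt by (intro level_ge[of _ c h]) (auto simp: F_def)
    also note mK
    also have "stop_const * t * vol K \<le> level_ratio * t * (vol K / 2)"
      using mult_right_mono[OF stop_const_le_level_ratio, of "t * vol K"] t0 by (simp add: mult_ac)
    finally have "level_ratio * t * vol (K \<inter> F) \<le> level_ratio * t * (vol K / 2)" .
    moreover have "0 < level_ratio * t" using level_ratio_gt t0 by simp
    ultimately have "vol (K \<inter> F) \<le> vol K / 2" by (rule mult_left_le_imp_le)
    moreover have "vol (interior K \<inter> F) \<le> vol (K \<inter> F)"
      using K_eq sets h intK by (intro vol_mono[of _ _ c h]) auto
    moreover have "vol (interior K - F) = vol (interior K) - vol (interior K \<inter> F)"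
      using vol_Diff[of "interior K \<inter> F" "interior K" c h] intK sets h intsets
      by (simp add: Diff_Int)
    ultimately have "vol K \<le> 2 * vol (interior K - F)" using volint by linarith
    then have "stop_const * t * vol K \<le> stop_const * t * (2 * vol (interior K - F))"
      using stop_const_ge t0 by (intro mult_left_mono) auto
    with mK have "m (K \<inter> F) \<le> 2 * stop_const * t * vol (interior K - F)" by simp
    then have "ennreal (m (K \<inter> F)) \<le> ennreal (2 * stop_const * t) * ennreal (vol (interior K - F))"
      using stop_const_ge t0 by (simp add: ennreal_mult[symmetric])
    moreover have "emeasure (weight_measure \<mu>) (K \<inter> F) = ennreal (m (K \<inter> F))"
      using K_eq sets h by (intro emeasure_eq_m[of _ c h]) auto
    moreover have "emeasure lebesgue (interior K - F) = ennreal (vol (interior K - F))"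
      using intK intsets sets h by (intro emeasure_subset_cube[of _ c h]) auto
    ultimately show "emeasure (weight_measure \<mu>) (K \<inter> F)
        \<le> ennreal (2 * stop_const * t) * emeasure lebesgue (interior K - F)" by simp
  qed
  also have "\<dots> \<le> ennreal (2 * stop_const * t) * emeasure lebesgue (U - F)"
  proof (intro mult_left_mono emeasure_mono)
    show "(\<Union>K\<in>\<B>. interior K - F) \<subseteq> U - F"
      using subU interior_subset unfolding \<B>_def by blast
  qed (use U in auto)
  also have "\<dots> \<le> ennreal (2 * stop_const * t) * ennreal d"
    using U(4) by (intro mult_left_mono) auto
  also have "\<dots> = ennreal e"
    using stop_const_ge t0 d by (simp add: ennreal_mult[symmetric] d_def)
  finally have bad: "emeasure (weight_measure \<mu>) (\<Union>K\<in>\<B>. K \<inter> F) \<le> ennreal e" .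

  have "\<forall>K\<in>\<D> - \<B>. \<exists>c h. 0 < h \<and> h \<le> l \<and> K \<subseteq> cube c h \<and> cube c h \<subseteq> ?Q \<and>
    stop_const * t * vol (cube c h) < m (cube c h) \<and> m (cube c h) \<le> 2 ^ CARD('n) * (stop_const * t) * vol (cube c h)"
  proof
    fix K assume K: "K \<in> \<D> - \<B>"
    then obtain c n where cn: "K = cube c (l / 2 ^ n)" using cubeD by blast
    \<comment> \<open>The large cube must violate the stopping level \<open>stop_const * t\<close>,
      which holds since \<open>stop_const\<close> is at least 1.\<close>
    have "1 * (t * vol ?Q) \<le> stop_const * (t * vol ?Q)"
      using stop_const_ge t0 by (intro mult_right_mono) auto
    with t have "m ?Q \<le> stop_const * t * vol ?Q" by (simp add: mult_ac)
    moreover have "stop_const * t * vol K < m K" using K unfolding \<B>_def by auto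
    moreover have "K \<subseteq> ?Q" using subQ K by simp
    ultimately show "\<exists>c h. 0 < h \<and> h \<le> l \<and> K \<subseteq> cube c h \<and> cube c h \<subseteq> ?Q \<and>
      stop_const * t * vol (cube c h) < m (cube c h) \<and> m (cube c h) \<le> 2 ^ CARD('n) * (stop_const * t) * vol (cube c h)"
      using stopping_cube[OF l, of c "l / 2 ^ n" a n "stop_const * t"] cn by simp
  qed
  then obtain pc ph where P: "\<And>K. K \<in> \<D> - \<B> \<Longrightarrow> 0 < ph K \<and> ph K \<le> l \<and> K \<subseteq> cube (pc K) (ph K)
    \<and> cube (pc K) (ph K) \<subseteq> ?Q \<and> stop_const * t * vol (cube (pc K) (ph K)) < m (cube (pc K) (ph K))
    \<and> m (cube (pc K) (ph K)) \<le> 2 ^ CARD('n) * (stop_const * t) * vol (cube (pc K) (ph K))"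
    by metis
  obtain J where J: "countable J" "J \<subseteq> \<D> - \<B>" "disjoint_family_on (\<lambda>i. cube (pc i) (ph i)) J"
    "\<And>i. i \<in> \<D> - \<B> \<Longrightarrow> \<exists>j\<in>J. cube (pc i) (ph i) \<subseteq> dilated_cube (pc j) (ph j)"
    using Vitali_covering_cubes[of "\<D> - \<B>" ph l pc] P by (metis (no_types, lifting))
  \<comment> \<open>The dilates cover the remaining part of \<open>F\<close>, but each is paid for
    by the middle layer inside its undilated cube, and those pieces are disjoint.\<close>
  have "emeasure (weight_measure \<mu>) (\<Union>j\<in>J. dilated_cube (pc j) (ph j))
      \<le> ennreal hole_const * emeasure (weight_measure \<mu>) (\<Union>j\<in>J. cube (pc j) (ph j) \<inter> G)"
  proof (rule emeasure_UN_le_disjoint)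
    show "disjoint_family_on (\<lambda>j. cube (pc j) (ph j) \<inter> G) J"
      using J(3) unfolding disjoint_family_on_def by blast
    fix j assume j: "j \<in> J"
    let ?P = "cube (pc j) (ph j)"
    have Pj: "0 < ph j" "?P \<subseteq> ?Q" "stop_const * t * vol ?P < m ?P" "m ?P \<le> 2 ^ CARD('n) * (stop_const * t) * vol ?P"
      using P J(2) j by auto
    show "?P \<inter> G \<in> sets (weight_measure \<mu>)" "dilated_cube (pc j) (ph j) \<in> sets (weight_measure \<mu>)"
      using sets by auto
    have "m (dilated_cube (pc j) (ph j)) \<le> hole_const * m {x \<in> ?P. t < \<mu> x \<and> \<mu> x \<le> level_ratio * t}"
      by (rule hole_filling_cube[OF Pj(1) t0 Pj(3,4)])
    also have "{x \<in> ?P. t < \<mu> x \<and> \<mu> x \<le> level_ratio * t} = ?P \<inter> G"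
      using Pj(2) by (auto simp: G_def)
    finally have "ennreal (m (dilated_cube (pc j) (ph j))) \<le> ennreal hole_const * ennreal (m (?P \<inter> G))"
      using hole_const_pos by (simp add: ennreal_mult[symmetric])
    moreover have "emeasure (weight_measure \<mu>) (?P \<inter> G) = ennreal (m (?P \<inter> G))"
      using Pj sets by (intro emeasure_eq_m[of _ "pc j" "ph j"]) auto
    moreover have "emeasure (weight_measure \<mu>) (dilated_cube (pc j) (ph j)) = ennreal (m (dilated_cube (pc j) (ph j)))"
      unfolding dilated_cube_def using Pj(1) by (intro emeasure_eq_m[OF _ order_refl]) auto
    ultimately show "emeasure (weight_measure \<mu>) (dilated_cube (pc j) (ph j))
        \<le> ennreal hole_const * emeasure (weight_measure \<mu>) (?P \<inter> G)" by simp
  qed (use J in auto)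
  also have "\<dots> \<le> ennreal hole_const * emeasure (weight_measure \<mu>) G"
    using sets by (intro mult_left_mono emeasure_mono) auto
  also have "\<dots> = ennreal (hole_const * m G)"
    using hole_const_pos sets l emeasure_eq_m[of G a l] by (simp add: G_def ennreal_mult)
  finally have good: "emeasure (weight_measure \<mu>) (\<Union>j\<in>J. dilated_cube (pc j) (ph j)) \<le> ennreal (hole_const * m G)" .

  have "F \<subseteq> (\<Union>j\<in>J. dilated_cube (pc j) (ph j)) \<union> (\<Union>K\<in>\<B>. K \<inter> F)"
  proof
    fix x assume x: "x \<in> F"
    with D(7) obtain K where K: "K \<in> \<D>" "x \<in> K" by auto
    show "x \<in> (\<Union>j\<in>J. dilated_cube (pc j) (ph j)) \<union> (\<Union>K\<in>\<B>. K \<inter> F)"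
    proof (cases "K \<in> \<B>")
      case False
      with K have "K \<in> \<D> - \<B>" by simp
      from J(4)[OF this] P[OF this] K show ?thesis by blast
    qed (use K x in auto)
  qed
  moreover have "countable \<B>" using D(1) by (auto simp: \<B>_def)
  then have Bsets: "(\<Union>K\<in>\<B>. K \<inter> F) \<in> sets lebesgue"
    using Kset sets by (intro sets.countable_UN') (auto simp: \<B>_def)
  moreover have Jsets: "(\<Union>j\<in>J. dilated_cube (pc j) (ph j)) \<in> sets lebesgue"
    using J(1) by (intro sets.countable_UN') auto
  ultimately have "emeasure (weight_measure \<mu>) F
      \<le> emeasure (weight_measure \<mu>) ((\<Union>j\<in>J. dilated_cube (pc j) (ph j)) \<union> (\<Union>K\<in>\<B>. K \<inter> F))"
    by (intro emeasure_mono) auto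
  also have "\<dots> \<le> emeasure (weight_measure \<mu>) (\<Union>j\<in>J. dilated_cube (pc j) (ph j))
      + emeasure (weight_measure \<mu>) (\<Union>K\<in>\<B>. K \<inter> F)"
    using Bsets Jsets by (intro emeasure_subadditive) auto
  also have "\<dots> \<le> ennreal (hole_const * m G) + ennreal e"
    using good bad by (rule add_mono)
  also have "\<dots> = ennreal (hole_const * m G + e)"
    using hole_const_pos e by (simp add: ennreal_plus)
  also have "emeasure (weight_measure \<mu>) F = ennreal (m F)"
    using sets l by (intro emeasure_eq_m[of _ a l]) (auto simp: F_def)
  finally have "m F \<le> hole_const * m G + e"
    by (rule iffD1[OF ennreal_le_iff, rotated]) (use hole_const_pos e in simp)
  then show "m {x \<in> cube a l. level_ratio * t < \<mu> x} \<le> hole_const * m {x \<in> cube a l. t < \<mu> x \<and> \<mu> x \<le> level_ratio * t} + e"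
    by (simp add: F_def G_def)
qed

text \<open>Hole filling: from m F \<le> c (m G - m F), moving m F to the left gives the contraction
  factor c/(1+c). Iterate over the levels \<open>level_ratio ^ k\<close> times the mean
  density.\<close>

lemma level_decay:
  assumes l: "0 < l"
  shows "m {x \<in> cube a l. level_ratio ^ k * (m (cube a l) / vol (cube a l)) < \<mu> x}
    \<le> (hole_const / (1 + hole_const)) ^ k * m (cube a l)"
proof (induction k)
  case 0
  show ?case using l by (auto intro!: m_mono[of _ _ a l])
next
  case (Suc k)
  let ?Q = "cube a l"
  define t where "t = level_ratio ^ k * (m ?Q / vol ?Q)"
  note p = m_cube_pos[OF l, of a] measure_cube_pos[OF l, of a]
  define F where "F = {x \<in> ?Q. level_ratio * t < \<mu> x}"
  define G where "G = {x \<in> ?Q. t < \<mu> x}"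
  have sets: "F \<in> sets lebesgue" "G \<in> sets lebesgue" unfolding F_def G_def by measurable
  have t: "m ?Q \<le> t * vol ?Q"
  proof -
    have "1 * m ?Q \<le> level_ratio ^ k * m ?Q" using level_ratio_gt by (intro mult_right_mono) auto
    then show ?thesis using p by (simp add: t_def)
  qed
  have "0 \<le> t" using p level_ratio_gt by (simp add: t_def)
  then have "t \<le> level_ratio * t" using level_ratio_gt by (simp add: mult_le_cancel_right1)
  then have FG: "F \<subseteq> G" and eq: "{x \<in> ?Q. t < \<mu> x \<and> \<mu> x \<le> level_ratio * t} = G - F"
    by (auto simp: F_def G_def)
  have "m F \<le> hole_const * m (G - F)"
    using hole_filling[OF l t] unfolding eq F_def .
  also have "m (G - F) = m G - m F"
    using FG sets l by (intro m_Diff[of _ _ a l]) (auto simp: G_def)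
  finally have "m F \<le> hole_const / (1 + hole_const) * m G"
    using hole_const_pos by (simp add: field_simps)
  also have "\<dots> \<le> hole_const / (1 + hole_const) * ((hole_const / (1 + hole_const)) ^ k * m ?Q)"
    using Suc hole_const_pos by (intro mult_left_mono) (auto simp: G_def t_def)
  finally show ?case by (simp add: F_def t_def mult_ac)
qed

text \<open>The reverse Hoelder inequality in distributional form. Decay of the \<mu>-mass gives the
  exponent \<open>e\<close>, and Chebyshev, dividing by the level to return to volume, gives the
  additional 1.\<close>

lemma level_tail:
  obtains c e where "0 < c" "0 < e"
    "\<And>a l t. \<lbrakk>0 < l; 0 < t\<rbrakk> \<Longrightarrow> vol {x \<in> cube a l. t < \<mu> x}
      \<le> c * (m (cube a l) / (t * vol (cube a l))) powr (1 + e) * vol (cube a l)"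
proof
  \<comment> \<open>Solves \<open>level_ratio powr (- e) = hole_const / (1 + hole_const)\<close>,
    which turns geometric decay in \<open>k\<close> into a power of the level.\<close>
  define e where "e = - ln (hole_const / (1 + hole_const)) / ln level_ratio"
  have k1: "0 < hole_const / (1 + hole_const)" "hole_const / (1 + hole_const) < 1" using hole_const_pos by auto
  have lnb: "0 < ln level_ratio" using level_ratio_gt by simp
  show "0 < level_ratio powr (1 + e)" using level_ratio_gt by simp
  have "ln (hole_const / (1 + hole_const)) < 0" using k1 by (simp add: ln_less_zero)
  then show "0 < e" using lnb by (simp add: e_def divide_neg_pos)
  have kappa: "hole_const / (1 + hole_const) = level_ratio powr (- e)"
    using k1 lnb level_ratio_gt by (simp add: powr_def e_def)
  fix a :: "real^'n" and l t :: real assume l: "0 < l" and t: "0 < t"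
  let ?Q = "cube a l"
  note p = m_cube_pos[OF l, of a] measure_cube_pos[OF l, of a]
  define s where "s = m ?Q / vol ?Q"
  have s: "0 < s" using p by (simp add: s_def)
  have st: "m ?Q / (t * vol ?Q) = s / t" by (simp add: s_def field_simps)
  let ?F = "{x \<in> ?Q. t < \<mu> x}"
  have F: "?F \<in> sets lebesgue" by measurable
  have volQ: "vol ?F \<le> vol ?Q" using l F by (intro vol_mono[of _ _ a l]) auto
  have "vol ?F \<le> (level_ratio * (s / t)) powr (1 + e) * vol ?Q"
  proof (cases "t < s")
    case True
    then have "1 * 1 \<le> level_ratio * (s / t)" using t level_ratio_gt by (intro mult_mono) auto
    then have "1 \<le> (level_ratio * (s / t)) powr (1 + e)" using \<open>0 < e\<close> by (simp add: ge_one_powr_ge_zero)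
    then have "1 * vol ?Q \<le> (level_ratio * (s / t)) powr (1 + e) * vol ?Q" by (intro mult_right_mono) auto
    with volQ show ?thesis by simp
  next
    case False
    then have ts: "1 \<le> t / s" using s by simp
    \<comment> \<open>The largest \<open>k\<close> with \<open>level_ratio ^ k * s \<le> t\<close>.
      Rounding down costs one factor \<open>level_ratio\<close>, whence the constant
      \<open>level_ratio powr (1 + e)\<close>.\<close>
    define k where "k = nat \<lfloor>log level_ratio (t / s)\<rfloor>"
    have "0 \<le> log level_ratio (t / s)" using ts level_ratio_gt by simp
    then have k: "real k \<le> log level_ratio (t / s)" "log level_ratio (t / s) < real k + 1"
      unfolding k_def by linarith+
    have "level_ratio powr real k \<le> t / s"
      using k(1) level_ratio_gt ts by (simp add: le_log_iff)
    then have k1: "level_ratio ^ k * s \<le> t"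
      using level_ratio_gt s by (simp add: powr_realpow field_simps)
    have "t / s < level_ratio powr (real k + 1)"
      using k(2) level_ratio_gt ts by (simp add: log_less_iff)
    then have "t / s < level_ratio powr real k * level_ratio"
      using level_ratio_gt by (simp add: powr_add)
    then have k2: "level_ratio powr (- real k) \<le> level_ratio * (s / t)"
      using level_ratio_gt s t by (simp add: powr_minus field_simps)
    let ?F' = "{x \<in> ?Q. level_ratio ^ k * s < \<mu> x}"
    have F': "?F' \<in> sets lebesgue" by measurable
    have bs: "0 < level_ratio ^ k * s" using level_ratio_gt s by simp
    have "vol ?F \<le> vol ?F'"
      using k1 F F' l by (intro vol_mono[of _ _ a l]) auto
    also have "level_ratio ^ k * s * vol ?F' \<le> m ?F'"
      using F' l bs by (intro level_ge[of _ a l]) auto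
    then have "vol ?F' \<le> m ?F' / (level_ratio ^ k * s)"
      using bs by (simp add: field_simps)
    also have "\<dots> \<le> (hole_const / (1 + hole_const)) ^ k * m ?Q / (level_ratio ^ k * s)"
      using bs level_decay[OF l, of a k] by (intro divide_right_mono) (auto simp: s_def)
    also have "\<dots> = (hole_const / (1 + hole_const)) ^ k / level_ratio ^ k * vol ?Q"
      using p by (simp add: s_def)
    also have "(hole_const / (1 + hole_const)) ^ k / level_ratio ^ k = (level_ratio powr (- real k)) powr (1 + e)"
    proof -
      have "(level_ratio powr (- e)) ^ k / level_ratio ^ k = level_ratio powr (- (e * real k) - real k)"
        using level_ratio_gt by (simp add: powr_realpow[symmetric] powr_powr powr_diff[symmetric])
      also have "- (e * real k) - real k = (- real k) * (1 + e)"
        by (simp add: algebra_simps)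
      finally show ?thesis unfolding kappa by (simp add: powr_powr)
    qed
    also have "\<dots> * vol ?Q \<le> (level_ratio * (s / t)) powr (1 + e) * vol ?Q"
      using k2 \<open>0 < e\<close> by (intro mult_right_mono powr_mono2) auto
    finally show ?thesis .
  qed
  also have "(level_ratio * (s / t)) powr (1 + e) = level_ratio powr (1 + e) * (s / t) powr (1 + e)"
    using level_ratio_gt s t by (subst powr_mult) auto
  finally show "vol ?F \<le> level_ratio powr (1 + e) * (m ?Q / (t * vol ?Q)) powr (1 + e) * vol ?Q"
    unfolding st .
qed


section \<open>A mixed weak-type estimate\<close>

definition vol_dil :: real where
  "vol_dil = (10 * real CARD('n)) ^ CARD('n)"

lemma vol_dilated_cube: "0 < l \<Longrightarrow> vol (dilated_cube a l) = vol_dil * vol (cube a l)"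
  by (simp add: measure_dilated_cube vol_dil_def)

lemma vol_dil_ge_1: "1 \<le> vol_dil"
proof -
  have "1 \<le> real CARD('n)" by (simp add: Suc_leI)
  then have "1 \<le> 10 * real CARD('n)" by linarith
  then show ?thesis unfolding vol_dil_def by (rule one_le_power)
qed

text \<open>\<open>s\<close> bounds the density of \<mu> on the undilated cube relative to the level
  \<open>t\<close>. Doubling transfers this bound to the dilate, where the tail is needed because
  Vitali covers only by dilates.\<close>

lemma dilated_level_tail:
  obtains c e where "0 < c" "0 < e"
    "\<And>a l t s. \<lbrakk>0 < l; 0 < t; 0 < s; m (cube a l) \<le> s * t * vol (cube a l)\<rbrakk> \<Longrightarrow>
      vol {x \<in> dilated_cube a l. t < \<mu> x} \<le> c * s powr (1 + e) * vol (cube a l)"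
proof -
  obtain c e where c: "0 < c" "0 < e"
    "\<And>a l t. \<lbrakk>0 < l; 0 < t\<rbrakk> \<Longrightarrow> vol {x \<in> cube a l. t < \<mu> x}
      \<le> c * (m (cube a l) / (t * vol (cube a l))) powr (1 + e) * vol (cube a l)"
    by (rule level_tail) blast
  let ?D = doubling_const
  show thesis
  proof
    show "0 < c * (?D / vol_dil) powr (1 + e) * vol_dil"
      using c doubling_const_pos vol_dil_ge_1 by (intro mult_pos_pos) auto
    show "0 < e" by fact
    fix a :: "real^'n" and l t s :: real
    assume l: "0 < l" and t: "0 < t" and s: "0 < s" and le: "m (cube a l) \<le> s * t * vol (cube a l)"
    have v: "vol (dilated_cube a l) = vol_dil * vol (cube a l)"
      using l by (rule vol_dilated_cube)
    have vp: "0 < vol (cube a l)" using l by (rule measure_cube_pos)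
    have "m (dilated_cube a l) \<le> ?D * (s * t * vol (cube a l))"
      using doubling[OF l, of a] mult_left_mono[OF le, of ?D] doubling_const_pos by linarith
    then have "m (dilated_cube a l) / (t * vol (dilated_cube a l)) \<le> ?D / vol_dil * s"
      unfolding v using t vp vol_dil_ge_1 by (simp add: field_simps)
    then have "(m (dilated_cube a l) / (t * vol (dilated_cube a l))) powr (1 + e)
        \<le> (?D / vol_dil * s) powr (1 + e)"
      using c t by (intro powr_mono2) auto
    also have "\<dots> = (?D / vol_dil) powr (1 + e) * s powr (1 + e)"
      using doubling_const_pos s by (subst powr_mult) auto
    finally have *: "(m (dilated_cube a l) / (t * vol (dilated_cube a l))) powr (1 + e)
      \<le> (?D / vol_dil) powr (1 + e) * s powr (1 + e)" .
    have "vol {x \<in> dilated_cube a l. t < \<mu> x}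
        \<le> c * (m (dilated_cube a l) / (t * vol (dilated_cube a l))) powr (1 + e) * vol (dilated_cube a l)"
      unfolding dilated_cube_def using l t by (intro c(3)) auto
    also have "\<dots> \<le> c * ((?D / vol_dil) powr (1 + e) * s powr (1 + e)) * vol (dilated_cube a l)"
      using * c by (intro mult_right_mono mult_left_mono) auto
    finally show "vol {x \<in> dilated_cube a l. t < \<mu> x}
        \<le> c * (?D / vol_dil) powr (1 + e) * vol_dil * s powr (1 + e) * vol (cube a l)"
      unfolding v by (simp add: mult_ac)
  qed
qed

lemma level_sets:
  assumes "E \<in> sets lebesgue"
  shows "{x \<in> E. t < \<mu> x} \<in> sets lebesgue"
proof -
  have "{x \<in> E. t < \<mu> x} = E \<inter> {x \<in> space lebesgue. t < \<mu> x}" by auto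
  also have "\<dots> \<in> sets lebesgue" using assms by measurable
  finally show ?thesis .
qed

lemma vol_subset_dilated_cube:
  assumes "E \<in> sets lebesgue" "E \<subseteq> dilated_cube a l" "0 < l"
  shows "emeasure lebesgue E = ennreal (vol E)"
  using assms(1) assms(2)[unfolded dilated_cube_def]
  by (rule emeasure_subset_cube) (use assms(3) in simp)

lemma m_subset_dilated_cube:
  assumes "E \<in> sets lebesgue" "E \<subseteq> dilated_cube a l" "0 < l"
  shows "emeasure (weight_measure \<mu>) E = ennreal (m E)"
  using assms(1) assms(2)[unfolded dilated_cube_def]
  by (rule emeasure_eq_m) (use assms(3) in simp)

text \<open>The summand 1 accounts for points of lower level than the given one; the fraction is the
  sum of the geometric series over the levels \<open>k x + j\<close> with
  \<open>j \<ge> 0\<close>.\<close>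

definition cover_const :: real where
  "cover_const = 1 + (2 * C) powr (1 / q) * vol_dil / (1 - 2 powr (- 1 / q))"

lemma two_powr_less_1: "2 powr (- 1 / q) < 1"
  using q_pos by (intro powr_less_one) auto

lemma cover_const_pos: "0 < cover_const"
  using two_powr_less_1 vol_dil_ge_1 unfolding cover_const_def
  by (intro add_pos_nonneg divide_nonneg_nonneg mult_nonneg_nonneg) auto

text \<open>The level \<open>k x\<close> of a point and the cube \<open>cube (a x) (l x)\<close> selected for it satisfy
  \<open>2\<^sup>k \<mu>(Q) \<le> \<nu>(Q) \<le> 2\<^sup>k\<^sup>+\<^sup>1 \<mu>(Q)\<close>. Points whose level exceeds that of \<open>x\<close> by \<open>j\<close> have their cubes in a set
  of \<open>\<mu>\<close>-measure at most \<open>2\<^sup>1\<^sup>-\<^sup>j \<mu>(Q)\<close>, so that the \<open>A\<^sub>\<infinity>\<close> condition gives geometric decay in \<open>j\<close>.\<close>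

lemma cover_within_dilated_cube:
  fixes a :: "real^'n \<Rightarrow> real^'n" and l :: "real^'n \<Rightarrow> real" and thr :: "int \<Rightarrow> real" and k :: "real^'n \<Rightarrow> int"
  assumes \<nu>: "sets \<nu> = sets lebesgue" and thr: "antimono thr" and \<beta>: "0 \<le> \<beta>"
    and l: "\<And>x. x \<in> S \<Longrightarrow> 0 < l x \<and> l x \<le> B"
    and mem: "\<And>x. x \<in> S \<Longrightarrow> x \<in> cube (a x) (l x)"
    and lower: "\<And>x. x \<in> S \<Longrightarrow>
      ennreal (2 powr k x * m (cube (a x) (l x))) \<le> emeasure \<nu> (cube (a x) (l x))"
    and upper: "\<And>x b h. \<lbrakk>x \<in> S; 0 < h; x \<in> cube b h\<rbrakk> \<Longrightarrow>
      emeasure \<nu> (cube b h) \<le> ennreal (2 powr (k x + 1) * m (cube b h))"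
    and large: "\<And>x. x \<in> S \<Longrightarrow> thr (k x) < \<mu> x"
    and tail: "\<And>x. x \<in> S \<Longrightarrow> vol {y \<in> dilated_cube (a x) (l x). thr (k x) < \<mu> y}
      \<le> \<beta> * vol (cube (a x) (l x))"
    and x: "x \<in> S"
  shows "\<exists>T\<in>sets lebesgue. {y \<in> S. cube (a y) (l y) \<subseteq> dilated_cube (a x) (l x)} \<subseteq> T \<and>
    emeasure lebesgue T \<le> ennreal (\<beta> * cover_const * vol (cube (a x) (l x)))"
proof -
  let ?Q = "\<lambda>y. cube (a y) (l y)" and ?D = "dilated_cube (a x) (l x)"
  let ?L = "\<lambda>y. {z \<in> dilated_cube (a y) (l y). thr (k y) < \<mu> z}"
  have Lsets: "?L y \<in> sets lebesgue" for y by (rule level_sets) simp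
  have eL: "emeasure lebesgue (?L y) \<le> ennreal (\<beta> * vol (?Q y))" if "y \<in> S" for y
  proof -
    have "emeasure lebesgue (?L y) = ennreal (vol (?L y))"
      using l[OF that] by (intro vol_subset_dilated_cube[OF Lsets]) auto
    also have "\<dots> \<le> ennreal (\<beta> * vol (?Q y))"
      by (rule ennreal_leI[OF tail[OF that]])
    finally show ?thesis .
  qed
  define r where "r = 2 powr (- 1 / q)"
  define w where "w = \<beta> * (2 * C) powr (1 / q) * vol (?D)"
  have "\<exists>T\<in>sets lebesgue. {y \<in> S. ?Q y \<subseteq> ?D \<and> k y = k x + int j} \<subseteq> T \<and>
    emeasure lebesgue T \<le> ennreal (w * r ^ j)" for j
  proof -
    define I where "I = {y \<in> S. ?Q y \<subseteq> ?D \<and> k y = k x + int j}"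
    have lI: "0 < l y \<and> l y \<le> B" if "y \<in> I" for y using that l by (simp add: I_def)
    obtain J where J: "countable J" "J \<subseteq> I" "disjoint_family_on ?Q J"
      "\<And>y. y \<in> I \<Longrightarrow> \<exists>z\<in>J. ?Q y \<subseteq> dilated_cube (a z) (l z)"
      using Vitali_covering_cubes[of I l B a, OF lI] by blast
    define V where "V = (\<Union>y\<in>J. ?Q y)"
    have JI: "y \<in> S" "?Q y \<subseteq> ?D" "k y = k x + int j" if "y \<in> J" for y
      using that J(2) by (auto simp: I_def)
    have V: "V \<in> sets lebesgue" "V \<subseteq> ?D"
      using JI(2) sets.countable_UN''[OF J(1), of ?Q lebesgue] by (auto simp: V_def)
    have lx: "0 < l x" and lD: "0 < 10 * real CARD('n) * l x"
      using l[OF x] by auto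
    \<comment> \<open>On the selected cubes \<mu> is at most 2^{-(k x + j)} \<nu>. Their union lies
      in the dilate, which contains \<open>x\<close>, so \<open>upper\<close> at \<open>x\<close>
      bounds \<nu> there by 2^{k x + 1} \<mu>. The quotient is 2^{1-j}.\<close>
    have "ennreal (m V) = emeasure (weight_measure \<mu>) V"
      using m_subset_dilated_cube[OF V lx] by simp
    also have "\<dots> \<le> ennreal (2 powr - (k x + int j)) * emeasure \<nu> V"
      unfolding V_def
    proof (rule emeasure_UN_le_disjoint[OF J(1,3)])
      fix y assume "y \<in> J"
      then have y: "y \<in> S" "k y = k x + int j" by (rule JI)+
      have "ennreal (m (?Q y)) = ennreal (2 powr - (k x + int j)) * ennreal (2 powr (k y) * m (?Q y))"
        using y(2) by (simp add: ennreal_mult[symmetric] mult.assoc[symmetric] powr_add[symmetric])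
      also have "\<dots> \<le> ennreal (2 powr - (k x + int j)) * emeasure \<nu> (?Q y)"
        using lower[OF y(1)] by (intro mult_left_mono) auto
      finally show "emeasure (weight_measure \<mu>) (?Q y) \<le> ennreal (2 powr - (k x + int j)) * emeasure \<nu> (?Q y)"
        using emeasure_eq_m[of "?Q y" "a y" "l y"] l[OF y(1)] by simp
    qed (use \<nu> in auto)
    also have "\<dots> \<le> ennreal (2 powr - (k x + int j)) * emeasure \<nu> ?D"
      using V \<nu> by (intro mult_left_mono emeasure_mono) auto
    also have "\<dots> \<le> ennreal (2 powr - (k x + int j)) * ennreal (2 powr (k x + 1) * m ?D)"
      using upper[OF x lD] mem[OF x] cube_subset_dilated_cube[of "a x" "l x"]
      by (intro mult_left_mono) (auto simp: dilated_cube_def)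
    also have "\<dots> = ennreal (2 powr (1 - real j) * m ?D)"
      by (simp add: ennreal_mult[symmetric] mult.assoc[symmetric] powr_add[symmetric])
    finally have mV: "m V \<le> 2 powr (1 - real j) * m ?D" by simp
    have mD: "0 < m ?D" using lD unfolding dilated_cube_def by (rule m_cube_pos)
    have "vol V \<le> (C * m V / m ?D) powr (1 / q) * vol ?D"
      using V lD unfolding dilated_cube_def by (intro vol_le_m) auto
    also have "\<dots> \<le> (C * 2 powr (1 - real j)) powr (1 / q) * vol ?D"
      using mV mD C_pos q_pos by (intro mult_right_mono powr_mono2) (auto simp: field_simps)
    also have "(C * 2 powr (1 - real j)) powr (1 / q) = (2 * C) powr (1 / q) * r ^ j"
    proof -
      have "C * 2 powr (1 - real j) = (2 * C) * 2 powr (- real j)"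
        using powr_add[of 2 1 "- real j"] by simp
      then have "(C * 2 powr (1 - real j)) powr (1 / q) = (2 * C) powr (1 / q) * (2 powr (- real j)) powr (1 / q)"
        using C_pos by (simp only:) (subst powr_mult, auto)
      also have "(2 powr (- real j)) powr (1 / q) = r ^ j"
        by (simp add: r_def powr_powr powr_realpow[symmetric])
      finally show ?thesis .
    qed
    finally have volV: "vol V \<le> (2 * C) powr (1 / q) * r ^ j * vol ?D" .
    have "emeasure lebesgue (\<Union>y\<in>J. ?L y) \<le> ennreal \<beta> * emeasure lebesgue V"
      unfolding V_def
    proof (rule emeasure_UN_le_disjoint[OF J(1,3)])
      fix y assume "y \<in> J"
      then have y: "y \<in> S" by (rule JI)
      have "emeasure lebesgue (?Q y) = ennreal (vol (?Q y))"
        using l[OF y] by (intro emeasure_subset_cube[of _ "a y" "l y"]) auto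
      then show "emeasure lebesgue (?L y) \<le> ennreal \<beta> * emeasure lebesgue (?Q y)"
        using eL[OF y] \<beta> by (simp add: ennreal_mult[symmetric])
    qed (use Lsets in auto)
    also have "emeasure lebesgue V = ennreal (vol V)"
      by (rule vol_subset_dilated_cube[OF V lx])
    also have "ennreal \<beta> * ennreal (vol V) = ennreal (\<beta> * vol V)"
      using \<beta> by (simp add: ennreal_mult)
    also have "\<dots> \<le> ennreal (w * r ^ j)"
      using mult_left_mono[OF volV \<beta>] by (intro ennreal_leI) (simp add: w_def mult_ac)
    finally have "emeasure lebesgue (\<Union>y\<in>J. ?L y) \<le> ennreal (w * r ^ j)" .
    moreover have "I \<subseteq> (\<Union>y\<in>J. ?L y)"
    proof
      fix y assume y: "y \<in> I"
      obtain z where z: "z \<in> J" "?Q y \<subseteq> dilated_cube (a z) (l z)" using J(4)[OF y] by auto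
      have "k z = k y" using z(1) y J(2) by (auto simp: I_def)
      then have "y \<in> ?L z" using y z(2) mem[of y] large[of y] by (auto simp: I_def)
      with z(1) show "y \<in> (\<Union>y\<in>J. ?L y)" by blast
    qed
    moreover have "(\<Union>y\<in>J. ?L y) \<in> sets lebesgue"
      using J(1) Lsets by (intro sets.countable_UN') auto
    ultimately show ?thesis unfolding I_def by blast
  qed
  then have "\<forall>j. \<exists>T\<in>sets lebesgue. {y \<in> S. ?Q y \<subseteq> ?D \<and> k y = k x + int j} \<subseteq> T \<and>
    emeasure lebesgue T \<le> ennreal (w * r ^ j)" by blast
  then obtain T where "\<forall>j. T j \<in> sets lebesgue \<and>
    {y \<in> S. ?Q y \<subseteq> ?D \<and> k y = k x + int j} \<subseteq> T j \<and>
    emeasure lebesgue (T j) \<le> ennreal (w * r ^ j)"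
    unfolding Bex_def by (rule exE[OF choice])
  then have T: "\<And>j. T j \<in> sets lebesgue"
    "\<And>j. {y \<in> S. ?Q y \<subseteq> ?D \<and> k y = k x + int j} \<subseteq> T j"
    "\<And>j. emeasure lebesgue (T j) \<le> ennreal (w * r ^ j)" by blast+
  have w: "0 \<le> w" using \<beta> C_pos by (simp add: w_def)
  have r: "0 \<le> r" "r < 1" using two_powr_less_1 by (auto simp: r_def)
  have TT: "emeasure lebesgue (\<Union>j. T j) \<le> ennreal (w / (1 - r))"
    using T w r by (intro emeasure_UN_nat_geometric_le) auto
  have "emeasure lebesgue (?L x \<union> (\<Union>j. T j)) \<le> emeasure lebesgue (?L x) + emeasure lebesgue (\<Union>j. T j)"
    using Lsets T by (intro emeasure_subadditive) auto
  also have "\<dots> \<le> ennreal (\<beta> * vol (?Q x)) + ennreal (w / (1 - r))"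
    using eL[OF x] TT by (rule add_mono)
  also have "\<dots> = ennreal (\<beta> * vol (?Q x) + w / (1 - r))"
    using \<beta> w r by (intro ennreal_plus[symmetric]) auto
  also have "\<beta> * vol (?Q x) + w / (1 - r) = \<beta> * cover_const * vol (?Q x)"
    using l[OF x] by (simp add: w_def cover_const_def r_def vol_dilated_cube field_simps)
  finally have le: "emeasure lebesgue (?L x \<union> (\<Union>j. T j)) \<le> ennreal (\<beta> * cover_const * vol (?Q x))" .
  have cov: "{y \<in> S. ?Q y \<subseteq> ?D} \<subseteq> ?L x \<union> (\<Union>j. T j)"
  proof
    fix y assume y: "y \<in> {y \<in> S. ?Q y \<subseteq> ?D}"
    show "y \<in> ?L x \<union> (\<Union>j. T j)"
    proof (cases "k x \<le> k y")
      case True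
      then have "k y = k x + int (nat (k y - k x))" by simp
      then have "y \<in> T (nat (k y - k x))" using y T(2) by blast
      then show ?thesis by blast
    next
      case False
      \<comment> \<open>A lower level means a higher threshold, so such points already belong to the
        level set of the dilate at the threshold of \<open>x\<close>.\<close>
      then have "thr (k x) \<le> thr (k y)"
        using thr by (simp add: antimono_def)
      then have "y \<in> ?L x" using y mem[of y] large[of y] by auto
      then show ?thesis by blast
    qed
  qed
  show ?thesis
    using le cov Lsets T(1) by (intro bexI[of _ "?L x \<union> (\<Union>j. T j)"]) auto
qed

text \<open>Vitali is now applied to all selected cubes regardless of level.
  \<open>cover_within_dilated_cube\<close> handles the points whose cubes fall into one dilate, and
  \<open>dens\<close> converts the volume of the chosen disjoint cubes into \<nu>-mass, which sums
  to at most \<nu>(X).\<close>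

lemma cover_single_type:
  fixes a :: "real^'n \<Rightarrow> real^'n" and l :: "real^'n \<Rightarrow> real" and thr :: "int \<Rightarrow> real" and k :: "real^'n \<Rightarrow> int"
  assumes \<nu>: "sets \<nu> = sets lebesgue" and thr: "antimono thr" and \<beta>: "0 \<le> \<beta>" and \<rho>: "0 \<le> \<rho>"
    and l: "\<And>x. x \<in> S \<Longrightarrow> 0 < l x \<and> l x \<le> B"
    and mem: "\<And>x. x \<in> S \<Longrightarrow> x \<in> cube (a x) (l x)"
    and lower: "\<And>x. x \<in> S \<Longrightarrow>
      ennreal (2 powr k x * m (cube (a x) (l x))) \<le> emeasure \<nu> (cube (a x) (l x))"
    and upper: "\<And>x b h. \<lbrakk>x \<in> S; 0 < h; x \<in> cube b h\<rbrakk> \<Longrightarrow>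
      emeasure \<nu> (cube b h) \<le> ennreal (2 powr (k x + 1) * m (cube b h))"
    and large: "\<And>x. x \<in> S \<Longrightarrow> thr (k x) < \<mu> x"
    and tail: "\<And>x. x \<in> S \<Longrightarrow> vol {y \<in> dilated_cube (a x) (l x). thr (k x) < \<mu> y}
      \<le> \<beta> * vol (cube (a x) (l x))"
    and dens: "\<And>x. x \<in> S \<Longrightarrow>
      ennreal (vol (cube (a x) (l x))) \<le> ennreal \<rho> * emeasure \<nu> (cube (a x) (l x))"
    and X: "X \<in> sets lebesgue" "\<And>x. x \<in> S \<Longrightarrow> cube (a x) (l x) \<subseteq> X"
  shows "\<exists>T\<in>sets lebesgue. S \<subseteq> T \<and> emeasure lebesgue T \<le> ennreal (\<beta> * cover_const * \<rho>) * emeasure \<nu> X"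
proof -
  let ?Q = "\<lambda>y. cube (a y) (l y)"
  have "\<forall>x\<in>S. \<exists>T\<in>sets lebesgue. {y \<in> S. ?Q y \<subseteq> dilated_cube (a x) (l x)} \<subseteq> T \<and>
    emeasure lebesgue T \<le> ennreal (\<beta> * cover_const * vol (?Q x))"
    by (intro ballI cover_within_dilated_cube[OF \<nu> thr \<beta> l mem lower upper large tail])
  then obtain T where "\<forall>x\<in>S. T x \<in> sets lebesgue \<and>
    {y \<in> S. ?Q y \<subseteq> dilated_cube (a x) (l x)} \<subseteq> T x \<and>
    emeasure lebesgue (T x) \<le> ennreal (\<beta> * cover_const * vol (?Q x))"
    unfolding Bex_def by (rule exE[OF bchoice])
  then have T: "\<And>x. x \<in> S \<Longrightarrow> T x \<in> sets lebesgue"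
    "\<And>x. x \<in> S \<Longrightarrow> {y \<in> S. ?Q y \<subseteq> dilated_cube (a x) (l x)} \<subseteq> T x"
    "\<And>x. x \<in> S \<Longrightarrow> emeasure lebesgue (T x) \<le> ennreal (\<beta> * cover_const * vol (?Q x))"
    by blast+
  obtain J where J: "countable J" "J \<subseteq> S" "disjoint_family_on ?Q J"
    "\<And>y. y \<in> S \<Longrightarrow> \<exists>z\<in>J. ?Q y \<subseteq> dilated_cube (a z) (l z)"
    using Vitali_covering_cubes[of S l B a, OF l] by blast
  have "emeasure lebesgue (\<Union>x\<in>J. T x) \<le> ennreal (\<beta> * cover_const * \<rho>) * emeasure \<nu> (\<Union>x\<in>J. ?Q x)"
  proof (rule emeasure_UN_le_disjoint[OF J(1,3)])
    fix x assume "x \<in> J"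
    then have x: "x \<in> S" using J(2) by auto
    have "emeasure lebesgue (T x) \<le> ennreal (\<beta> * cover_const) * ennreal (vol (?Q x))"
      using T(3)[OF x] \<beta> cover_const_pos by (simp add: ennreal_mult[symmetric])
    also have "\<dots> \<le> ennreal (\<beta> * cover_const) * (ennreal \<rho> * emeasure \<nu> (?Q x))"
      using dens[OF x] by (rule mult_left_mono) simp
    also have "\<dots> = ennreal (\<beta> * cover_const * \<rho>) * emeasure \<nu> (?Q x)"
      using \<beta> \<rho> cover_const_pos by (simp add: ennreal_mult mult.assoc)
    finally show "emeasure lebesgue (T x) \<le> ennreal (\<beta> * cover_const * \<rho>) * emeasure \<nu> (?Q x)" .
  qed (use T J \<nu> in auto)
  also have "\<dots> \<le> ennreal (\<beta> * cover_const * \<rho>) * emeasure \<nu> X"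
    using X J(2) \<nu> by (intro mult_left_mono emeasure_mono) auto
  finally have "emeasure lebesgue (\<Union>x\<in>J. T x) \<le> ennreal (\<beta> * cover_const * \<rho>) * emeasure \<nu> X" .
  moreover have "S \<subseteq> (\<Union>x\<in>J. T x)"
    using J(2,4) T(2) by blast
  moreover have "(\<Union>x\<in>J. T x) \<in> sets lebesgue"
    using J(1,2) T(1) by (intro sets.countable_UN') auto
  ultimately show ?thesis by blast
qed


text \<open>A point has type \<open>i\<close> if the density of \<open>\<nu>\<close> on its selected cube is about \<open>2\<^sup>-\<^sup>i t\<close>. By the reverse
  Hoelder inequality the points of type \<open>i\<close> fill at most a fraction \<open>2\<^bsup>-i(1+e)\<^esup>\<close> of the selected cubes,
  whose total volume is at most \<open>2\<^bsup>i+1\<^esup> \<nu>(X) / t\<close>.\<close>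

lemma mixed_weak_type_cover:
  obtains K where "0 < K"
    "\<And>\<nu> t B a l k S X. \<lbrakk>sets \<nu> = sets lebesgue; 0 < t;
      \<And>x. x \<in> S \<Longrightarrow> 0 < l x \<and> l x \<le> B; \<And>x. x \<in> S \<Longrightarrow> x \<in> cube (a x) (l x);
      \<And>x. x \<in> S \<Longrightarrow> ennreal (2 powr real_of_int (k x) * m (cube (a x) (l x))) \<le> emeasure \<nu> (cube (a x) (l x));
      \<And>x b h. \<lbrakk>x \<in> S; 0 < h; x \<in> cube b h\<rbrakk> \<Longrightarrow>
        emeasure \<nu> (cube b h) \<le> ennreal (2 powr real_of_int (k x + 1) * m (cube b h));
      \<And>x. x \<in> S \<Longrightarrow> t / 2 powr real_of_int (k x + 1) < \<mu> x;
      X \<in> sets lebesgue; emeasure \<nu> X < \<infinity>; \<And>x. x \<in> S \<Longrightarrow> cube (a x) (l x) \<subseteq> X\<rbrakk> \<Longrightarrow>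
      \<exists>T\<in>sets lebesgue. S \<subseteq> T \<and> emeasure lebesgue T \<le> ennreal (K / t) * emeasure \<nu> X"
proof -
  obtain c e where c: "0 < c" and e: "0 < e" and tail0:
    "\<And>a l t s. \<lbrakk>0 < l; 0 < t; 0 < s; m (cube a l) \<le> s * t * vol (cube a l)\<rbrakk> \<Longrightarrow>
      vol {x \<in> dilated_cube a l. t < \<mu> x} \<le> c * s powr (1 + e) * vol (cube a l)"
    by (rule dilated_level_tail) blast
  \<comment> \<open>For type i \<ge> 1, \<mu>(Q) \<le> 2^{-k} \<nu>(Q) \<le> 2^{-k} 2^{-i} t |Q|,
    while the threshold is t/2^{k+1}; hence the ratio \<open>2 * 2 powr - real i\<close>. Type 0 has
    only the trivial volume bound of the dilate, hence the summand \<open>vol_dil\<close>.\<close>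
  define \<beta> where "\<beta> i = (c + vol_dil) * (2 * 2 powr - real i) powr (1 + e)" for i :: nat
  have \<beta>: "0 \<le> \<beta> i" for i using c vol_dil_ge_1 by (simp add: \<beta>_def)
  define y where "y = 2 powr - e"
  have y: "0 \<le> y" "y < 1" using e by (auto simp: y_def intro!: powr_less_one)
  define K where "K = (c + vol_dil) * 2 powr (1 + e) * cover_const * 2 / (1 - y)"
  show thesis
  proof
    show "0 < K" using c vol_dil_ge_1 cover_const_pos y by (simp add: K_def)
    fix \<nu> :: "(real^'n) measure" and t B :: real and a :: "real^'n \<Rightarrow> real^'n" and l and k :: "real^'n \<Rightarrow> int" and S X
    assume \<nu>: "sets \<nu> = sets lebesgue" and t: "0 < t"
      and l: "\<And>x. x \<in> S \<Longrightarrow> 0 < l x \<and> l x \<le> B"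
      and mem: "\<And>x. x \<in> S \<Longrightarrow> x \<in> cube (a x) (l x)"
      and lower: "\<And>x. x \<in> S \<Longrightarrow> ennreal (2 powr real_of_int (k x) * m (cube (a x) (l x))) \<le> emeasure \<nu> (cube (a x) (l x))"
      and upper: "\<And>x b h. \<lbrakk>x \<in> S; 0 < h; x \<in> cube b h\<rbrakk> \<Longrightarrow>
        emeasure \<nu> (cube b h) \<le> ennreal (2 powr real_of_int (k x + 1) * m (cube b h))"
      and large: "\<And>x. x \<in> S \<Longrightarrow> t / 2 powr real_of_int (k x + 1) < \<mu> x"
      and X: "X \<in> sets lebesgue" "emeasure \<nu> X < \<infinity>" "\<And>x. x \<in> S \<Longrightarrow> cube (a x) (l x) \<subseteq> X"
    let ?Q = "\<lambda>x. cube (a x) (l x)"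
    define thr where "thr i = t / 2 powr real_of_int (i + 1)" for i :: int
    have thr: "antimono thr"
      unfolding antimono_def thr_def using t by (intro allI impI divide_left_mono powr_mono mult_pos_pos) auto
    define \<theta> where "\<theta> x = measure \<nu> (?Q x) / (t * vol (?Q x))" for x
    \<comment> \<open>\<open>nat\<close> truncates at 0, so type 0 also collects all densities above
      \<open>t\<close>. Thus \<open>ty1\<close> holds for every type, but the upper bound
      \<open>ty2\<close> only for nonzero types.\<close>
    define ty where "ty x = nat \<lfloor>- log 2 (\<theta> x)\<rfloor>" for x
    have \<nu>Q: "emeasure \<nu> (?Q x) = ennreal (measure \<nu> (?Q x))" if x: "x \<in> S" for x
      using upper[OF x _ mem[OF x]] l[OF x] by (intro emeasure_eq_ennreal_measure) (auto simp: top_unique)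
    have volQ: "0 < vol (?Q x)" and mQ: "0 < m (?Q x)" if "x \<in> S" for x
      using l[OF that] by (auto intro: measure_cube_pos m_cube_pos)
    have low: "2 powr real_of_int (k x) * m (?Q x) \<le> measure \<nu> (?Q x)" if x: "x \<in> S" for x
      using lower[OF x] unfolding \<nu>Q[OF x] by (subst (asm) ennreal_le_iff) auto
    have nQ: "0 < measure \<nu> (?Q x)" if x: "x \<in> S" for x
    proof -
      have "0 < 2 powr real_of_int (k x) * m (?Q x)" using mQ[OF x] by simp
      with low[OF x] show ?thesis by linarith
    qed
    have \<theta>: "0 < \<theta> x" if "x \<in> S" for x
      using nQ[OF that] volQ[OF that] t by (simp add: \<theta>_def)
    have n\<theta>: "measure \<nu> (?Q x) = \<theta> x * t * vol (?Q x)" if "x \<in> S" for x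
      using volQ[OF that] t by (simp add: \<theta>_def)
    have ty1: "2 powr (- real (ty x) - 1) \<le> \<theta> x" if "x \<in> S" for x
    proof -
      have "- log 2 (\<theta> x) \<le> real (ty x) + 1" unfolding ty_def by linarith
      then have "- real (ty x) - 1 \<le> log 2 (\<theta> x)" by linarith
      then show ?thesis using \<theta>[OF that] by (subst (asm) le_log_iff) auto
    qed
    have ty2: "\<theta> x \<le> 2 powr (- real (ty x))" if "x \<in> S" "ty x \<noteq> 0" for x
    proof -
      have "real (ty x) \<le> - log 2 (\<theta> x)" using that(2) unfolding ty_def by linarith
      then have "log 2 (\<theta> x) \<le> - real (ty x)" by linarith
      then show ?thesis using \<theta>[OF that(1)] by (subst (asm) log_le_iff) auto
    qed
    have "\<exists>T\<in>sets lebesgue. {x \<in> S. ty x = i} \<subseteq> T \<and>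
      emeasure lebesgue T \<le> ennreal (\<beta> i * cover_const * (2 powr (real i + 1) / t)) * emeasure \<nu> X" for i
    proof (rule cover_single_type[OF \<nu> thr \<beta>])
      show "0 \<le> 2 powr (real i + 1) / t" using t by simp
      fix x assume "x \<in> {x \<in> S. ty x = i}"
      then have x: "x \<in> S" and tyx: "ty x = i" by auto
      show "0 < l x \<and> l x \<le> B" "x \<in> ?Q x"
        "ennreal (2 powr real_of_int (k x) * m (?Q x)) \<le> emeasure \<nu> (?Q x)" "?Q x \<subseteq> X"
        using l mem lower X x by auto
      show "thr (k x) < \<mu> x" unfolding thr_def by (rule large[OF x])
      show "emeasure \<nu> (cube b h) \<le> ennreal (2 powr real_of_int (k x + 1) * m (cube b h))"
        if "0 < h" "x \<in> cube b h" for b h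
        using upper[OF x that] .
      show "vol {y \<in> dilated_cube (a x) (l x). thr (k x) < \<mu> y} \<le> \<beta> i * vol (?Q x)"
      proof (cases "i = 0")
        case True
        have "vol {y \<in> dilated_cube (a x) (l x). thr (k x) < \<mu> y} \<le> vol (dilated_cube (a x) (l x))"
          using l[OF x] unfolding dilated_cube_def by (intro vol_mono[OF level_sets _ _ order_refl]) auto
        also have "\<dots> = vol_dil * 1 * vol (?Q x)" using l[OF x] by (simp add: vol_dilated_cube)
        also have "\<dots> \<le> \<beta> i * vol (?Q x)"
          unfolding \<beta>_def using True e c vol_dil_ge_1
          by (intro mult_right_mono mult_mono ge_one_powr_ge_zero) auto
        finally show ?thesis .
      next
        case False
        have "vol {y \<in> dilated_cube (a x) (l x). thr (k x) < \<mu> y}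
            \<le> c * (2 * 2 powr - real i) powr (1 + e) * vol (?Q x)"
        proof (rule tail0)
          show "0 < l x" "0 < thr (k x)" "0 < 2 * 2 powr - real i"
            using l[OF x] t by (auto simp: thr_def)
          have "2 powr real_of_int (k x) * m (?Q x) \<le> \<theta> x * t * vol (?Q x)"
            using low[OF x] n\<theta>[OF x] by simp
          also have "\<dots> \<le> 2 powr - real i * t * vol (?Q x)"
            using ty2[OF x] False t unfolding tyx by (intro mult_right_mono) auto
          finally have "m (?Q x) \<le> 2 powr - real i * t * vol (?Q x) / 2 powr real_of_int (k x)"
            by (subst pos_le_divide_eq) (auto simp: mult.commute)
          also have "\<dots> = 2 * 2 powr - real i * thr (k x) * vol (?Q x)"
            unfolding thr_def of_int_add powr_add by simp
          finally show "m (?Q x) \<le> 2 * 2 powr - real i * thr (k x) * vol (?Q x)" .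
        qed
        also have "\<dots> \<le> \<beta> i * vol (?Q x)"
          unfolding \<beta>_def using vol_dil_ge_1 by (intro mult_right_mono) auto
        finally show ?thesis .
      qed
      have "2 powr (- real i - 1) * t * vol (?Q x) \<le> measure \<nu> (?Q x)"
        unfolding n\<theta>[OF x] using ty1[OF x] t unfolding tyx by (intro mult_right_mono) auto
      moreover have "2 powr (- real i - 1) = 1 / 2 powr (real i + 1)"
        by (simp add: powr_minus_divide[symmetric])
      ultimately have "vol (?Q x) \<le> 2 powr (real i + 1) / t * measure \<nu> (?Q x)"
        using t by (simp add: field_simps)
      then show "ennreal (vol (?Q x)) \<le> ennreal (2 powr (real i + 1) / t) * emeasure \<nu> (?Q x)"
        unfolding \<nu>Q[OF x] using t by (subst ennreal_mult[symmetric]) (auto intro: ennreal_leI)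
    next
      show "X \<in> sets lebesgue" by (rule X)
    qed
    then have "\<forall>i. \<exists>T. T \<in> sets lebesgue \<and> {x \<in> S. ty x = i} \<subseteq> T \<and>
      emeasure lebesgue T \<le> ennreal (\<beta> i * cover_const * (2 powr (real i + 1) / t)) * emeasure \<nu> X"
      by blast
    then obtain T where "\<forall>i. T i \<in> sets lebesgue \<and> {x \<in> S. ty x = i} \<subseteq> T i \<and>
      emeasure lebesgue (T i) \<le> ennreal (\<beta> i * cover_const * (2 powr (real i + 1) / t)) * emeasure \<nu> X"
      by (rule exE[OF choice])
    then have T: "\<And>i. T i \<in> sets lebesgue" "\<And>i. {x \<in> S. ty x = i} \<subseteq> T i"
      and eT: "\<And>i. emeasure lebesgue (T i) \<le> ennreal (\<beta> i * cover_const * (2 powr (real i + 1) / t)) * emeasure \<nu> X"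
      by blast+
    define w where "w = K * (1 - y) / t * measure \<nu> X"
    have \<nu>X: "emeasure \<nu> X = ennreal (measure \<nu> X)"
      using X by (intro emeasure_eq_ennreal_measure) auto
    have eT': "emeasure lebesgue (T i) \<le> ennreal (w * y ^ i)" for i
    proof -
      have "\<beta> i * cover_const * (2 powr (real i + 1) / t) = K * (1 - y) / t * y ^ i"
      proof -
        have "(2 * 2 powr - real i) powr (1 + e) = 2 powr (1 + e) * (2 powr - real i) powr (1 + e)"
          by (rule powr_mult)
        also have "(2 powr - real i) powr (1 + e) = 2 powr - real i * y ^ i"
          unfolding y_def by (simp add: powr_powr powr_realpow[symmetric] powr_add[symmetric] algebra_simps)
        finally have \<beta>i: "\<beta> i = (c + vol_dil) * 2 powr (1 + e) * (2 powr - real i * y ^ i)"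
          by (simp add: \<beta>_def)
        have p1: "2 powr (real i + 1) = 2 * 2 powr real i" by (simp add: powr_add)
        have p2: "2 powr - real i * 2 powr real i = 1" by (simp add: powr_add[symmetric])
        have "\<beta> i * cover_const * (2 powr (real i + 1) / t)
            = (c + vol_dil) * 2 powr (1 + e) * cover_const * 2 / t * y ^ i * (2 powr - real i * 2 powr real i)"
          unfolding \<beta>i p1 times_divide_eq_left times_divide_eq_right by (simp only: mult_ac)
        then have "\<beta> i * cover_const * (2 powr (real i + 1) / t)
            = (c + vol_dil) * 2 powr (1 + e) * cover_const * 2 / t * y ^ i"
          unfolding p2 by simp
        then show ?thesis using y by (simp add: K_def)
      qed
      then have "emeasure lebesgue (T i) \<le> ennreal (K * (1 - y) / t * y ^ i) * ennreal (measure \<nu> X)"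
        using eT[of i] unfolding \<nu>X by (simp only:)
      also have "\<dots> = ennreal (w * y ^ i)"
        using t y \<open>0 < K\<close> by (subst ennreal_mult[symmetric]) (auto simp: w_def mult_ac)
      finally show ?thesis .
    qed
    have "emeasure lebesgue (\<Union>i. T i) \<le> ennreal (w / (1 - y))"
      using T(1) eT' y t \<open>0 < K\<close> by (intro emeasure_UN_nat_geometric_le) (auto simp: w_def)
    also have "\<dots> = ennreal (K / t) * emeasure \<nu> X"
      unfolding \<nu>X w_def using y t \<open>0 < K\<close> by (subst ennreal_mult[symmetric]) auto
    finally have "emeasure lebesgue (\<Union>i. T i) \<le> ennreal (K / t) * emeasure \<nu> X" .
    moreover have "S \<subseteq> (\<Union>i. T i)" using T(2) by blast
    moreover have "(\<Union>i. T i) \<in> sets lebesgue" using T(1) by auto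
    ultimately show "\<exists>T\<in>sets lebesgue. S \<subseteq> T \<and> emeasure lebesgue T \<le> ennreal (K / t) * emeasure \<nu> X"
      by blast
  qed
qed

end

section \<open>The mixed estimate for the maximal function\<close>

lemma divide_le_ennreal_iff:
  fixes a b c :: ennreal
  assumes "0 < b" "b < top"
  shows "a / b \<le> c \<longleftrightarrow> a \<le> c * b"
proof
  assume "a / b \<le> c"
  then have "a / b * b \<le> c * b" by (rule mult_right_mono) simp
  then show "a \<le> c * b" using assms by (simp add: ennreal_divide_times)
qed (rule divide_le_posI_ennreal[OF assms(1)], simp add: mult.commute)

lemma less_maximalD:
  assumes "t < maximal \<mu> g x"
  shows "\<exists>a l. 0 < l \<and> x \<in> cube a l \<and> t < avg (weight_measure \<mu>) (cube a l) (\<lambda>y. ennreal \<bar>g y\<bar>)"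
  using assms unfolding maximal_def less_SUP_iff cubes_eq by auto

lemma avg_le_maximal:
  assumes "0 < l" "x \<in> cube a l"
  shows "avg (weight_measure \<mu>) (cube a l) (\<lambda>y. ennreal \<bar>g y\<bar>) \<le> maximal \<mu> g x"
  unfolding maximal_def by (rule SUP_upper) (use assms in \<open>auto simp: cubes_eq\<close>)

context A_infinity_weight begin

lemma avg_weight_measure_le_iff:
  assumes "0 < l"
  shows "avg (weight_measure \<mu>) (cube a l) f \<le> ennreal s
    \<longleftrightarrow> (\<integral>\<^sup>+x\<in>cube a l. f x \<partial>weight_measure \<mu>) \<le> ennreal (s * m (cube a l))"
proof -
  have *: "emeasure (weight_measure \<mu>) (cube a l) = ennreal (m (cube a l))" "0 < m (cube a l)"
    using assms by (auto intro: emeasure_eq_m m_cube_pos)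
  have "ennreal (s * m (cube a l)) = ennreal s * ennreal (m (cube a l))"
    by (simp add: ennreal_mult'')
  then show ?thesis
    unfolding avg_def *(1) using *(2) by (simp add: divide_le_ennreal_iff)
qed

text \<open>\<open>A\<close> bounds the averages over all cubes containing Q. Where the maximal
  function is at most \<open>doubling_const * A\<close>, Chebyshev for \<mu> suffices. Elsewhere a
  nearly optimal cube is no larger than Q and stays in its dilate, so
  \<open>mixed_weak_type_cover\<close> applies with \<open>X\<close> that dilate and \<nu> = |g|
  \<mu>.\<close>

lemma mixed_weak_type_maximal:
  obtains K where "0 < K"
    "\<And>g t A a l S. \<lbrakk>g \<in> borel_measurable lebesgue; 0 < l; 0 < t; 0 < A;
      \<And>b h. \<lbrakk>0 < h; cube a l \<subseteq> cube b h\<rbrakk> \<Longrightarrow>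
        avg (weight_measure \<mu>) (cube b h) (\<lambda>y. ennreal \<bar>g y\<bar>) \<le> ennreal A;
      \<And>x. x \<in> S \<Longrightarrow> x \<in> cube a l; \<And>x. x \<in> S \<Longrightarrow> maximal \<mu> g x < \<infinity>;
      \<And>x. x \<in> S \<Longrightarrow> ennreal t < ennreal (\<mu> x) * maximal \<mu> g x\<rbrakk> \<Longrightarrow>
      \<exists>T\<in>sets lebesgue. S \<subseteq> T \<and> emeasure lebesgue T \<le> ennreal (K * A / t * m (cube a l))"
proof -
  obtain K where K: "0 < K" and cover:
    "\<And>\<nu> t B a l k S X. \<lbrakk>sets \<nu> = sets lebesgue; 0 < t;
      \<And>x. x \<in> S \<Longrightarrow> 0 < l x \<and> l x \<le> B; \<And>x. x \<in> S \<Longrightarrow> x \<in> cube (a x) (l x);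
      \<And>x. x \<in> S \<Longrightarrow> ennreal (2 powr real_of_int (k x) * m (cube (a x) (l x))) \<le> emeasure \<nu> (cube (a x) (l x));
      \<And>x b h. \<lbrakk>x \<in> S; 0 < h; x \<in> cube b h\<rbrakk> \<Longrightarrow>
        emeasure \<nu> (cube b h) \<le> ennreal (2 powr real_of_int (k x + 1) * m (cube b h));
      \<And>x. x \<in> S \<Longrightarrow> t / 2 powr real_of_int (k x + 1) < \<mu> x;
      X \<in> sets lebesgue; emeasure \<nu> X < \<infinity>; \<And>x. x \<in> S \<Longrightarrow> cube (a x) (l x) \<subseteq> X\<rbrakk> \<Longrightarrow>
      \<exists>T\<in>sets lebesgue. S \<subseteq> T \<and> emeasure lebesgue T \<le> ennreal (K / t) * emeasure \<nu> X"
    by (rule mixed_weak_type_cover) blast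
  let ?D = doubling_const
  note D = doubling_const_pos
  show thesis
  proof
    show "0 < ?D + K * ?D" using K D by (intro add_pos_pos mult_pos_pos)
    fix g t A S and a :: "real^'n" and l :: real
    assume g: "g \<in> borel_measurable lebesgue" and l: "0 < l" and t: "0 < t" and A: "0 < A"
      and avgA: "\<And>b h. \<lbrakk>0 < h; cube a l \<subseteq> cube b h\<rbrakk> \<Longrightarrow>
        avg (weight_measure \<mu>) (cube b h) (\<lambda>y. ennreal \<bar>g y\<bar>) \<le> ennreal A"
      and S: "\<And>x. x \<in> S \<Longrightarrow> x \<in> cube a l" and fin: "\<And>x. x \<in> S \<Longrightarrow> maximal \<mu> g x < \<infinity>"
      and large: "\<And>x. x \<in> S \<Longrightarrow> ennreal t < ennreal (\<mu> x) * maximal \<mu> g x"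
    note [measurable] = g
    define \<nu> where "\<nu> = density (weight_measure \<mu>) (\<lambda>y. ennreal \<bar>g y\<bar>)"
    have \<nu>sets: "sets \<nu> = sets lebesgue" by (simp add: \<nu>_def)
    have \<nu>E: "emeasure \<nu> E = (\<integral>\<^sup>+y\<in>E. ennreal \<bar>g y\<bar> \<partial>weight_measure \<mu>)" if "E \<in> sets lebesgue" for E
      unfolding \<nu>_def using that by (intro emeasure_density) auto
    have avg_iff: "avg (weight_measure \<mu>) (cube b h) (\<lambda>y. ennreal \<bar>g y\<bar>) \<le> ennreal s
        \<longleftrightarrow> emeasure \<nu> (cube b h) \<le> ennreal (s * m (cube b h))" if "0 < h" for b h s
      using avg_weight_measure_le_iff[OF that] \<nu>E by simp
    have dil: "emeasure \<nu> (dilated_cube b h) \<le> ennreal (?D * A * m (cube b h))"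
      if h: "0 < h" "cube a l \<subseteq> dilated_cube b h" for b h
    proof -
      have h': "0 < 10 * real CARD('n) * h" using h by simp
      have "emeasure \<nu> (dilated_cube b h) \<le> ennreal (A * m (dilated_cube b h))"
        unfolding dilated_cube_def using avgA[OF h' h(2)[unfolded dilated_cube_def]] avg_iff[OF h'] by blast
      also have "\<dots> \<le> ennreal (A * (?D * m (cube b h)))"
        using doubling[OF h(1)] A by (intro ennreal_leI mult_left_mono) auto
      finally show ?thesis by (simp add: mult_ac)
    qed
    define M where "M x = enn2real (maximal \<mu> g x)" for x
    have M: "maximal \<mu> g x = ennreal (M x)" if "x \<in> S" for x
      using fin[OF that] by (simp add: M_def)
    have mupos: "0 < \<mu> x" "t < \<mu> x * M x" if x: "x \<in> S" for x
    proof -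
      show *: "0 < \<mu> x"
      proof (rule ccontr)
        assume "\<not> 0 < \<mu> x"
        then have "ennreal (\<mu> x) = 0" by (simp add: ennreal_neg)
        with large[OF x] show False by simp
      qed
      have "0 \<le> M x" by (simp add: M_def)
      then have "ennreal (\<mu> x * M x) = ennreal (\<mu> x) * maximal \<mu> g x"
        using * unfolding M[OF x] by (intro ennreal_mult) auto
      with large[OF x] have "ennreal t < ennreal (\<mu> x * M x)" by simp
      then show "t < \<mu> x * M x" using t by (subst (asm) ennreal_less_iff) auto
    qed
    define S1 where "S1 = {x \<in> S. M x \<le> ?D * A}"
    define S2 where "S2 = {x \<in> S. ?D * A < M x}"
    define T1 where "T1 = {x \<in> cube a l. t / (?D * A) < \<mu> x}"
    have T1: "T1 \<in> sets lebesgue" unfolding T1_def by (rule level_sets) simp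
    have "S1 \<subseteq> T1"
    proof
      fix x assume x: "x \<in> S1"
      then have xS: "x \<in> S" and "M x \<le> ?D * A" by (auto simp: S1_def)
      then have "t < \<mu> x * (?D * A)"
        using mupos[OF xS] mult_left_mono[of "M x" "?D * A" "\<mu> x"] by linarith
      then have "t / (?D * A) < \<mu> x" using D A by (simp add: field_simps)
      then show "x \<in> T1" using S[OF xS] by (simp add: T1_def)
    qed
    have "t / (?D * A) * vol T1 \<le> m T1"
      using T1 l t D A by (intro level_ge[of _ a l]) (auto simp: T1_def)
    also have "\<dots> \<le> m (cube a l)"
      using T1 l by (intro m_mono[of _ _ a l]) (auto simp: T1_def)
    finally have "vol T1 \<le> ?D * A / t * m (cube a l)"
      using t D A by (simp add: field_simps)
    moreover have "emeasure lebesgue T1 = ennreal (vol T1)"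
      using T1 l by (intro emeasure_subset_cube[of _ a l]) (auto simp: T1_def)
    ultimately have eT1: "emeasure lebesgue T1 \<le> ennreal (?D * A / t * m (cube a l))"
      by (simp add: ennreal_leI)

    \<comment> \<open>Ceiling minus one gives 2^k < M \<le> 2^{k+1}. The strict lower bound is what
      yields a cube with average above 2^k.\<close>
    define k where "k x = \<lceil>log 2 (M x)\<rceil> - 1" for x
    have Mpos: "0 < M x" if "x \<in> S2" for x
    proof -
      have "0 < ?D * A" using D A by simp
      then show ?thesis using that by (auto simp: S2_def)
    qed
    have k: "2 powr real_of_int (k x) < M x" "M x \<le> 2 powr real_of_int (k x + 1)" if x: "x \<in> S2" for x
    proof -
      have "real_of_int (k x) < log 2 (M x)" "log 2 (M x) \<le> real_of_int (k x + 1)"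
        unfolding k_def by linarith+
      then show "2 powr real_of_int (k x) < M x" "M x \<le> 2 powr real_of_int (k x + 1)"
        using Mpos[OF x] by (simp_all only: less_log_iff log_le_iff one_less_numeral_iff semiring_norm)
    qed
    \<comment> \<open>The average of the selected cube beats both bounds: 2^k gives its level, and
      \<open>?D * A\<close> will bound its size.\<close>
    have "\<forall>x. \<exists>bh. x \<in> S2 \<longrightarrow> 0 < snd bh \<and> x \<in> cube (fst bh) (snd bh) \<and>
      ennreal (max (2 powr real_of_int (k x)) (?D * A)) < avg (weight_measure \<mu>) (cube (fst bh) (snd bh)) (\<lambda>y. ennreal \<bar>g y\<bar>)"
    proof
      fix x show "\<exists>bh. x \<in> S2 \<longrightarrow> 0 < snd bh \<and> x \<in> cube (fst bh) (snd bh) \<and>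
        ennreal (max (2 powr real_of_int (k x)) (?D * A)) < avg (weight_measure \<mu>) (cube (fst bh) (snd bh)) (\<lambda>y. ennreal \<bar>g y\<bar>)"
      proof (cases "x \<in> S2")
        case True
        then have "ennreal (max (2 powr real_of_int (k x)) (?D * A)) < maximal \<mu> g x"
        proof -
          have "max (2 powr real_of_int (k x)) (?D * A) < M x" "x \<in> S"
            using True k(1)[OF True] by (auto simp: S2_def)
          moreover have "0 \<le> max (2 powr real_of_int (k x)) (?D * A)" by (rule max.coboundedI1) simp
          ultimately show ?thesis using M[of x] by (simp add: ennreal_less_iff del: max_less_iff_conj)
        qed
        from less_maximalD[OF this] show ?thesis by auto
      qed auto
    qed
    then obtain bh where bh: "\<forall>x. x \<in> S2 \<longrightarrow> 0 < snd (bh x) \<and> x \<in> cube (fst (bh x)) (snd (bh x)) \<and>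
      ennreal (max (2 powr real_of_int (k x)) (?D * A))
        < avg (weight_measure \<mu>) (cube (fst (bh x)) (snd (bh x))) (\<lambda>y. ennreal \<bar>g y\<bar>)"
      by (rule exE[OF choice])
    define b where "b x = fst (bh x)" for x
    define h where "h x = snd (bh x)" for x
    have bh: "0 < h x" "x \<in> cube (b x) (h x)"
      "ennreal (max (2 powr real_of_int (k x)) (?D * A))
        < avg (weight_measure \<mu>) (cube (b x) (h x)) (\<lambda>y. ennreal \<bar>g y\<bar>)" if "x \<in> S2" for x
      using bh that by (auto simp: b_def h_def)
    have big: "ennreal (2 powr real_of_int (k x) * m (cube (b x) (h x))) < emeasure \<nu> (cube (b x) (h x))"
      "ennreal (?D * A * m (cube (b x) (h x))) < emeasure \<nu> (cube (b x) (h x))" if x: "x \<in> S2" for x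
    proof -
      have "ennreal (2 powr real_of_int (k x)) < avg (weight_measure \<mu>) (cube (b x) (h x)) (\<lambda>y. ennreal \<bar>g y\<bar>)"
        by (rule le_less_trans[OF ennreal_leI bh(3)[OF x]]) simp
      then show "ennreal (2 powr real_of_int (k x) * m (cube (b x) (h x))) < emeasure \<nu> (cube (b x) (h x))"
        using avg_iff[OF bh(1)[OF x]] by (meson not_le)
      have "ennreal (?D * A) < avg (weight_measure \<mu>) (cube (b x) (h x)) (\<lambda>y. ennreal \<bar>g y\<bar>)"
        by (rule le_less_trans[OF ennreal_leI bh(3)[OF x]]) simp
      then show "ennreal (?D * A * m (cube (b x) (h x))) < emeasure \<nu> (cube (b x) (h x))"
        using avg_iff[OF bh(1)[OF x]] by (meson not_le)
    qed
    have xa: "x \<in> cube a l" if "x \<in> S2" for x using S that by (auto simp: S2_def)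
    have hl: "h x \<le> l" if x: "x \<in> S2" for x
    proof (rule ccontr)
      assume "\<not> h x \<le> l"
      \<comment> \<open>A larger cube would have a dilate containing Q, with average at most
        \<open>A\<close>; doubling then bounds \<nu> on the cube itself by \<open>?D * A\<close>
        times its \<mu>-measure, contrary to its selection.\<close>
      then have "cube a l \<subseteq> dilated_cube (b x) (h x)"
        using cube_subset_dilated_cube_meets[OF bh(2)[OF x] xa[OF x]] by simp
      from dil[OF bh(1)[OF x] this]
      have "emeasure \<nu> (cube (b x) (h x)) \<le> ennreal (?D * A * m (cube (b x) (h x)))"
        by (rule order_trans[rotated]) (intro emeasure_mono cube_subset_dilated_cube, simp add: \<nu>sets)
      with big(2)[OF x] show False by simp
    qed
    have dila: "emeasure \<nu> (dilated_cube a l) \<le> ennreal (?D * A * m (cube a l))"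
      by (rule dil[OF l cube_subset_dilated_cube])
    have "\<exists>T\<in>sets lebesgue. S2 \<subseteq> T \<and> emeasure lebesgue T \<le> ennreal (K / t) * emeasure \<nu> (dilated_cube a l)"
    proof (rule cover[OF \<nu>sets t, of S2 h l b k])
      fix x assume x: "x \<in> S2"
      show "0 < h x \<and> h x \<le> l" "x \<in> cube (b x) (h x)" using bh hl x by auto
      show "ennreal (2 powr real_of_int (k x) * m (cube (b x) (h x))) \<le> emeasure \<nu> (cube (b x) (h x))"
        using big(1)[OF x] by simp
      show "cube (b x) (h x) \<subseteq> dilated_cube a l"
        by (rule cube_subset_dilated_cube_meets[OF xa[OF x] bh(2)[OF x] hl[OF x]])
      have xS: "x \<in> S" using x by (simp add: S2_def)
      have "t < \<mu> x * 2 powr real_of_int (k x + 1)"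
        using mupos[OF xS] mult_left_mono[OF k(2)[OF x], of "\<mu> x"] by linarith
      then show "t / 2 powr real_of_int (k x + 1) < \<mu> x"
        by (subst pos_divide_less_eq) auto
      fix c s assume s: "0 < (s::real)" "x \<in> cube c s"
      have "avg (weight_measure \<mu>) (cube c s) (\<lambda>y. ennreal \<bar>g y\<bar>) \<le> ennreal (M x)"
        using avg_le_maximal[OF s, of \<mu> g] unfolding M[OF xS] .
      also have "\<dots> \<le> ennreal (2 powr real_of_int (k x + 1))"
        using k(2)[OF x] by (rule ennreal_leI)
      finally show "emeasure \<nu> (cube c s) \<le> ennreal (2 powr real_of_int (k x + 1) * m (cube c s))"
        using avg_iff[OF s(1)] by blast
    next
      show "emeasure \<nu> (dilated_cube a l) < \<infinity>"
        using dila by (rule le_less_trans) simp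
    qed simp
    then obtain T2 where T2: "T2 \<in> sets lebesgue" "S2 \<subseteq> T2"
      "emeasure lebesgue T2 \<le> ennreal (K / t) * emeasure \<nu> (dilated_cube a l)" by blast
    note T2(3)
    also have "ennreal (K / t) * emeasure \<nu> (dilated_cube a l) \<le> ennreal (K / t) * ennreal (?D * A * m (cube a l))"
      using dila by (rule mult_left_mono) simp
    also have "\<dots> = ennreal (K / t * (?D * A * m (cube a l)))"
      using K t D A by (intro ennreal_mult[symmetric]) auto
    finally have eT2: "emeasure lebesgue T2 \<le> ennreal (K / t * (?D * A * m (cube a l)))" .
    have "emeasure lebesgue (T1 \<union> T2) \<le> emeasure lebesgue T1 + emeasure lebesgue T2"
      using T1 T2 by (intro emeasure_subadditive) auto
    also have "\<dots> \<le> ennreal (?D * A / t * m (cube a l)) + ennreal (K / t * (?D * A * m (cube a l)))"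
      using eT1 eT2 by (rule add_mono)
    also have "\<dots> = ennreal (?D * A / t * m (cube a l) + K / t * (?D * A * m (cube a l)))"
      using K t D A by (intro ennreal_plus[symmetric]) auto
    also have "?D * A / t * m (cube a l) + K / t * (?D * A * m (cube a l)) = (?D + K * ?D) * A / t * m (cube a l)"
      using t by (simp add: field_simps)
    finally have "emeasure lebesgue (T1 \<union> T2) \<le> ennreal ((?D + K * ?D) * A / t * m (cube a l))" .
    moreover have "S \<subseteq> T1 \<union> T2"
    proof
      fix x assume "x \<in> S"
      then have "x \<in> S1 \<or> x \<in> S2" by (auto simp: S1_def S2_def)
      then show "x \<in> T1 \<union> T2" using \<open>S1 \<subseteq> T1\<close> T2(2) by blast
    qed
    ultimately show "\<exists>T\<in>sets lebesgue. S \<subseteq> T \<and>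
        emeasure lebesgue T \<le> ennreal ((?D + K * ?D) * A / t * m (cube a l))"
      using T1 T2(1) by blast
  qed
qed

end

section \<open>The factors of the restricted class\<close>

text \<open>The supremum of the admissible lower bounds is the limit of countably many of them, so
  their null sets can be united.\<close>

lemma essinf_AE: "AE x in M. essinf M f \<le> f x"
proof (cases "essinf M f = 0")
  case False
  let ?A = "{z. AE x in M. z \<le> f x}"
  have "?A \<noteq> {}" by (auto intro!: exI[of _ 0])
  then obtain z :: "nat \<Rightarrow> ennreal" where z: "range z \<subseteq> ?A" "Sup ?A = (SUP i. z i)"
    using ennreal_Sup_countable_SUP[of ?A] by metis
  then have "AE x in M. \<forall>i. z i \<le> f x" by (subst AE_all_countable) auto
  then show ?thesis
    by eventually_elim (auto simp: essinf_def z intro!: SUP_least)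
qed simp

lemma essinf_greatest: "AE x in M. z \<le> f x \<Longrightarrow> z \<le> essinf M f"
  unfolding essinf_def by (rule Sup_upper) simp

lemma epow_ennreal: "0 < x \<Longrightarrow> epow (ennreal x) a = ennreal (x powr a)"
  by (auto simp: epow_def)

lemma epow_mono:
  assumes "x \<le> y" "0 \<le> a"
  shows "epow x a \<le> epow y a"
proof (cases "a = 0 \<or> x = 0 \<or> y = \<infinity>")
  case False
  then obtain s t where st: "x = ennreal s" "y = ennreal t" "0 < s" "0 < t"
    using assms(1) by (cases x; cases y) (auto simp: top_unique less_le)
  with assms have "s powr a \<le> t powr a" by (intro powr_mono2) auto
  with st show ?thesis by (simp add: epow_ennreal ennreal_leI)
qed (use assms in \<open>auto simp: epow_def\<close>)

lemma epow_antimono: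
  assumes "x \<le> y" "a \<le> 0"
  shows "epow y a \<le> epow x a"
proof (cases "a = 0 \<or> x = 0 \<or> y = \<infinity>")
  case False
  then obtain s t where st: "x = ennreal s" "y = ennreal t" "0 < s" "0 < t"
    using assms(1) by (cases x; cases y) (auto simp: top_unique less_le)
  with assms have "t powr a \<le> s powr a" by (intro powr_mono2') auto
  with st show ?thesis by (simp add: epow_ennreal ennreal_leI)
qed (use assms in \<open>auto simp: epow_def\<close>)

lemma SUP_cubes_less_top_iff:
  fixes f :: "(real^'n) set \<Rightarrow> ennreal"
  shows "(SUP Q\<in>cubes. f Q) < \<infinity> \<longleftrightarrow> (\<exists>K>0. \<forall>a l. 0 < l \<longrightarrow> f (cube a l) \<le> ennreal K)"
proof
  assume *: "(SUP Q\<in>cubes. f Q) < \<infinity>"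
  show "\<exists>K>0. \<forall>a l. 0 < l \<longrightarrow> f (cube a l) \<le> ennreal K"
  proof (intro exI[of _ "enn2real (SUP Q\<in>cubes. f Q) + 1"] conjI allI impI)
    show "0 < enn2real (SUP Q\<in>cubes. f Q) + 1" by (simp add: add_nonneg_pos)
    fix a :: "real^'n" and l :: real assume "0 < l"
    then have "f (cube a l) \<le> (SUP Q\<in>cubes. f Q)" by (intro SUP_upper) (auto simp: cubes_eq)
    also have "\<dots> = ennreal (enn2real (SUP Q\<in>cubes. f Q))" using * by simp
    also have "\<dots> \<le> ennreal (enn2real (SUP Q\<in>cubes. f Q) + 1)" by (intro ennreal_leI) simp
    finally show "f (cube a l) \<le> ennreal (enn2real (SUP Q\<in>cubes. f Q) + 1)" .
  qed
next
  assume "\<exists>K>0. \<forall>a l. 0 < l \<longrightarrow> f (cube a l) \<le> ennreal K"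
  then obtain K where "\<forall>a l. 0 < l \<longrightarrow> f (cube a l) \<le> ennreal K" by auto
  then have "(SUP Q\<in>cubes. f Q) \<le> ennreal K" by (intro SUP_least) (auto simp: cubes_eq)
  then show "(SUP Q\<in>cubes. f Q) < \<infinity>" by (rule le_less_trans) simp
qed

lemma AE_restrict_cube_iff:
  "(AE x in restrict_space lebesgue (cube a l). P x) \<longleftrightarrow> (AE x in lebesgue. x \<in> cube a l \<longrightarrow> P x)"
  by (rule AE_restrict_space_iff) simp

lemma cube_not_AE_empty:
  assumes "0 < l" "AE x in lebesgue. x \<notin> cube a l"
  shows False
proof -
  have "emeasure lebesgue (cube a l) = 0"
    using assms(2) by (subst (asm) AE_iff_measurable[of "cube a l"]) auto
  then show False using assms(1) by (simp add: emeasure_cube)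
qed

lemma weight_measurable: "weight w \<Longrightarrow> w \<in> borel_measurable lebesgue"
  and weight_AE_pos: "weight w \<Longrightarrow> AE x in lebesgue. 0 < w x"
  by (simp_all add: weight_def)

lemma weight_powr: "weight w \<Longrightarrow> weight (\<lambda>x. w x powr a)"
proof -
  assume w: "weight w"
  note [measurable] = weight_measurable[OF w]
  have "AE x in lebesgue. 0 < w x powr a"
    using weight_AE_pos[OF w] by eventually_elim simp
  then show ?thesis by (simp add: weight_def)
qed

lemma weight_prod:
  assumes "finite I" "\<And>i. i \<in> I \<Longrightarrow> weight (w i)"
  shows "weight (\<lambda>x. \<Prod>i\<in>I. w i x)"
proof -
  have "AE x in lebesgue. \<forall>i\<in>I. 0 < w i x"
    using assms by (intro AE_finite_allI) (auto intro: weight_AE_pos)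
  then have "AE x in lebesgue. 0 < (\<Prod>i\<in>I. w i x)"
    by eventually_elim (auto intro: prod_pos)
  then show ?thesis
    using assms weight_measurable by (auto simp: weight_def intro!: borel_measurable_prod)
qed

lemma weight_mu_weight:
  assumes "\<And>i. i \<in> {1..<m} \<Longrightarrow> weight (w i)"
  shows "weight (mu_weight m p r w)"
  unfolding mu_weight_def using assms by (intro weight_powr weight_prod) auto

text \<open>The weak norm read at the single level \<open>F * \<eta> powr (- s)\<close>, the one at
  which it bounds the relative volume by \<eta>.\<close>

lemma weak_norm_le_level:
  assumes s: "0 < s" and l: "0 < l" and f: "f \<in> borel_measurable lebesgue" "\<And>x. 0 \<le> f x"
    and le: "weak_norm (scale_measure (1 / emeasure lebesgue (cube a l)) lebesgue) (1 / s)
      (\<lambda>x. indicator (cube a l) x * f x) \<le> ennreal F"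
    and F: "0 < F" and \<eta>: "0 < \<eta>"
  shows "measure lebesgue {x \<in> cube a l. F * \<eta> powr (- s) < f x} \<le> \<eta> * measure lebesgue (cube a l)"
proof -
  note [measurable] = f(1)
  let ?Q = "cube a l"
  define t where "t = F * \<eta> powr (- s)"
  let ?B = "{x \<in> ?Q. t < f x}"
  have t: "0 < t" using F \<eta> by (simp add: t_def)
  have B: "?B \<in> sets lebesgue" by measurable
  have B_eq: "{x \<in> space (scale_measure (1 / emeasure lebesgue ?Q) lebesgue). t < \<bar>indicator ?Q x * f x\<bar>} = ?B"
    using t f(2) by (auto simp: indicator_def space_scale_measure)
  have vQ: "emeasure lebesgue ?Q = ennreal (measure lebesgue ?Q)" "0 < measure lebesgue ?Q"
    using l by (auto simp: emeasure_subset_cube[of _ a l] measure_cube_pos)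
  define b where "b = measure lebesgue ?B / measure lebesgue ?Q"
  have eS: "emeasure (scale_measure (1 / emeasure lebesgue ?Q) lebesgue) ?B = ennreal b"
  proof -
    have eB: "emeasure lebesgue ?B = ennreal (measure lebesgue ?B)"
      using l by (intro emeasure_subset_cube[OF B, of a l]) auto
    have "1 / ennreal (measure lebesgue ?Q) = ennreal (1 / measure lebesgue ?Q)"
      using vQ(2) by (metis divide_ennreal ennreal_1 zero_le_one)
    then have "emeasure (scale_measure (1 / emeasure lebesgue ?Q) lebesgue) ?B
        = ennreal (1 / measure lebesgue ?Q) * ennreal (measure lebesgue ?B)"
      unfolding emeasure_scale_measure vQ(1) eB by (simp only:)
    also have "\<dots> = ennreal b"
      unfolding b_def by (subst ennreal_mult[symmetric]) (simp_all only: measure_nonneg zero_le_divide_1_iff times_divide_eq_left mult_1)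
    finally show ?thesis .
  qed
  have ss: "1 / (1 / s) = s" by simp
  have "ennreal t * epow (ennreal b) s \<le> weak_norm (scale_measure (1 / emeasure lebesgue ?Q) lebesgue) (1 / s)
      (\<lambda>x. indicator ?Q x * f x)"
    unfolding weak_norm_def
  proof (rule SUP_upper2)
    show "t \<in> {0<..}" using t by simp
  qed (simp only: B_eq eS ss)
  then have *: "ennreal t * epow (ennreal b) s \<le> ennreal F" using le by (rule order_trans)
  have level_ratio: "0 \<le> b" by (simp add: b_def)
  have bQ: "measure lebesgue ?B = b * measure lebesgue ?Q" using vQ(2) by (simp add: b_def)
  have "b \<le> \<eta>"
  proof (cases "0 < b")
    case True
    then have "ennreal (t * b powr s) \<le> ennreal F"
      using * t by (simp add: epow_ennreal ennreal_mult)
    then have "F * (\<eta> powr (- s) * b powr s) \<le> F * 1" using F by (simp add: t_def mult_ac)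
    then have "\<eta> powr (- s) * b powr s \<le> 1" using F by (subst (asm) mult_le_cancel_left_pos) auto
    then have "b powr s \<le> \<eta> powr s" using \<eta> by (simp add: powr_minus field_simps)
    then show ?thesis using powr_less_mono2[OF s, of \<eta> b] \<eta> by force
  qed (use \<eta> in simp)
  then show ?thesis unfolding t_def[symmetric] bQ by (rule mult_right_mono) simp
qed

text \<open>One form for finite and infinite \<delta>_i. If \<open>r i = p i\<close>, the power of
  \<eta> is 1 and the essential supremum makes the level set null.\<close>

lemma AR_factor_le_level:
  assumes w: "weight (w i)" and l: "0 < l" and i: "i \<noteq> m + 1" and r: "0 < r i" "r i \<le> p i"
    and le: "AR_factor m p r w (cube a l) i \<le> ennreal F" and F: "0 < F" and \<eta>: "0 < \<eta>"
  shows "measure lebesgue {x \<in> cube a l. F * \<eta> powr (- (1 / r i - 1 / p i)) < w i x powr (- 1 / p i)}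
    \<le> \<eta> * measure lebesgue (cube a l)"
proof (cases "r i = p i")
  case True
  note [measurable] = weight_measurable[OF w]
  let ?B = "{x \<in> cube a l. F < w i x powr (- 1 / p i)}"
  have "AE x in restrict_space lebesgue (cube a l). ennreal (w i x powr (- 1 / p i)) \<le> ennreal F"
    using esssup_AE by (rule eventually_mono) (rule order_trans[OF _ le[unfolded AR_factor_def if_P[OF True]]])
  then have "AE x in lebesgue. x \<notin> ?B"
    unfolding AE_restrict_cube_iff
    by (rule eventually_mono) (simp add: not_less ennreal_le_iff[OF less_imp_le[OF F]])
  then have "emeasure lebesgue ?B = 0"
    by (subst (asm) AE_iff_measurable[of ?B]) auto
  then have "measure lebesgue ?B = 0" by (simp add: measure_def)
  then show ?thesis using True \<eta> by simp
next
  case False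
  have s: "inv_delta m p r i = 1 / r i - 1 / p i" using i by (simp add: inv_delta_def inv_p_def)
  have "0 < 1 / r i - 1 / p i" using False r by (simp add: field_simps)
  then show ?thesis
    using le w l F \<eta> unfolding AR_factor_def if_not_P[OF False] s
    by (intro weak_norm_le_level) (auto intro: weight_measurable weight_powr)
qed

text \<open>If the factor were 0, \<open>AR_factor_le_level\<close> with \<eta> = 1/2 and
  arbitrarily small bounds would leave at most half of the cube to each set where
  \<open>w i x powr (- 1 / p i)\<close> exceeds a given positive number. These sets increase to
  almost all of the cube.\<close>

lemma AR_factor_pos:
  assumes w: "weight (w i)" and l: "0 < l" and i: "i \<noteq> m + 1" and r: "0 < r i" "r i \<le> p i"
  shows "0 < AR_factor m p r w (cube a l) i"
proof (rule ccontr)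
  assume "\<not> 0 < AR_factor m p r w (cube a l) i"
  then have 0: "AR_factor m p r w (cube a l) i = 0" by (simp add: not_gr_zero)
  define s where "s = 1 / r i - 1 / p i"
  note [measurable] = weight_measurable[OF w]
  define c :: real where "c = (1/2) powr (- s)"
  have c: "0 < c" by (simp add: c_def)
  define t where "t n = (1 / real (Suc n))" for n
  let ?B = "\<lambda>n. {x \<in> cube a l. t n * c < w i x powr (- 1 / p i)}"
  let ?P = "{x \<in> cube a l. 0 < w i x powr (- 1 / p i)}"
  have B: "?B n \<in> sets lebesgue" for n by measurable
  have "emeasure lebesgue (?B n) \<le> ennreal (1 / 2 * measure lebesgue (cube a l))" for n
  proof -
    have "emeasure lebesgue (?B n) = ennreal (measure lebesgue (?B n))"
      using l by (intro emeasure_subset_cube[OF B, where a = a and l = l]) auto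
    also have "\<dots> \<le> ennreal (1 / 2 * measure lebesgue (cube a l))"
      unfolding c_def s_def using w l i r
      by (intro ennreal_leI AR_factor_le_level[where m = m and r = r and i = i and p = p and w = w]) (simp_all add: 0 t_def)
    finally show ?thesis .
  qed
  then have "(SUP n. emeasure lebesgue (?B n)) \<le> ennreal (1 / 2 * measure lebesgue (cube a l))"
    by (rule SUP_least)
  moreover have "(SUP n. emeasure lebesgue (?B n)) = emeasure lebesgue (\<Union>n. ?B n)"
  proof (rule SUP_emeasure_incseq)
    show "range ?B \<subseteq> sets lebesgue" using B by auto
    show "incseq ?B"
    proof (intro incseq_SucI subsetI)
      fix n x assume "x \<in> ?B n"
      moreover have "t (Suc n) * c \<le> t n * c"
        using c by (intro mult_right_mono) (auto simp: t_def field_simps)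
      ultimately show "x \<in> ?B (Suc n)" by auto
    qed
  qed
  moreover have "(\<Union>n. ?B n) = ?P"
  proof (intro equalityI subsetI)
    fix x assume x: "x \<in> ?P"
    define y where "y = w i x powr (- 1 / p i) / c"
    have "0 < y" using x c by (simp add: y_def)
    then obtain n where "inverse (real (Suc n)) < y" using reals_Archimedean by blast
    then have "t n * c < w i x powr (- 1 / p i)"
      using c by (simp add: t_def y_def field_simps)
    with x show "x \<in> (\<Union>n. ?B n)" by auto
  next
    fix x assume "x \<in> (\<Union>n. ?B n)"
    then obtain n where n: "x \<in> cube a l" "t n * c < w i x powr (- 1 / p i)" by auto
    have "0 < t n * c" using c by (simp add: t_def)
    with n show "x \<in> ?P" by auto
  qed
  ultimately have "emeasure lebesgue ?P \<le> ennreal (1 / 2 * measure lebesgue (cube a l))"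
    by (simp only:)
  moreover have "emeasure lebesgue ?P = emeasure lebesgue (cube a l)"
    using weight_AE_pos[OF w] by (intro emeasure_eq_AE) (auto elim!: eventually_mono)
  ultimately show False
    using l by (simp add: emeasure_subset_cube[of _ a l] measure_cube_pos)
qed

lemma emeasure_weight_measure:
  assumes "weight \<mu>" "E \<in> sets lebesgue"
  shows "emeasure (weight_measure \<mu>) E = (\<integral>\<^sup>+x\<in>E. ennreal (\<mu> x) \<partial>lebesgue)"
  unfolding weight_measure_def using assms weight_measurable[OF assms(1)]
  by (intro emeasure_density) auto

lemma nn_integral_cube_pos:
  assumes "weight v" "0 < l"
  shows "0 < (\<integral>\<^sup>+x\<in>cube a l. ennreal (v x) \<partial>lebesgue)"
proof (rule ccontr)
  note [measurable] = weight_measurable[OF assms(1)]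
  assume "\<not> ?thesis"
  then have "(\<integral>\<^sup>+x\<in>cube a l. ennreal (v x) \<partial>lebesgue) = 0" by (simp add: not_gr_zero)
  then have "AE x in lebesgue. ennreal (v x) * indicator (cube a l) x = 0"
    by (subst (asm) nn_integral_0_iff_AE) auto
  with weight_AE_pos[OF assms(1)] have "AE x in lebesgue. x \<notin> cube a l"
    by eventually_elim (auto simp: indicator_def split: if_splits)
  with assms(2) show False by (rule cube_not_AE_empty)
qed

lemma avg_lebesgue_pos:
  assumes "weight v" "0 < l"
  shows "0 < avg lebesgue (cube a l) (\<lambda>x. ennreal (v x))"
  unfolding avg_def using nn_integral_cube_pos[OF assms] assms(2)
  by (simp add: ennreal_zero_less_divide emeasure_cube)

lemma epow_pos: "0 < x \<Longrightarrow> 0 < a \<Longrightarrow> 0 < epow x a"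
  by (cases x) (auto simp: epow_def)

lemma epow_mult_ennreal:
  assumes "0 < c"
  shows "epow (ennreal c * x) a = ennreal (c powr a) * epow x a"
proof (cases x)
  case (real y)
  show ?thesis
  proof (cases "y = 0 \<or> a = 0")
    case False
    with real assms have "epow (ennreal (c * y)) a = ennreal ((c * y) powr a)"
      by (intro epow_ennreal) simp
    also have "(c * y) powr a = c powr a * y powr a" by (rule powr_mult)
    finally show ?thesis using False real assms by (simp add: epow_ennreal ennreal_mult)
  qed (use real assms in \<open>auto simp: epow_def ennreal_mult_top\<close>)
qed (use assms in \<open>auto simp: epow_def ennreal_mult_top\<close>)

text \<open>Since 0 times \<infinity> is 0, finiteness of the product passes to the factors only
  through their positivity.\<close>

lemma prod_ennreal_eq_real:
  fixes f :: "'i \<Rightarrow> ennreal"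
  assumes "finite I" "\<And>i. i \<in> I \<Longrightarrow> 0 < f i" "(\<Prod>i\<in>I. f i) < \<infinity>"
  obtains F where "\<And>i. 0 < F i" "\<And>i. i \<in> I \<Longrightarrow> f i = ennreal (F i)"
    "(\<Prod>i\<in>I. f i) = ennreal (\<Prod>i\<in>I. F i)"
proof -
  have fin: "f i < \<infinity>" if i: "i \<in> I" for i
  proof (rule ccontr)
    assume "\<not> f i < \<infinity>"
    then have "f i = top" unfolding infinity_ennreal_def by (metis top.not_eq_extremum)
    moreover have "f j \<noteq> 0" if "j \<in> I" for j using assms(2)[OF that] by simp
    then have "(\<Prod>j\<in>I - {i}. f j) \<noteq> 0"
      using assms(1) by (simp add: prod_zero_iff)
    ultimately have "(\<Prod>i\<in>I. f i) = top"
      using assms(1) i by (simp add: prod.remove ennreal_top_mult)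
    with assms(3) show False by simp
  qed
  define F where "F i = (if i \<in> I then enn2real (f i) else 1)" for i
  have F: "0 < F i" for i
    using assms(2) fin by (auto simp: F_def enn2real_positive_iff)
  moreover have fF: "f i = ennreal (F i)" if "i \<in> I" for i
    using fin[OF that] that by (simp add: F_def)
  moreover have "(\<Prod>i\<in>I. f i) = (\<Prod>i\<in>I. ennreal (F i))"
    by (intro prod.cong fF) auto
  then have "(\<Prod>i\<in>I. f i) = ennreal (\<Prod>i\<in>I. F i)"
    using F by (subst (asm) prod_ennreal) (auto intro: less_imp_le)
  ultimately show thesis by (rule that)
qed

lemma lmeasurable_subset_cube:
  "E \<in> sets lebesgue \<Longrightarrow> E \<subseteq> cube a l \<Longrightarrow> E \<in> lmeasurable"
  by (rule fmeasurableI2[of "cube a l"]) (auto simp: cube_def)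

text \<open>Outside a set of at most half the measure of \<open>E\<close>, each factor \<open>w\<^sub>i\<^bsup>-1/p\<^esup>\<close> is bounded by its weak norm
  up to a power of \<open>\<eta>\<close>, and \<open>\<mu>\<close> is the power \<open>-\<rho>\<close> of the product of these factors.\<close>

lemma Hoelder_lower_bound:
  assumes m: "1 \<le> m" and w: "\<And>i. i \<in> {1..<m} \<Longrightarrow> weight (w i)"
    and r: "\<And>i. i \<in> {1..<m} \<Longrightarrow> 1 \<le> r i \<and> r i \<le> p i"
    and \<rho>: "0 < rho_exp m p r" and l: "0 < l"
    and E: "E \<in> sets lebesgue" "E \<subseteq> cube a l" "0 < measure lebesgue E"
    and F: "\<And>i. 0 < F i" "\<And>i. i \<in> {1..<m} \<Longrightarrow> AR_factor m p r w (cube a l) i \<le> ennreal (F i)"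
    and \<eta>: "\<eta> = measure lebesgue E / (2 * real m * measure lebesgue (cube a l))"
  shows "ennreal (measure lebesgue E / 2 * (\<Prod>i\<in>{1..<m}. \<eta> powr (1 / r i - 1 / p i) / F i) powr rho_exp m p r)
    \<le> emeasure (weight_measure (mu_weight m p r w)) E"
proof -
  let ?Q = "cube a l" and ?\<mu> = "mu_weight m p r w" and ?\<rho> = "rho_exp m p r"
  have vQ: "0 < measure lebesgue ?Q" using l by (rule measure_cube_pos)
  have \<eta>0: "0 < \<eta>" using E vQ m by (simp add: \<eta>)
  define h where "h i = F i * \<eta> powr (- (1 / r i - 1 / p i))" for i
  have h: "0 < h i" for i using F(1)[of i] \<eta>0 by (simp add: h_def)
  have h_inv: "\<eta> powr (1 / r i - 1 / p i) / F i = 1 / h i" for i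
    unfolding h_def powr_minus_divide using \<eta>0 by simp
  define B where "B i = {x \<in> ?Q. h i < w i x powr (- 1 / p i)}" for i
  have B: "B i \<in> sets lebesgue" "B i \<subseteq> ?Q" if "i \<in> {1..<m}" for i
  proof -
    note [measurable] = weight_measurable[OF w[OF that]]
    show "B i \<in> sets lebesgue" unfolding B_def by measurable
  qed (auto simp: B_def)
  have volB: "measure lebesgue (B i) \<le> \<eta> * measure lebesgue ?Q" if i: "i \<in> {1..<m}" for i
    unfolding B_def h_def using w[OF i] l r[OF i] F(2)[OF i] F(1)[of i] \<eta>0 i
    by (intro AR_factor_le_level[where m = m and r = r and i = i and p = p and w = w]) auto
  define U where "U = (\<Union>i\<in>{1..<m}. B i)"
  define G where "G = E - U"
  have U: "U \<in> sets lebesgue" "U \<subseteq> ?Q"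
    unfolding U_def using B by (blast intro: sets.finite_UN)+
  have G: "G \<in> sets lebesgue" "G \<subseteq> ?Q" using U E by (auto simp: G_def)
  \<comment> \<open>\<eta> is chosen so that \<open>m\<close> exceptional sets of volume \<eta> |Q|
    add up to |E|/2.\<close>
  have "measure lebesgue U \<le> (\<Sum>i\<in>{1..<m}. measure lebesgue (B i))"
    unfolding U_def using B by (intro measure_UNION_le) auto
  also have "\<dots> \<le> (\<Sum>i\<in>{1..<m}. \<eta> * measure lebesgue ?Q)"
    by (intro sum_mono volB)
  also have "\<dots> = real (m - 1) * (\<eta> * measure lebesgue ?Q)" by simp
  also have "\<dots> \<le> real m * (\<eta> * measure lebesgue ?Q)"
    using \<eta>0 vQ by (intro mult_right_mono) auto
  also have "\<dots> = measure lebesgue E / 2" using m vQ by (simp add: \<eta>)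
  finally have "measure lebesgue U \<le> measure lebesgue E / 2" .
  moreover have "measure lebesgue E \<le> measure lebesgue (G \<union> U)"
    using E U G by (intro measure_mono_fmeasurable lmeasurable_subset_cube[of _ a l]) (auto simp: G_def)
  moreover have "measure lebesgue (G \<union> U) \<le> measure lebesgue G + measure lebesgue U"
    using G U by (intro measure_Un_le) auto
  ultimately have volG: "measure lebesgue E / 2 \<le> measure lebesgue G" by linarith
  define \<kappa> where "\<kappa> = (\<Prod>i\<in>{1..<m}. 1 / h i) powr ?\<rho>"
  have \<kappa>: "0 \<le> \<kappa>" by (simp add: \<kappa>_def)
  have "AE x in lebesgue. \<forall>i\<in>{1..<m}. 0 < w i x"
    using w by (intro AE_finite_allI) (auto intro: weight_AE_pos)
  then have AE: "AE x in lebesgue. ennreal \<kappa> * indicator G x \<le> ennreal (?\<mu> x) * indicator E x"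
  proof eventually_elim
    case (elim x)
    have "\<kappa> \<le> ?\<mu> x" if x: "x \<in> G"
      unfolding \<kappa>_def mu_weight_def
    proof (intro powr_mono2 prod_mono conjI)
      fix i assume i: "i \<in> {1..<m}"
      then have "w i x powr (- 1 / p i) \<le> h i"
        using x E(2) by (auto simp: G_def U_def B_def not_less)
      moreover have "w i x powr (- 1 / p i) = 1 / w i x powr (1 / p i)"
        using powr_minus_divide[of "w i x" "1 / p i"] by simp
      moreover have "0 < w i x" using elim i by blast
      then have "0 < w i x powr (1 / p i)" by simp
      ultimately show "1 / h i \<le> w i x powr (1 / p i)"
        using h[of i] by (simp add: field_simps)
    qed (use h \<rho> in \<open>auto intro!: prod_nonneg simp: less_imp_le\<close>)
    then show ?case by (auto simp: indicator_def G_def intro: ennreal_leI)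
  qed
  have \<mu>: "weight ?\<mu>" using w by (rule weight_mu_weight)
  have "ennreal (measure lebesgue E / 2 * \<kappa>) \<le> ennreal (\<kappa> * measure lebesgue G)"
    using mult_right_mono[OF volG \<kappa>] by (intro ennreal_leI) (simp add: mult.commute)
  also have "\<dots> = ennreal \<kappa> * emeasure lebesgue G"
    using G l by (simp add: emeasure_subset_cube[of G a l] ennreal_mult \<kappa>_def)
  also have "\<dots> = (\<integral>\<^sup>+x. ennreal \<kappa> * indicator G x \<partial>lebesgue)"
    using G by (simp add: nn_integral_cmult_indicator)
  also have "\<dots> \<le> (\<integral>\<^sup>+x\<in>E. ennreal (?\<mu> x) \<partial>lebesgue)"
    using AE by (rule nn_integral_mono_AE)
  also have "\<dots> = emeasure (weight_measure ?\<mu>) E"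
    using \<mu> E by (simp add: emeasure_weight_measure)
  finally show ?thesis unfolding h_inv \<kappa>_def .
qed

section \<open>The class condition cube by cube, and the resulting quantitative condition on
  \<mu>\<close>

lemma AR_factor_cong:
  "w i = w' i \<Longrightarrow> p i = p' i \<Longrightarrow> i \<noteq> m + 1 \<Longrightarrow> AR_factor m p r w Q i = AR_factor m p' r w' Q i"
  by (simp add: AR_factor_def inv_delta_def inv_p_def)

lemma inv_delta_last:
  assumes "1 \<le> m"
  shows "inv_delta m p r (m + 1) = (\<Sum>i\<in>{1..<m}. 1 / p i) + 1 / p m - inv_conj (r (m + 1))"
    and "1 / total_p m p = (\<Sum>i\<in>{1..<m}. 1 / p i) + 1 / p m"
proof -
  have "{1..m} = insert m {1..<m}" using assms by auto
  then show "1 / total_p m p = (\<Sum>i\<in>{1..<m}. 1 / p i) + 1 / p m"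
    by (simp add: total_p_def)
  then show "inv_delta m p r (m + 1) = (\<Sum>i\<in>{1..<m}. 1 / p i) + 1 / p m - inv_conj (r (m + 1))"
    by (simp add: inv_delta_def inv_p_def inv_conj_def)
qed

text \<open>\<open>D\<close> is 1/\<delta>_{m+1}. The weights are raised to p/p_i and then to
  \<delta>_{m+1}/p, so the total exponent p cancels and the dependence on the last weight can be
  split off.\<close>

lemma AR_class_iff:
  fixes w :: "nat \<Rightarrow> real^'n \<Rightarrow> real"
  assumes m: "1 \<le> m" and p: "\<forall>i\<in>{1..m}. 0 < p i"
    and D: "D = inv_delta m p r (m + 1)"
  shows "w \<in> AR_class m p r \<longleftrightarrow> (\<forall>i\<in>{1..m}. weight (w i)) \<and>
    (\<exists>K>0. \<forall>a l. 0 < l \<longrightarrow>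
      epow (avg lebesgue (cube a l) (\<lambda>x. ennreal ((\<Prod>i\<in>{1..<m}. w i x powr (1 / p i)) powr (1 / D)
          * w m x powr (1 / (D * p m))))) D
      * ((\<Prod>i\<in>{1..<m}. AR_factor m p r w (cube a l) i) * AR_factor m p r w (cube a l) m) \<le> ennreal K)"
proof -
  have split: "{1..m} = insert m {1..<m}" using m by auto
  have "0 < (\<Sum>i\<in>{1..m}. 1 / p i)" using p m by (intro sum_pos) auto
  then have t: "total_p m p \<noteq> 0" by (simp add: total_p_def)
  have eq1: "prod_weight m p w x powr ((1 / D) / total_p m p)
      = (\<Prod>i\<in>{1..<m}. w i x powr (1 / p i)) powr (1 / D) * w m x powr (1 / (D * p m))" for x
  proof -
    have "prod_weight m p w x powr ((1 / D) / total_p m p)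
        = (\<Prod>i\<in>{1..m}. (w i x powr (total_p m p / p i)) powr ((1 / D) / total_p m p))"
      unfolding prod_weight_def by (rule prod_powr_distrib)
    also have "\<dots> = (\<Prod>i\<in>{1..m}. (w i x powr (1 / p i)) powr (1 / D))"
      using t by (simp add: powr_powr mult.commute)
    also have "\<dots> = (w m x powr (1 / p m)) powr (1 / D) * (\<Prod>i\<in>{1..<m}. (w i x powr (1 / p i)) powr (1 / D))"
      unfolding split by simp
    also have "(\<Prod>i\<in>{1..<m}. (w i x powr (1 / p i)) powr (1 / D)) = (\<Prod>i\<in>{1..<m}. w i x powr (1 / p i)) powr (1 / D)"
      by (rule prod_powr_distrib[symmetric])
    also have "(w m x powr (1 / p m)) powr (1 / D) = w m x powr (1 / (D * p m))"
      by (simp add: powr_powr mult.commute)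
    finally show ?thesis by (simp add: mult.commute)
  qed
  have eq2: "(\<Prod>i\<in>{1..m}. AR_factor m p r w Q i)
      = (\<Prod>i\<in>{1..<m}. AR_factor m p r w Q i) * AR_factor m p r w Q m" for Q
    unfolding split by (simp add: mult.commute)
  show ?thesis
    unfolding AR_class_def mem_Collect_eq D[symmetric] eq1 eq2 SUP_cubes_less_top_iff ..
qed

text \<open>Passage to real numbers on one cube. Positivity of the average and of the factors makes
  each of them finite, and the class bound becomes an upper bound for \<mu>(Q) in terms of the
  product of the factors.\<close>

lemma cube_data:
  assumes w: "\<And>i. i \<in> {1..<m} \<Longrightarrow> weight (w i)"
    and r: "\<And>i. i \<in> {1..<m} \<Longrightarrow> 1 \<le> r i \<and> r i \<le> p i"
    and \<rho>: "0 < rho_exp m p r" and l: "0 < l" and K: "0 < K"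
    and le: "epow (avg lebesgue (cube a l) (\<lambda>x. ennreal (mu_weight m p r w x))) (1 / rho_exp m p r)
      * (\<Prod>i\<in>{1..<m}. AR_factor m p r w (cube a l) i) \<le> ennreal K"
  obtains F M where "\<And>i. 0 < F i" "\<And>i. i \<in> {1..<m} \<Longrightarrow> AR_factor m p r w (cube a l) i = ennreal (F i)"
    "(\<Prod>i\<in>{1..<m}. AR_factor m p r w (cube a l) i) = ennreal (\<Prod>i\<in>{1..<m}. F i)"
    "0 < M" "emeasure (weight_measure (mu_weight m p r w)) (cube a l) = ennreal M"
    "M \<le> (K / (\<Prod>i\<in>{1..<m}. F i)) powr rho_exp m p r * measure lebesgue (cube a l)"
proof -
  let ?Q = "cube a l" and ?\<mu> = "mu_weight m p r w" and ?\<rho> = "rho_exp m p r"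
  let ?A = "avg lebesgue ?Q (\<lambda>x. ennreal (?\<mu> x))" and ?P = "\<Prod>i\<in>{1..<m}. AR_factor m p r w ?Q i"
  have \<mu>: "weight ?\<mu>" using w by (rule weight_mu_weight)
  have v: "0 < measure lebesgue ?Q" "emeasure lebesgue ?Q = ennreal (measure lebesgue ?Q)"
    using l by (auto intro: measure_cube_pos emeasure_subset_cube)
  have fac: "0 < AR_factor m p r w ?Q i" if i: "i \<in> {1..<m}" for i
    using w[OF i] l r[OF i] i by (intro AR_factor_pos[where m = m and r = r and p = p and w = w and i = i]) auto
  have Apos: "0 < ?A" using \<mu> l by (rule avg_lebesgue_pos)
  then have epos: "0 < epow ?A (1 / ?\<rho>)" using \<rho> by (intro epow_pos) auto
  have lt: "epow ?A (1 / ?\<rho>) * ?P < \<infinity>" using le by (rule le_less_trans) simp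
  have "AR_factor m p r w ?Q i \<noteq> 0" if "i \<in> {1..<m}" for i using fac[OF that] by simp
  then have Ppos: "?P \<noteq> 0" by (simp add: prod_zero_iff)
  have fin: "epow ?A (1 / ?\<rho>) < \<infinity>" "?P < \<infinity>"
    using lt epos Ppos unfolding infinity_ennreal_def ennreal_mult_less_top by (metis less_irrefl)+
  from prod_ennreal_eq_real[OF _ fac fin(2)]
  obtain F where F: "\<And>i. 0 < F i" "\<And>i. i \<in> {1..<m} \<Longrightarrow> AR_factor m p r w ?Q i = ennreal (F i)"
    "?P = ennreal (\<Prod>i\<in>{1..<m}. F i)"
    by blast
  have Fp: "0 < (\<Prod>i\<in>{1..<m}. F i)" using F(1) by (rule prod_pos)
  have "?A \<noteq> \<infinity>" using fin(1) \<rho> by (auto simp: epow_def)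
  then obtain x where x: "?A = ennreal x" "0 < x"
    using Apos by (cases ?A) auto
  have "emeasure (weight_measure ?\<mu>) ?Q = ?A * emeasure lebesgue ?Q"
    using v \<mu> by (simp add: emeasure_weight_measure avg_def ennreal_divide_times)
  then have M: "emeasure (weight_measure ?\<mu>) ?Q = ennreal (x * measure lebesgue ?Q)"
    using x v by (simp add: ennreal_mult)
  have "ennreal (x powr (1 / ?\<rho>) * (\<Prod>i\<in>{1..<m}. F i)) \<le> ennreal K"
    using le x F(3) Fp by (simp add: epow_ennreal ennreal_mult)
  then have "x powr (1 / ?\<rho>) * (\<Prod>i\<in>{1..<m}. F i) \<le> K" using K by simp
  then have "x powr (1 / ?\<rho>) \<le> K / (\<Prod>i\<in>{1..<m}. F i)" using Fp by (simp add: field_simps)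
  then have "(x powr (1 / ?\<rho>)) powr ?\<rho> \<le> (K / (\<Prod>i\<in>{1..<m}. F i)) powr ?\<rho>"
    using \<rho> by (intro powr_mono2) auto
  then have xle: "x \<le> (K / (\<Prod>i\<in>{1..<m}. F i)) powr ?\<rho>" using x \<rho> by (simp add: powr_powr)
  show thesis
  proof (rule that[OF F _ M])
    show "0 < x * measure lebesgue ?Q" using x v by simp
    show "x * measure lebesgue ?Q \<le> (K / (\<Prod>i\<in>{1..<m}. F i)) powr ?\<rho> * measure lebesgue ?Q"
      using xle by (rule mult_right_mono) simp
  qed
qed

text \<open>The upper bound for \<mu>(Q) from \<open>cube_data\<close> and the lower bound for
  \<mu>(E) from \<open>Hoelder_lower_bound\<close> contain the same product of factors, which
  cancels. Of the exponent \<open>q\<close>, 1 comes from the volume of E and \<rho> S from the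
  powers of \<eta>.\<close>

lemma A_infinity_mu_weight:
  fixes w :: "nat \<Rightarrow> real^'n \<Rightarrow> real"
  assumes m: "1 \<le> m" and w: "\<And>i. i \<in> {1..<m} \<Longrightarrow> weight (w i)"
    and r: "\<And>i. i \<in> {1..<m} \<Longrightarrow> 1 \<le> r i \<and> r i \<le> p i"
    and \<rho>: "0 < rho_exp m p r" and K: "0 < K"
    and le: "\<And>a l. 0 < l \<Longrightarrow> epow (avg lebesgue (cube a l) (\<lambda>x. ennreal (mu_weight m p r w x))) (1 / rho_exp m p r)
      * (\<Prod>i\<in>{1..<m}. AR_factor m p r w (cube a l) i) \<le> ennreal K"
  shows "\<exists>C q. A_infinity_weight (mu_weight m p r w) C q"
proof -
  let ?\<mu> = "mu_weight m p r w" and ?\<rho> = "rho_exp m p r"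
  define S where "S = (\<Sum>i\<in>{1..<m}. 1 / r i - 1 / p i)"
  define q where "q = 1 + ?\<rho> * S"
  \<comment> \<open>2 comes from keeping half of E, \<open>2 * real m\<close> from the denominator
    of \<eta>, and K from the class bound.\<close>
  define C where "C = 2 * K powr ?\<rho> * (2 * real m) powr (?\<rho> * S)"
  have "0 \<le> 1 / r i - 1 / p i" if "i \<in> {1..<m}" for i
    using r[OF that] by (simp add: frac_le)
  then have S: "0 \<le> S" unfolding S_def by (intro sum_nonneg)
  have q: "0 < q" using S \<rho> by (simp add: q_def add_pos_nonneg)
  have C: "0 < C" using K m by (simp add: C_def)
  have "A_infinity_weight ?\<mu> C q"
  proof
    show "weight ?\<mu>" using w by (rule weight_mu_weight)
    show "0 < C" "0 < q" by fact+
    fix a :: "real^'n" and l :: real assume l: "0 < l"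
    let ?Q = "cube a l"
    obtain F M where F: "\<And>i. 0 < F i" "\<And>i. i \<in> {1..<m} \<Longrightarrow> AR_factor m p r w ?Q i = ennreal (F i)"
      and M: "0 < M" "emeasure (weight_measure ?\<mu>) ?Q = ennreal M"
        "M \<le> (K / (\<Prod>i\<in>{1..<m}. F i)) powr ?\<rho> * measure lebesgue ?Q"
      using cube_data[OF w r \<rho> l K le[OF l]] by metis
    define P where "P = (\<Prod>i\<in>{1..<m}. F i)"
    have P: "0 < P" unfolding P_def using F(1) by (rule prod_pos)
    show "emeasure (weight_measure ?\<mu>) ?Q < \<infinity>" using M by simp
    have mM: "measure (weight_measure ?\<mu>) ?Q = M" using M by (intro measure_eq_emeasure_eq_ennreal) auto
    fix E assume E: "E \<in> sets lebesgue" "E \<subseteq> ?Q"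
    define e where "e = measure lebesgue E"
    define v where "v = measure lebesgue ?Q"
    have v: "0 < v" using l unfolding v_def by (rule measure_cube_pos)
    show "measure lebesgue E powr q * measure (weight_measure ?\<mu>) ?Q
        \<le> C * measure lebesgue ?Q powr q * measure (weight_measure ?\<mu>) E"
    proof (cases "e = 0")
      case True
      then show ?thesis using C by (simp add: e_def)
    next
      case False
      then have e: "0 < e" by (simp add: e_def zero_less_measure_iff)
      define \<eta> where "\<eta> = e / (2 * real m * v)"
      have \<eta>: "0 < \<eta>" using e v m by (simp add: \<eta>_def)
      have "(\<Prod>i\<in>{1..<m}. \<eta> powr (1 / r i - 1 / p i) / F i) = \<eta> powr S / P"
        using \<eta> by (simp add: prod_dividef powr_sum S_def P_def)
      then have "ennreal (e / 2 * (\<eta> powr S / P) powr ?\<rho>) \<le> emeasure (weight_measure ?\<mu>) E"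
        using Hoelder_lower_bound[OF m w r \<rho> l E e[unfolded e_def] F(1) eq_refl[OF F(2)] \<eta>_def[unfolded e_def v_def]]
        by (simp add: e_def)
      also have "emeasure (weight_measure ?\<mu>) E = ennreal (measure (weight_measure ?\<mu>) E)"
      proof -
        have "emeasure (weight_measure ?\<mu>) E \<le> emeasure (weight_measure ?\<mu>) ?Q"
          using E by (intro emeasure_mono) auto
        also have "\<dots> < \<infinity>" using M by simp
        finally show ?thesis by (intro emeasure_eq_ennreal_measure) auto
      qed
      finally have low: "e / 2 * (\<eta> powr S / P) powr ?\<rho> \<le> measure (weight_measure ?\<mu>) E" by simp
      have eq: "C * v powr q * (e / 2 * (\<eta> powr S / P) powr ?\<rho>) = e powr q * ((K / P) powr ?\<rho> * v)"
      proof -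
        have e1: "(\<eta> powr S / P) powr ?\<rho> = e powr (?\<rho> * S) / ((2 * real m) powr (?\<rho> * S) * v powr (?\<rho> * S)) / P powr ?\<rho>"
          unfolding \<eta>_def by (simp add: powr_divide powr_powr powr_mult mult.commute)
        have e2: "v powr q = v * v powr (?\<rho> * S)" "e powr q = e * e powr (?\<rho> * S)"
          using v e by (simp_all add: q_def powr_add)
        have e3: "(K / P) powr ?\<rho> = K powr ?\<rho> / P powr ?\<rho>" by (rule powr_divide)
        have "0 < (2 * real m) powr (?\<rho> * S)" "0 < v powr (?\<rho> * S)" "0 < P powr ?\<rho>"
          using m v P by auto
        then show ?thesis
          unfolding C_def e1 e2 e3 by (simp add: field_simps)
      qed
      have "e powr q * M \<le> e powr q * ((K / P) powr ?\<rho> * v)"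
        using M(3) by (intro mult_left_mono) (auto simp: P_def v_def)
      also have "\<dots> \<le> C * v powr q * measure (weight_measure ?\<mu>) E"
        unfolding eq[symmetric] using low C by (intro mult_left_mono) auto
      finally show ?thesis unfolding mM e_def v_def .
    qed
  qed
  then show ?thesis by blast
qed

section \<open>Proof of the two parts\<close>

text \<open>This is 1/\<rho> = 1/\<delta>_{m+1} + 1/\<delta>_m. It balances the powers of
  \<mu>(Q)/|Q| in part (b), and gives \<rho> = \<delta>_{m+1} when \<open>p m = r m\<close>.\<close>

lemma rho_exp_eq:
  assumes "1 \<le> m"
  shows "1 / rho_exp m p r = inv_delta m p r (m + 1) + (1 / r m - 1 / p m)"
  unfolding inv_delta_last(1)[OF assms] by (simp add: rho_exp_def)

lemma nn_integral_weight_measure: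
  assumes "weight \<mu>" "f \<in> borel_measurable lebesgue"
  shows "(\<integral>\<^sup>+x\<in>cube a l. f x \<partial>weight_measure \<mu>) = (\<integral>\<^sup>+x\<in>cube a l. ennreal (\<mu> x) * f x \<partial>lebesgue)"
proof -
  note [measurable] = weight_measurable[OF assms(1)] assms(2)
  show ?thesis
    unfolding weight_measure_def by (subst nn_integral_density) (auto simp: mult.assoc)
qed

lemma AR_factor_one_eq:
  assumes "r m = p m" "0 < l"
  shows "AR_factor m p r (w(m := (\<lambda>x. 1))) (cube a l) m = 1"
proof -
  have "emeasure (restrict_space lebesgue (cube a l)) (space (restrict_space lebesgue (cube a l))) \<noteq> 0"
    using assms(2) by (simp add: emeasure_restrict_space space_restrict_space emeasure_cube)
  from esssup_const[OF this, of "1::ennreal"] show ?thesis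
    using assms(1) by (simp add: AR_factor_def)
qed

text \<open>With last weight 1 and \<delta>_m infinite, the last factor is 1 and, as \<rho> =
  \<delta>_{m+1}, the averaged weight is \<mu> itself.\<close>

lemma AR_class_one_iff:
  fixes w :: "nat \<Rightarrow> real^'n \<Rightarrow> real"
  assumes m: "1 \<le> m" and p: "\<forall>i\<in>{1..m}. 0 < p i" and rm: "p m = r m"
    and w: "\<And>i. i \<in> {1..<m} \<Longrightarrow> weight (w i)"
  shows "w(m := (\<lambda>x. 1)) \<in> AR_class m p r \<longleftrightarrow>
    (\<exists>K>0. \<forall>a l. 0 < l \<longrightarrow> epow (avg lebesgue (cube a l) (\<lambda>x. ennreal (mu_weight m p r w x))) (1 / rho_exp m p r)
      * (\<Prod>i\<in>{1..<m}. AR_factor m p r w (cube a l) i) \<le> ennreal K)"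
proof -
  define D where "D = inv_delta m p r (m + 1)"
  have D: "1 / rho_exp m p r = D" using rho_exp_eq[OF m, of p r] rm by (simp add: D_def)
  then have D': "1 / D = rho_exp m p r" by auto
  have e1: "(\<Prod>i\<in>{1..<m}. (w(m := (\<lambda>x. 1))) i x powr (1 / p i)) powr (1 / D) * (w(m := (\<lambda>x. 1))) m x powr (1 / (D * p m))
      = mu_weight m p r w x" for x
    unfolding D' mu_weight_def by (auto intro!: arg_cong[where f = "\<lambda>y. y powr _"] prod.cong)
  have e2: "(\<Prod>i\<in>{1..<m}. AR_factor m p r (w(m := (\<lambda>x. 1))) Q i) = (\<Prod>i\<in>{1..<m}. AR_factor m p r w Q i)" for Q
    by (intro prod.cong refl AR_factor_cong) auto
  have e3: "\<forall>i\<in>{1..m}. weight ((w(m := (\<lambda>x. 1))) i)"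
    using w by (auto simp: weight_def)
  have e4: "AR_factor m p r (w(m := (\<lambda>x. 1))) (cube a l) m = 1" if "0 < l" for a l
    using rm that by (intro AR_factor_one_eq) simp
  have e5: "(0 < l \<longrightarrow> X * (Y * AR_factor m p r (w(m := (\<lambda>x. 1))) (cube a l) m) \<le> Z) \<longleftrightarrow> (0 < l \<longrightarrow> X * Y \<le> Z)"
    for X Y Z :: ennreal and a l
    using e4[of l a] by auto
  show ?thesis
    unfolding D using AR_class_iff[OF m p D_def, of "w(m := (\<lambda>x. 1))"]
    unfolding e1 e2
    by (simp only: e5) (rule iffI, erule conjunct2, rule conjI[OF e3])
qed

section \<open>Tools for part (b): weak norms from level sets, and positivity of the maximal
  function\<close>

lemma weak_norm_le:
  assumes s: "0 < s" and l: "0 < l" and f: "\<And>x. 0 \<le> f x" and c: "0 < c"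
    and le: "\<And>t. 0 < t \<Longrightarrow> emeasure lebesgue {x \<in> cube a l. t < f x}
      \<le> ennreal ((c / t) powr (1 / s) * measure lebesgue (cube a l))"
  shows "weak_norm (scale_measure (1 / emeasure lebesgue (cube a l)) lebesgue) (1 / s)
      (\<lambda>x. indicator (cube a l) x * f x) \<le> ennreal c"
  unfolding weak_norm_def
proof (rule SUP_least)
  fix t :: real assume "t \<in> {0<..}"
  then have t: "0 < t" by simp
  let ?Q = "cube a l"
  define B where "B = {x \<in> ?Q. t < f x}"
  have vQ: "emeasure lebesgue ?Q = ennreal (measure lebesgue ?Q)" "0 < measure lebesgue ?Q"
    using l by (auto intro: emeasure_subset_cube measure_cube_pos)
  have B_eq: "{x \<in> space (scale_measure (1 / emeasure lebesgue ?Q) lebesgue). t < \<bar>indicator ?Q x * f x\<bar>} = B"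
    using t f by (auto simp: B_def indicator_def space_scale_measure)
  have ss: "1 / (1 / s) = s" by simp
  have v1: "1 / ennreal (measure lebesgue ?Q) = ennreal (1 / measure lebesgue ?Q)"
    using vQ(2) by (metis divide_ennreal ennreal_1 zero_le_one)
  have "emeasure (scale_measure (1 / emeasure lebesgue ?Q) lebesgue) B
      \<le> ennreal (1 / measure lebesgue ?Q) * ennreal ((c / t) powr (1 / s) * measure lebesgue ?Q)"
    unfolding emeasure_scale_measure vQ(1) v1 B_def using le[OF t] by (rule mult_left_mono) simp
  also have "\<dots> = ennreal ((c / t) powr (1 / s))"
    using vQ(2) by (simp add: ennreal_mult[symmetric])
  finally have "epow (emeasure (scale_measure (1 / emeasure lebesgue ?Q) lebesgue) B) s
      \<le> epow (ennreal ((c / t) powr (1 / s))) s"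
    using s by (intro epow_mono) auto
  also have "\<dots> = ennreal (c / t)"
    using c t s by (simp add: epow_ennreal powr_powr)
  finally have "ennreal t * epow (emeasure (scale_measure (1 / emeasure lebesgue ?Q) lebesgue) B) s
      \<le> ennreal t * ennreal (c / t)"
    by (rule mult_left_mono) simp
  also have "\<dots> = ennreal c" using c t by (simp add: ennreal_mult[symmetric])
  finally show "ennreal t * epow (emeasure (scale_measure (1 / emeasure lebesgue ?Q) lebesgue)
      {x \<in> space (scale_measure (1 / emeasure lebesgue ?Q) lebesgue). t < \<bar>indicator ?Q x * f x\<bar>}) (1 / (1 / s)) \<le> ennreal c"
    unfolding B_eq ss .
qed

lemma bounded_subset_cube:
  fixes S :: "(real^'n) set"
  assumes "bounded S"
  obtains a l where "0 < l" "S \<subseteq> cube a l"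
proof -
  obtain B where B: "0 < B" "\<And>x. x \<in> S \<Longrightarrow> norm x \<le> B"
    using assms by (auto simp: bounded_pos)
  show thesis
  proof
    show "0 < 2 * B" using B by simp
    show "S \<subseteq> cube (\<chi> i. - B) (2 * B)"
    proof
      fix x assume "x \<in> S"
      then have "\<bar>x $ i\<bar> \<le> B" for i using B(2)[of x] component_le_norm_cart[of x i] by linarith
      then show "x \<in> cube (\<chi> i. - B) (2 * B)"
        unfolding mem_cube by (auto simp: abs_le_iff) (smt (verit))+
    qed
  qed
qed

lemma bounded_cube: "bounded (cube a l)"
  by (simp add: cube_def bounded_cbox)

context A_infinity_weight begin

text \<open>A cube with positive average and Q lie in a common cube. The average over it is still
  positive and bounds the maximal function from below at every point of Q.\<close>

lemma INF_maximal_pos: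
  assumes x: "0 < maximal \<mu> g x" and l: "0 < l"
  shows "0 < (INF y\<in>cube a l. maximal \<mu> g y)"
proof -
  obtain b h where bh: "0 < h" "0 < avg (weight_measure \<mu>) (cube b h) (\<lambda>y. ennreal \<bar>g y\<bar>)"
    using less_maximalD[OF x] by blast
  then have "0 < (\<integral>\<^sup>+y\<in>cube b h. ennreal \<bar>g y\<bar> \<partial>weight_measure \<mu>)"
    unfolding avg_def by (simp add: ennreal_zero_less_divide)
  moreover obtain c s where cs: "0 < s" "cube a l \<union> cube b h \<subseteq> cube c s"
    by (rule bounded_subset_cube[of "cube a l \<union> cube b h"]) (auto simp: bounded_cube)
  moreover have "(\<integral>\<^sup>+y\<in>cube b h. ennreal \<bar>g y\<bar> \<partial>weight_measure \<mu>) \<le> (\<integral>\<^sup>+y\<in>cube c s. ennreal \<bar>g y\<bar> \<partial>weight_measure \<mu>)"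
    using cs by (intro nn_set_integral_set_mono) auto
  ultimately have "0 < avg (weight_measure \<mu>) (cube c s) (\<lambda>y. ennreal \<bar>g y\<bar>)"
    using finite_cube[OF cs(1), of c] unfolding avg_def by (auto simp: ennreal_zero_less_divide)
  also have "\<dots> \<le> (INF y\<in>cube a l. maximal \<mu> g y)"
    using cs by (intro INF_greatest avg_le_maximal) auto
  finally show ?thesis .
qed

end

text \<open>The essential supremum in the last factor gives a lower bound for u = w_m^{\<rho>/r_m};
  inserting it into the first factor removes u and proves the first claim. For the second, the class
  bound controls the integral of \<mu> u from above, and \<open>Hoelder_lower_bound\<close> with E =
  Q controls \<mu>(Q) from below.\<close>

lemma A1_of_AR_class:
  fixes w :: "nat \<Rightarrow> real^'n \<Rightarrow> real"
  assumes m: "1 \<le> m" and w: "\<And>i. i \<in> {1..m} \<Longrightarrow> weight (w i)"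
    and r: "\<And>i. i \<in> {1..<m} \<Longrightarrow> 1 \<le> r i \<and> r i \<le> p i" and rm: "1 \<le> r m" "p m = r m"
    and D: "0 < inv_delta m p r (m + 1)" and wcls: "w \<in> AR_class m p r"
  shows "w(m := (\<lambda>x. 1)) \<in> AR_class m p r"
    and "(\<lambda>x. w m x powr (rho_exp m p r / r m)) \<in> A1 (mu_weight m p r w)"
proof -
  define D where "D = inv_delta m p r (m + 1)"
  define \<rho> where "\<rho> = rho_exp m p r"
  define \<mu> where "\<mu> = mu_weight m p r w"
  define u where "u x = w m x powr (\<rho> / r m)" for x
  have D0: "0 < D" using D by (simp add: D_def)
  have D\<rho>: "1 / \<rho> = D" using rho_exp_eq[OF m, of p r] rm by (simp add: D_def \<rho>_def)
  then have \<rho>D: "1 / D = \<rho>" by auto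
  have \<rho>0: "0 < \<rho>" using D0 by (simp add: \<rho>D[symmetric])
  have p: "\<forall>i\<in>{1..m}. 0 < p i"
  proof
    fix i assume "i \<in> {1..m}"
    then show "0 < p i" using r[of i] rm by (cases "i = m") auto
  qed
  have w': "weight (w i)" if "i \<in> {1..<m}" for i using w that by simp
  have wm: "weight (w m)" using w m by simp
  have \<mu>: "weight \<mu>" unfolding \<mu>_def using w' by (rule weight_mu_weight)
  have u: "weight u" unfolding u_def using wm by (rule weight_powr)
  note [measurable] = weight_measurable[OF \<mu>] weight_measurable[OF u]
  have \<mu>u: "weight (\<lambda>x. \<mu> x * u x)"
    using weight_AE_pos[OF \<mu>] weight_AE_pos[OF u] by (auto simp: weight_def)
  have integrand: "(\<Prod>i\<in>{1..<m}. w i x powr (1 / p i)) powr (1 / D) * w m x powr (1 / (D * p m)) = \<mu> x * u x" for x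
  proof -
    have "1 / (D * p m) = \<rho> / r m" using rm by (simp add: \<rho>D[symmetric])
    then show ?thesis by (simp add: \<mu>_def mu_weight_def u_def \<rho>D \<rho>_def)
  qed
  define P where "P Q = (\<Prod>i\<in>{1..<m}. AR_factor m p r w Q i)" for Q
  from iffD1[OF AR_class_iff[OF m p D_def, of w] wcls, THEN conjunct2, unfolded integrand, folded P_def]
  obtain K where K: "0 < K" and K': "\<forall>a l. 0 < l \<longrightarrow>
      epow (avg lebesgue (cube a l) (\<lambda>x. ennreal (\<mu> x * u x))) D
      * (P (cube a l) * AR_factor m p r w (cube a l) m) \<le> ennreal K"
    by (elim exE conjE)
  note KQ = K'[rule_format]

  \<comment> \<open>\<phi> is the last factor. Replacing u by its lower bound \<phi>^{-\<rho>} costs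
    a factor \<phi>^\<rho> inside the average, hence exactly \<phi> after the power
    1/\<rho>.\<close>
  have loc: "\<exists>\<phi>>0. AR_factor m p r w (cube a l) m = ennreal \<phi> \<and>
      (AE x in lebesgue. x \<in> cube a l \<longrightarrow> \<phi> powr (- \<rho>) \<le> u x) \<and>
      epow (avg lebesgue (cube a l) (\<lambda>x. ennreal (\<mu> x))) D * P (cube a l) \<le> ennreal K"
    if l: "0 < l" for a l
  proof -
    let ?Q = "cube a l"
    let ?A = "avg lebesgue ?Q (\<lambda>x. ennreal (\<mu> x * u x))" and ?F = "AR_factor m p r w ?Q m"
    have "0 < epow ?A D" using avg_lebesgue_pos[OF \<mu>u l] D0 by (rule epow_pos)
    moreover have fac: "AR_factor m p r w ?Q i \<noteq> 0" if i: "i \<in> {1..m}" for i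
    proof -
      have "r i \<le> p i" "1 \<le> r i" using r[of i] rm i by (cases "i = m"; simp)+
      then have "0 < AR_factor m p r w ?Q i"
        using w[OF i] l i by (intro AR_factor_pos[where m = m and r = r and p = p and w = w and i = i]) auto
      then show ?thesis by simp
    qed
    then have "P ?Q \<noteq> 0" by (auto simp: P_def prod_zero_iff)
    moreover have Fm: "?F \<noteq> 0" using fac[of m] m by simp
    moreover have "epow ?A D * (P ?Q * ?F) < \<infinity>" using KQ[OF l] by (rule le_less_trans) simp
    ultimately have "?F < \<infinity>"
      unfolding infinity_ennreal_def ennreal_mult_less_top by auto
    then obtain \<phi> where \<phi>: "?F = ennreal \<phi>" "0 < \<phi>" using Fm by (cases ?F) auto
    have "?F = esssup (restrict_space lebesgue ?Q) (\<lambda>x. ennreal (w m x powr (- 1 / p m)))"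
      using rm by (simp add: AR_factor_def)
    then have "AE x in restrict_space lebesgue ?Q. ennreal (w m x powr (- 1 / p m)) \<le> ennreal \<phi>"
      using esssup_AE[of "\<lambda>x. ennreal (w m x powr (- 1 / p m))" "restrict_space lebesgue ?Q"] \<phi>(1) by simp
    then have AE1: "AE x in lebesgue. x \<in> ?Q \<longrightarrow> \<phi> powr (- \<rho>) \<le> u x"
      using weight_AE_pos[OF wm] unfolding AE_restrict_cube_iff
    proof eventually_elim
      case (elim x)
      show ?case
      proof
        assume "x \<in> ?Q"
        with elim have "w m x powr (- 1 / p m) \<le> \<phi>"
          using \<phi>(2) by (simp add: ennreal_le_iff less_imp_le)
        then have "\<phi> powr (- \<rho>) \<le> (w m x powr (- 1 / p m)) powr (- \<rho>)"
          using elim \<rho>0 by (intro powr_mono2') auto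
        also have "\<dots> = u x" using rm by (simp add: u_def powr_powr)
        finally show "\<phi> powr (- \<rho>) \<le> u x" .
      qed
    qed
    have "(\<integral>\<^sup>+x\<in>?Q. ennreal (\<mu> x) \<partial>lebesgue) \<le> (\<integral>\<^sup>+x. ennreal (\<phi> powr \<rho>) * (ennreal (\<mu> x * u x) * indicator ?Q x) \<partial>lebesgue)"
    proof (rule nn_integral_mono_AE)
      show "AE x in lebesgue. ennreal (\<mu> x) * indicator ?Q x \<le> ennreal (\<phi> powr \<rho>) * (ennreal (\<mu> x * u x) * indicator ?Q x)"
        using AE1 weight_AE_pos[OF \<mu>]
      proof eventually_elim
        case (elim x)
        show ?case
        proof (cases "x \<in> ?Q")
          case True
          then have "\<phi> powr \<rho> * \<phi> powr (- \<rho>) \<le> \<phi> powr \<rho> * u x"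
            using elim by (intro mult_left_mono) auto
          moreover have "\<phi> powr \<rho> * \<phi> powr (- \<rho>) = 1" using \<phi>(2) by (simp add: powr_add[symmetric])
          ultimately have "1 * \<mu> x \<le> (\<phi> powr \<rho> * u x) * \<mu> x" using elim by (intro mult_right_mono) auto
          then show ?thesis using True by (simp add: ennreal_mult'[symmetric] mult_ac ennreal_leI)
        qed simp
      qed
    qed
    also have "\<dots> = ennreal (\<phi> powr \<rho>) * (\<integral>\<^sup>+x\<in>?Q. ennreal (\<mu> x * u x) \<partial>lebesgue)"
      by (rule nn_integral_cmult) measurable
    finally have "avg lebesgue ?Q (\<lambda>x. ennreal (\<mu> x)) \<le> ennreal (\<phi> powr \<rho>) * ?A"
      unfolding avg_def by (simp add: ennreal_times_divide divide_right_mono_ennreal)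
    then have "epow (avg lebesgue ?Q (\<lambda>x. ennreal (\<mu> x))) D \<le> epow (ennreal (\<phi> powr \<rho>) * ?A) D"
      using D0 by (intro epow_mono) auto
    also have "\<dots> = ennreal \<phi> * epow ?A D"
      using \<phi> D0 by (subst epow_mult_ennreal) (auto simp: powr_powr \<rho>D[symmetric])
    finally have "epow (avg lebesgue ?Q (\<lambda>x. ennreal (\<mu> x))) D * P ?Q \<le> ennreal \<phi> * epow ?A D * P ?Q"
      by (rule mult_right_mono) simp
    also have "\<dots> = epow ?A D * (P ?Q * ?F)" unfolding \<phi>(1) by (simp only: mult_ac)
    also have "\<dots> \<le> ennreal K" by (rule KQ[OF l])
    finally show ?thesis using \<phi> AE1 by blast
  qed
  then have class1: "epow (avg lebesgue (cube a l) (\<lambda>x. ennreal (mu_weight m p r w x))) (1 / rho_exp m p r)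
      * (\<Prod>i\<in>{1..<m}. AR_factor m p r w (cube a l) i) \<le> ennreal K" if "0 < l" for a l
    using that D\<rho> unfolding \<mu>_def P_def \<rho>_def by auto
  then show "w(m := (\<lambda>x. 1)) \<in> AR_class m p r"
    using AR_class_one_iff[of m p r w, OF m p rm(2) w'] K by blast

  \<comment> \<open>The powers of \<eta> in \<open>Hoelder_lower_bound\<close> for E = Q, where
    \<eta> = 1/(2m).\<close>
  define c where "c = (\<Prod>i\<in>{1..<m}. (1 / (2 * real m)) powr (1 / r i - 1 / p i))"
  have c: "0 < c" unfolding c_def using m by (intro prod_pos) auto
  have "u \<in> A1 \<mu>"
    unfolding A1_def mem_Collect_eq SUP_cubes_less_top_iff
  proof (intro conjI exI[of _ "2 * K powr \<rho> / c powr \<rho>"] allI impI)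
    show "weight u" by fact
    show "0 < 2 * K powr \<rho> / c powr \<rho>" using K c by simp
    fix a :: "real^'n" and l :: real assume l: "0 < l"
    let ?Q = "cube a l"
    let ?A = "avg lebesgue ?Q (\<lambda>x. ennreal (\<mu> x * u x))"
    define v where "v = measure lebesgue ?Q"
    have v: "0 < v" "emeasure lebesgue ?Q = ennreal v"
      using l by (auto simp: v_def intro: measure_cube_pos emeasure_subset_cube)
    obtain F M where F: "\<And>i. 0 < F i" "\<And>i. i \<in> {1..<m} \<Longrightarrow> AR_factor m p r w ?Q i = ennreal (F i)"
      "P ?Q = ennreal (\<Prod>i\<in>{1..<m}. F i)"
      and M: "0 < M" "emeasure (weight_measure \<mu>) ?Q = ennreal M"
      using cube_data[OF w' r \<rho>0[unfolded \<rho>_def] l K class1[OF l]] unfolding P_def \<mu>_def by metis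
    define PF where "PF = (\<Prod>i\<in>{1..<m}. F i)"
    have PF: "0 < PF" unfolding PF_def using F(1) by (rule prod_pos)
    obtain \<phi> where \<phi>: "0 < \<phi>" "AR_factor m p r w ?Q m = ennreal \<phi>"
      "AE x in lebesgue. x \<in> ?Q \<longrightarrow> \<phi> powr (- \<rho>) \<le> u x"
      using loc[OF l, of a] by blast
    have \<eta>: "1 / (2 * real m) = measure lebesgue ?Q / (2 * real m * measure lebesgue ?Q)"
      using v by (simp add: v_def)
    have "ennreal (v / 2 * (c / PF) powr \<rho>) \<le> ennreal M"
      using Hoelder_lower_bound[OF m w' r \<rho>0[unfolded \<rho>_def] l _ order_refl v(1)[unfolded v_def] F(1) eq_refl[OF F(2)] \<eta>]
      unfolding M(2)[unfolded \<mu>_def] by (simp add: v_def c_def PF_def prod_dividef \<rho>_def)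
    then have Mlow: "v / 2 * (c / PF) powr \<rho> \<le> M" using M(1) by simp
    have "ennreal (PF * \<phi>) = P ?Q * AR_factor m p r w ?Q m"
      using F(3) \<phi> PF by (simp add: PF_def ennreal_mult)
    with KQ[OF l, of a] have le: "epow ?A D * ennreal (PF * \<phi>) \<le> ennreal K" by simp
    have PF\<phi>: "0 < PF * \<phi>" using PF \<phi> by simp
    have "?A \<noteq> \<infinity>"
    proof
      assume "?A = \<infinity>"
      then have "epow ?A D = top" using D0 by (simp add: epow_def)
      with le PF \<phi>(1) show False by (simp add: ennreal_top_mult top_unique)
    qed
    then obtain x where x: "?A = ennreal x" "0 < x"
      using avg_lebesgue_pos[OF \<mu>u l, of a] by (cases ?A) auto
    have "ennreal (x powr D * (PF * \<phi>)) \<le> ennreal K"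
      using le x PF\<phi> by (simp add: epow_ennreal ennreal_mult)
    then have "x powr D * (PF * \<phi>) \<le> K" using K by simp
    then have "x powr D \<le> K / (PF * \<phi>)" using PF\<phi> by (simp add: field_simps)
    then have "(x powr D) powr \<rho> \<le> (K / (PF * \<phi>)) powr \<rho>"
      using \<rho>0 by (intro powr_mono2) auto
    then have xle: "x \<le> (K / (PF * \<phi>)) powr \<rho>"
      using x D0 by (simp add: powr_powr \<rho>D[symmetric])
    have "(\<integral>\<^sup>+y\<in>?Q. ennreal (u y) \<partial>weight_measure \<mu>) = (\<integral>\<^sup>+y\<in>?Q. ennreal (\<mu> y) * ennreal (u y) \<partial>lebesgue)"
      using \<mu> by (rule nn_integral_weight_measure) measurable
    also have "\<dots> = (\<integral>\<^sup>+y\<in>?Q. ennreal (\<mu> y * u y) \<partial>lebesgue)"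
      by (simp add: ennreal_mult'' u_def)
    also have "\<dots> = ?A * ennreal v"
      using v by (simp add: avg_def ennreal_divide_times)
    also have "\<dots> = ennreal (x * v)"
      unfolding x(1) using x(2) v by (intro ennreal_mult[symmetric]) auto
    finally have intu: "(\<integral>\<^sup>+y\<in>?Q. ennreal (u y) \<partial>weight_measure \<mu>) = ennreal (x * v)" .
    have "avg (weight_measure \<mu>) ?Q (\<lambda>y. ennreal (u y)) = ennreal (x * v / M)"
      unfolding avg_def intu M(2) using x(2) v M(1) by (intro divide_ennreal) auto
    also have "\<dots> \<le> ennreal (2 * K powr \<rho> / c powr \<rho> * \<phi> powr (- \<rho>))"
    proof (rule ennreal_leI)
      have "x * v \<le> (K / (PF * \<phi>)) powr \<rho> * v" using xle v by simp
      \<comment> \<open>The product \<open>PF\<close> of the first factors is common to the upper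
        bound for the integral and the lower bound for \<mu>(Q), so it drops out of the
        quotient.\<close>
      also have "\<dots> = 2 * K powr \<rho> / c powr \<rho> * \<phi> powr (- \<rho>) * (v / 2 * (c / PF) powr \<rho>)"
        using c by (simp add: powr_divide powr_mult powr_minus_divide field_simps)
      also have "\<dots> \<le> 2 * K powr \<rho> / c powr \<rho> * \<phi> powr (- \<rho>) * M"
        using Mlow by (intro mult_left_mono) auto
      finally show "x * v / M \<le> 2 * K powr \<rho> / c powr \<rho> * \<phi> powr (- \<rho>)"
        using M by (simp add: field_simps)
    qed
    also have "\<dots> = ennreal (2 * K powr \<rho> / c powr \<rho>) * ennreal (\<phi> powr (- \<rho>))"
      by (intro ennreal_mult) auto
    also have "\<dots> \<le> ennreal (2 * K powr \<rho> / c powr \<rho>) * essinf (restrict_space lebesgue ?Q) (\<lambda>y. ennreal (u y))"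
    proof (intro mult_left_mono essinf_greatest)
      show "AE y in restrict_space lebesgue ?Q. ennreal (\<phi> powr (- \<rho>)) \<le> ennreal (u y)"
        unfolding AE_restrict_cube_iff using \<phi>(3) by eventually_elim (auto intro: ennreal_leI)
    qed simp
    finally have "avg (weight_measure \<mu>) ?Q (\<lambda>y. ennreal (u y))
      \<le> ennreal (2 * K powr \<rho> / c powr \<rho>) * essinf (restrict_space lebesgue ?Q) (\<lambda>y. ennreal (u y))" .
    \<comment> \<open>Dividing by the essential infimum requires it to be nonzero.\<close>
    moreover have "ennreal (\<phi> powr (- \<rho>)) \<le> essinf (restrict_space lebesgue ?Q) (\<lambda>y. ennreal (u y))"
      unfolding AE_restrict_cube_iff[symmetric]
      by (rule essinf_greatest, unfold AE_restrict_cube_iff, use \<phi>(3) in eventually_elim) (auto intro: ennreal_leI)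
    then have "0 < essinf (restrict_space lebesgue ?Q) (\<lambda>y. ennreal (u y))"
      by (rule less_le_trans[rotated]) (use \<phi>(1) in simp)
    ultimately show "avg (weight_measure \<mu>) ?Q (\<lambda>y. ennreal (u y)) / essinf (restrict_space lebesgue ?Q) (\<lambda>y. ennreal (u y))
        \<le> ennreal (2 * K powr \<rho> / c powr \<rho>)"
      by (intro divide_le_posI_ennreal) (auto simp: mult.commute)
  qed
  then show "(\<lambda>x. w m x powr (rho_exp m p r / r m)) \<in> A1 (mu_weight m p r w)"
    unfolding u_def \<mu>_def \<rho>_def .
qed

text \<open>\<open>j\<close> is the essential infimum as a positive real. It is not 0, because a
  positive average divided by 0 is \<infinity>, and not \<infinity>, because the cube has positive
  measure.\<close>

lemma A1_cube:
  assumes \<mu>: "A_infinity_weight \<mu> C q" and K: "0 < K"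
    and le: "\<And>a l. 0 < l \<Longrightarrow> avg (weight_measure \<mu>) (cube a l) (\<lambda>y. ennreal (u y))
      / essinf (restrict_space lebesgue (cube a l)) (\<lambda>y. ennreal (u y)) \<le> ennreal K"
    and u: "weight u" and l: "0 < l"
  obtains j where "0 < j" "AE x in lebesgue. x \<in> cube a l \<longrightarrow> j \<le> u x"
    "(\<integral>\<^sup>+x\<in>cube a l. ennreal (\<mu> x) * ennreal (u x) \<partial>lebesgue)
      \<le> ennreal (K * j * measure (weight_measure \<mu>) (cube a l))"
proof -
  interpret A_infinity_weight \<mu> C q by fact
  let ?Q = "cube a l"
  let ?j = "essinf (restrict_space lebesgue ?Q) (\<lambda>y. ennreal (u y))"
  let ?A = "avg (weight_measure \<mu>) ?Q (\<lambda>y. ennreal (u y))"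
  note [measurable] = weight_measurable[OF u]
  have AE: "AE x in lebesgue. x \<in> ?Q \<longrightarrow> ?j \<le> ennreal (u x)"
    using essinf_AE[of "restrict_space lebesgue ?Q" "\<lambda>y. ennreal (u y)"] unfolding AE_restrict_cube_iff .
  have \<mu>u: "weight (\<lambda>x. \<mu> x * u x)"
    using AE_pos weight_AE_pos[OF u] by (auto simp: weight_def)
  have int: "(\<integral>\<^sup>+x\<in>?Q. ennreal (u x) \<partial>weight_measure \<mu>) = (\<integral>\<^sup>+x\<in>?Q. ennreal (\<mu> x) * ennreal (u x) \<partial>lebesgue)"
    using weight by (rule nn_integral_weight_measure) measurable
  also have "\<dots> = (\<integral>\<^sup>+x\<in>?Q. ennreal (\<mu> x * u x) \<partial>lebesgue)"
    using AE_pos by (intro nn_integral_cong_AE) (auto elim!: eventually_mono simp: ennreal_mult')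
  also have "0 < \<dots>" using \<mu>u l by (rule nn_integral_cube_pos)
  finally have "0 < ?A"
    unfolding avg_def using finite_cube[OF l, of a] by (simp add: ennreal_zero_less_divide)
  have le': "?A / ?j \<le> ennreal K" by (rule le[OF l])
  have "?j \<noteq> 0"
  proof
    assume "?j = 0"
    with le' \<open>0 < ?A\<close> show False by (auto simp: top_unique split: if_splits)
  qed
  moreover have "?j \<noteq> \<infinity>"
  proof
    assume "?j = \<infinity>"
    with AE have "AE x in lebesgue. x \<notin> ?Q" by (auto elim!: eventually_mono simp: top_unique)
    with l show False by (rule cube_not_AE_empty)
  qed
  ultimately obtain j where j: "?j = ennreal j" "0 < j" by (cases ?j) auto
  have "?A \<le> ennreal K * ennreal j"
    using le' j by (simp add: divide_le_ennreal_iff)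
  also have "\<dots> = ennreal (K * j)" using K j by (simp add: ennreal_mult)
  finally have "(\<integral>\<^sup>+x\<in>?Q. ennreal (u x) \<partial>weight_measure \<mu>) \<le> ennreal (K * j * m ?Q)"
    by (rule iffD1[OF avg_weight_measure_le_iff[OF l]])
  moreover have "AE x in lebesgue. x \<in> ?Q \<longrightarrow> j \<le> u x"
    using AE weight_AE_pos[OF u]
    unfolding j(1) by eventually_elim (auto simp: ennreal_le_iff)
  ultimately show thesis using that j(2) int by simp
qed

text \<open>Write D = 1/\<delta>_{m+1}, s = 1/\<delta>_m, and U for the given power of W. The first
  factor averages \<mu> U, and the function in the last one is U^{-D} \<mu>^s. As U = u (M_\<mu>
  g)^{-s/D}, the latter is u^{-D} (\<mu> M_\<mu> g)^s, so its level sets are controlled by those of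
  \<mu> M_\<mu> g and by a lower bound for u.\<close>

lemma AR_class_of_A_hat:
  fixes w :: "nat \<Rightarrow> real^'n \<Rightarrow> real"
  assumes m: "1 \<le> m" and w: "\<And>i. i \<in> {1..m} \<Longrightarrow> weight (w i)"
    and r: "\<And>i. i \<in> {1..m} \<Longrightarrow> 1 \<le> r i \<and> r i \<le> p i"
    and D: "0 < inv_delta m p r (m + 1)"
    and one: "w(m := (\<lambda>x. 1)) \<in> AR_class m (p(m := r m)) r"
    and W: "weight W"
    and hat: "(\<lambda>x. W x powr ((1 / inv_delta m p r (m + 1)) / r m))
      \<in> A_hat (1 + (1 / inv_delta m p r (m + 1)) * inv_delta m p r m) (mu_weight m p r w)"
    and wm: "AE x in lebesgue.
      w m x = W x powr (p m / r m) * mu_weight m p r w x powr (- (p m * inv_delta m p r m))"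
  shows "w \<in> AR_class m p r"
proof -
  define D where "D = inv_delta m p r (m + 1)"
  define s where "s = 1 / r m - 1 / p m"
  define \<rho> where "\<rho> = rho_exp m p r"
  define \<mu> where "\<mu> = mu_weight m p r w"
  let ?m = "measure (weight_measure \<mu>)" and ?vol = "measure lebesgue :: (real^'n) set \<Rightarrow> real"
  define U where "U x = W x powr ((1 / D) / r m)" for x
  have s_eq: "inv_delta m p r m = s" by (simp add: s_def inv_delta_def inv_p_def)
  have D0: "0 < D" using D by (simp add: D_def)
  have rm: "1 \<le> r m" "r m \<le> p m" using r m by auto
  then have s0: "0 \<le> s" by (simp add: s_def frac_le)
  have \<rho>: "1 / \<rho> = D + s" using rho_exp_eq[OF m, of p r] by (simp add: D_def \<rho>_def s_def)
  then have \<rho>0: "0 < \<rho>" using D0 s0 by (metis add_pos_nonneg zero_less_divide_1_iff)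
  have p: "\<forall>i\<in>{1..m}. 0 < p i" using r by fastforce
  have w': "weight (w i)" if "i \<in> {1..<m}" for i using w that by simp
  have r': "1 \<le> r i \<and> r i \<le> p i" if "i \<in> {1..<m}" for i using r that by simp
  have wwm: "weight (w m)" using w m by simp
  define P where "P Q = (\<Prod>i\<in>{1..<m}. AR_factor m p r w Q i)" for Q

  \<comment> \<open>\<mu>, \<rho> and the first m - 1 factors do not involve \<open>p m\<close>, so
    the hypothesis about the exponents with \<open>r m\<close> in place of \<open>p m\<close> speaks
    of the same objects.\<close>
  have \<mu>': "mu_weight m (p(m := r m)) r w x = mu_weight m p r w x" for x
    by (simp add: mu_weight_def rho_exp_def)
  have \<rho>': "rho_exp m (p(m := r m)) r = rho_exp m p r" by (simp add: rho_exp_def)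
  have P': "(\<Prod>i\<in>{1..<m}. AR_factor m (p(m := r m)) r w Q i) = P Q" for Q
    unfolding P_def by (intro prod.cong refl AR_factor_cong) auto
  have p': "\<forall>i\<in>{1..m}. 0 < (p(m := r m)) i" using p rm by simp
  have "w(m := (\<lambda>x. 1)) \<in> AR_class m (p(m := r m)) r \<longleftrightarrow>
    (\<exists>K>0. \<forall>a l. 0 < l \<longrightarrow> epow (avg lebesgue (cube a l) (\<lambda>x. ennreal (\<mu> x))) (1 / \<rho>) * P (cube a l) \<le> ennreal K)"
    using AR_class_one_iff[of m "p(m := r m)" r w, OF m p' _ w'] unfolding \<mu>' \<rho>' P' \<mu>_def \<rho>_def by simp
  with one obtain K where K: "0 < K" and KQ: "\<And>a l. 0 < l \<Longrightarrow>
      epow (avg lebesgue (cube a l) (\<lambda>x. ennreal (\<mu> x))) (1 / \<rho>) * P (cube a l) \<le> ennreal K"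
    by blast
  obtain C q where Cq: "A_infinity_weight \<mu> C q"
    using A_infinity_mu_weight[OF m w' r' \<rho>0[unfolded \<rho>_def] K KQ[unfolded P_def \<mu>_def \<rho>_def]]
    unfolding \<mu>_def by blast
  interpret A_infinity_weight \<mu> C q by (rule Cq)
  obtain Cs where Cs: "0 < Cs" and mixed: "\<And>g t A a l S. \<lbrakk>g \<in> borel_measurable lebesgue; 0 < l; 0 < t; 0 < A;
      \<And>b h. \<lbrakk>0 < h; cube a l \<subseteq> cube b h\<rbrakk> \<Longrightarrow>
        avg (weight_measure \<mu>) (cube b h) (\<lambda>y. ennreal \<bar>g y\<bar>) \<le> ennreal A;
      \<And>x. x \<in> S \<Longrightarrow> x \<in> cube a l; \<And>x. x \<in> S \<Longrightarrow> maximal \<mu> g x < \<infinity>;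
      \<And>x. x \<in> S \<Longrightarrow> ennreal t < ennreal (\<mu> x) * maximal \<mu> g x\<rbrakk> \<Longrightarrow>
      \<exists>T\<in>sets lebesgue. S \<subseteq> T \<and> emeasure lebesgue T \<le> ennreal (Cs * A / t * ?m (cube a l))"
    by (rule mixed_weak_type_maximal) blast

  obtain u g where u: "u \<in> A1 \<mu>" and g: "g \<in> borel_measurable lebesgue"
    and gfin: "AE x in lebesgue. maximal \<mu> g x < \<infinity>"
    and Uu: "AE x in lebesgue. ennreal (U x) = ennreal (u x) * epow (maximal \<mu> g x) (- (s / D))"
    using hat unfolding A_hat_def D_def[symmetric] s_eq U_def \<mu>_def by auto
  have uw: "weight u" using u by (simp add: A1_def)
  obtain K1 where K1: "0 < K1" and K1Q: "\<And>a l. 0 < l \<Longrightarrow> avg (weight_measure \<mu>) (cube a l) (\<lambda>y. ennreal (u y))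
      / essinf (restrict_space lebesgue (cube a l)) (\<lambda>y. ennreal (u y)) \<le> ennreal K1"
    using u unfolding A1_def mem_Collect_eq SUP_cubes_less_top_iff by blast
  have Uw: "weight U" unfolding U_def using W by (rule weight_powr)
  define v where "v x = (\<Prod>i\<in>{1..<m}. w i x powr (1 / p i)) powr (1 / D) * w m x powr (1 / (D * p m))" for x
  have \<mu>_powr: "\<mu> x powr b = (\<Prod>i\<in>{1..<m}. w i x powr (1 / p i)) powr (\<rho> * b)" for x b
    by (simp add: \<mu>_def mu_weight_def \<rho>_def powr_powr)
  \<comment> \<open>The power of \<mu> in the formula for \<open>w m\<close> is chosen so that
    \<mu>^{1 + s/D} from the first weights and \<mu>^{-s/D} from the last one leave \<mu> U; here
    \<rho> (1 + s/D) = 1/D.\<close>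
  have facts: "AE x in lebesgue. 0 < \<mu> x \<and> 0 < W x \<and> 0 < u x \<and> maximal \<mu> g x < \<infinity>
     \<and> ennreal (U x) = ennreal (u x) * epow (maximal \<mu> g x) (- (s / D))
     \<and> v x = \<mu> x * U x \<and> w m x powr (- 1 / p m) = U x powr (- D) * \<mu> x powr s"
    using AE_pos weight_AE_pos[OF W] weight_AE_pos[OF uw] gfin Uu wm
  proof eventually_elim
    case (elim x)
    have wmx: "w m x = W x powr (p m / r m) * \<mu> x powr (- (p m * s))"
      using elim unfolding s_eq \<mu>_def by simp
    have pm: "0 < p m" "0 < r m" using rm by auto
    have "w m x powr (1 / (D * p m)) = U x * \<mu> x powr (- (s / D))"
      unfolding wmx powr_mult powr_powr U_def using pm D0 by (simp add: field_simps)
    moreover have "(\<Prod>i\<in>{1..<m}. w i x powr (1 / p i)) powr (1 / D) = \<mu> x powr (1 + s / D)"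
    proof -
      have "\<rho> * (D + s) = 1" using \<rho> \<rho>0 by (simp add: field_simps)
      then have "\<rho> * (1 + s / D) = 1 / D" using D0 by (simp add: field_simps)
      then show ?thesis unfolding \<mu>_powr by simp
    qed
    moreover have "\<mu> x powr (1 + s / D) * \<mu> x powr (- (s / D)) = \<mu> x"
      using elim by (simp add: powr_add[symmetric])
    ultimately have "v x = \<mu> x * U x" unfolding v_def by (simp add: mult_ac)
    moreover have "w m x powr (- 1 / p m) = U x powr (- D) * \<mu> x powr s"
      unfolding wmx powr_mult powr_powr U_def using pm D0 by simp
    ultimately show ?case using elim by simp
  qed

  have claim: "\<exists>j>0. \<exists>A>0.
      (\<integral>\<^sup>+x\<in>cube a l. ennreal (v x) \<partial>lebesgue) \<le> ennreal (A powr (- (s / D)) * (K1 * j * ?m (cube a l))) \<and>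
      AR_factor m p r w (cube a l) m \<le> ennreal ((Cs * A * (?m (cube a l) / ?vol (cube a l))) powr s * j powr (- D))"
    if l: "0 < l" for a l
  proof -
    let ?Q = "cube a l"
    obtain j where j: "0 < j" and jAE: "AE x in lebesgue. x \<in> ?Q \<longrightarrow> j \<le> u x"
      and jint: "(\<integral>\<^sup>+x\<in>?Q. ennreal (\<mu> x) * ennreal (u x) \<partial>lebesgue) \<le> ennreal (K1 * j * ?m ?Q)"
      using A1_cube[OF Cq K1 K1Q uw l] by blast
    have mQ: "0 < ?m ?Q" and vQ: "0 < ?vol ?Q" using l by (auto intro: m_cube_pos measure_cube_pos)
    show ?thesis
    proof (cases "s = 0")
      \<comment> \<open>Here \<delta>_m is infinite and \<open>epow _ 0 = 1\<close> removes the
        maximal function. \<open>A\<close> occurs only with exponent 0, so 1 serves as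
        witness.\<close>
      case True
      then have pr: "r m = p m" using rm by (simp add: s_def)
      have UuAE: "AE x in lebesgue. x \<in> ?Q \<longrightarrow> v x = \<mu> x * u x \<and> w m x powr (- 1 / p m) \<le> j powr (- D)"
        using facts jAE
      proof eventually_elim
        case (elim x)
        have "ennreal (U x) = ennreal (u x)" using elim True by (simp add: epow_def)
        moreover have "0 \<le> U x" "0 \<le> u x" using elim by (simp_all add: U_def)
        ultimately have "U x = u x" by (simp only: ennreal_inj)
        moreover have "w m x powr (- 1 / p m) = U x powr (- D)" using elim True by simp
        moreover have "u x powr (- D) \<le> j powr (- D)" if "x \<in> ?Q"
          using elim that j D0 by (intro powr_mono2') auto
        ultimately show ?case using elim by simp
      qed
      have "(\<integral>\<^sup>+x\<in>?Q. ennreal (v x) \<partial>lebesgue) = (\<integral>\<^sup>+x\<in>?Q. ennreal (\<mu> x) * ennreal (u x) \<partial>lebesgue)"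
      proof (rule nn_integral_cong_AE)
        show "AE x in lebesgue. ennreal (v x) * indicator ?Q x = ennreal (\<mu> x) * ennreal (u x) * indicator ?Q x"
          using UuAE facts by eventually_elim (auto simp: indicator_def ennreal_mult')
      qed
      with jint have "(\<integral>\<^sup>+x\<in>?Q. ennreal (v x) \<partial>lebesgue) \<le> ennreal (1 powr (- (s / D)) * (K1 * j * ?m ?Q))"
        by simp
      moreover have "AR_factor m p r w ?Q m \<le> ennreal (j powr (- D))"
        unfolding AR_factor_def if_P[OF pr]
      proof (rule esssup_I)
        have "(\<lambda>x. ennreal (w m x powr (- 1 / p m))) \<in> borel_measurable lebesgue"
          using weight_measurable[OF wwm] by measurable
        then show "(\<lambda>x. ennreal (w m x powr (- 1 / p m))) \<in> borel_measurable (restrict_space lebesgue ?Q)"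
          by (rule measurable_restrict_space1)
        show "AE x in restrict_space lebesgue ?Q. ennreal (w m x powr (- 1 / p m)) \<le> ennreal (j powr (- D))"
          unfolding AE_restrict_cube_iff using UuAE by eventually_elim (auto intro: ennreal_leI)
      qed
      then have "AR_factor m p r w ?Q m \<le> ennreal ((Cs * 1 * (?m ?Q / ?vol ?Q)) powr s * j powr (- D))"
        using True Cs mQ vQ by simp
      ultimately show ?thesis using j zero_less_one by blast
    next
      case False
      then have s: "0 < s" using s0 by simp
      have pr: "r m \<noteq> p m" using False by (auto simp: s_def)
      \<comment> \<open>Its positivity allows the negative power in the first factor; finiteness of
        M_\<mu> g at one point of Q makes it real.\<close>
      define A0 where "A0 = (INF y\<in>?Q. maximal \<mu> g y)"
      \<comment> \<open>Where M_\<mu> g vanished, its negative power would be \<infinity>, while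
        \<open>U\<close> is finite and \<open>u\<close> is positive a.e.\<close>
      have Mpos: "AE x in lebesgue. 0 < maximal \<mu> g x"
        using facts
      proof eventually_elim
        case (elim x)
        show ?case
        proof (rule ccontr)
          assume "\<not> 0 < maximal \<mu> g x"
          then have "maximal \<mu> g x = 0" by (simp add: not_gr_zero)
          moreover have "0 < s / D" using s D0 by simp
          ultimately have "epow (maximal \<mu> g x) (- (s / D)) = top"
            using s D0 by (simp add: epow_def not_less less_imp_le)
          with elim show False by (auto simp: ennreal_mult_top split: if_splits)
        qed
      qed
      have "\<exists>x\<in>?Q. 0 < maximal \<mu> g x \<and> maximal \<mu> g x < \<infinity>"
      proof (rule ccontr)
        assume *: "\<not> ?thesis"
        have "AE x in lebesgue. x \<notin> ?Q" using Mpos gfin by eventually_elim (use * in auto)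
        with l show False by (rule cube_not_AE_empty)
      qed
      then obtain x0 where x0: "x0 \<in> ?Q" "0 < maximal \<mu> g x0" "maximal \<mu> g x0 < \<infinity>" by blast
      have "0 < A0" unfolding A0_def using x0(2) l by (rule INF_maximal_pos)
      moreover have "A0 \<le> maximal \<mu> g x0" unfolding A0_def using x0(1) by (rule INF_lower)
      ultimately obtain A where A: "A0 = ennreal A" "0 < A"
        using x0(3) by (cases A0) (auto simp: top_unique)
      have AM: "ennreal A \<le> maximal \<mu> g x" if "x \<in> ?Q" for x
        unfolding A(1)[symmetric] A0_def using that by (rule INF_lower)
      have vle: "AE x in lebesgue. ennreal (v x) * indicator ?Q x
          \<le> ennreal (A powr (- (s / D))) * (ennreal (\<mu> x) * ennreal (u x) * indicator ?Q x)"
        using facts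
      proof eventually_elim
        case (elim x)
        show ?case
        proof (cases "x \<in> ?Q")
          case True
          have "epow (maximal \<mu> g x) (- (s / D)) \<le> epow (ennreal A) (- (s / D))"
            using AM[OF True] s D0 by (intro epow_antimono) auto
          then have "ennreal (U x) \<le> ennreal (u x) * ennreal (A powr (- (s / D)))"
            using elim A(2) by (simp add: epow_ennreal mult_left_mono)
          then have "ennreal (\<mu> x) * ennreal (U x) \<le> ennreal (\<mu> x) * (ennreal (u x) * ennreal (A powr (- (s / D))))"
            by (rule mult_left_mono) simp
          moreover have "ennreal (v x) = ennreal (\<mu> x) * ennreal (U x)"
            using elim by (metis ennreal_mult' less_imp_le)
          ultimately show ?thesis using True by (simp add: mult_ac)
        qed simp
      qed
      have "(\<integral>\<^sup>+x\<in>?Q. ennreal (v x) \<partial>lebesgue)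
          \<le> (\<integral>\<^sup>+x. ennreal (A powr (- (s / D))) * (ennreal (\<mu> x) * ennreal (u x) * indicator ?Q x) \<partial>lebesgue)"
        using vle by (rule nn_integral_mono_AE)
      also have "\<dots> = ennreal (A powr (- (s / D))) * (\<integral>\<^sup>+x\<in>?Q. ennreal (\<mu> x) * ennreal (u x) \<partial>lebesgue)"
      proof -
        have [measurable]: "u \<in> borel_measurable lebesgue" "?Q \<in> sets lebesgue"
          using uw by (auto intro: weight_measurable)
        show ?thesis by (rule nn_integral_cmult) measurable
      qed
      also have "\<dots> \<le> ennreal (A powr (- (s / D))) * ennreal (K1 * j * ?m ?Q)"
        using jint by (rule mult_left_mono) simp
      also have "\<dots> = ennreal (A powr (- (s / D)) * (K1 * j * ?m ?Q))"
        using K1 j by (intro ennreal_mult[symmetric]) auto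
      finally have part1: "(\<integral>\<^sup>+x\<in>?Q. ennreal (v x) \<partial>lebesgue) \<le> ennreal (A powr (- (s / D)) * (K1 * j * ?m ?Q))" .

      define c where "c = (Cs * A * (?m ?Q / ?vol ?Q)) powr s * j powr (- D)"
      have c: "0 < c" using Cs A mQ vQ j by (simp add: c_def)
      have "weak_norm (scale_measure (1 / emeasure lebesgue ?Q) lebesgue) (1 / s)
          (\<lambda>x. indicator ?Q x * w m x powr (- 1 / p m)) \<le> ennreal c"
      proof (rule weak_norm_le[OF s l _ c])
        fix t :: real assume t: "0 < t"
        \<comment> \<open>t = j^{-D} \<tau>^s: with u at least j on Q, exceeding t in the last
          factor forces \<mu> M_\<mu> g > \<tau>.\<close>
        define \<tau> where "\<tau> = (t * j powr D) powr (1 / s)"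
        have \<tau>: "0 < \<tau>" using t j by (simp add: \<tau>_def)
        define E where "E = {x \<in> ?Q. t < w m x powr (- 1 / p m)}"
        have E: "E \<in> sets lebesgue"
          unfolding E_def using weight_measurable[OF wwm] by measurable
        define S where "S = {x \<in> ?Q. maximal \<mu> g x < \<infinity> \<and> ennreal \<tau> < ennreal (\<mu> x) * maximal \<mu> g x}"
        have "\<exists>T\<in>sets lebesgue. S \<subseteq> T \<and> emeasure lebesgue T \<le> ennreal (Cs * A / \<tau> * ?m ?Q)"
        proof (rule mixed[OF g l \<tau> A(2)])
          fix b h assume "0 < (h::real)" "?Q \<subseteq> cube b h"
          then show "avg (weight_measure \<mu>) (cube b h) (\<lambda>y. ennreal \<bar>g y\<bar>) \<le> ennreal A"
            unfolding A(1)[symmetric] A0_def by (intro INF_greatest avg_le_maximal) auto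
        qed (auto simp: S_def)
        then obtain T where T: "T \<in> sets lebesgue" "S \<subseteq> T" "emeasure lebesgue T \<le> ennreal (Cs * A / \<tau> * ?m ?Q)"
          by blast
        have "AE x in lebesgue. x \<in> E \<longrightarrow> x \<in> T"
          using facts jAE Mpos
        proof eventually_elim
          case (elim x)
          show ?case
          proof
            assume xE: "x \<in> E"
            then have xQ: "x \<in> ?Q" and tx: "t < w m x powr (- 1 / p m)" by (auto simp: E_def)
            obtain M where M: "maximal \<mu> g x = ennreal M" "0 < M"
              using elim by (cases "maximal \<mu> g x") auto
            have "ennreal (U x) = ennreal (u x * M powr (- (s / D)))"
              using elim M by (simp add: epow_ennreal ennreal_mult)
            moreover have "0 \<le> u x * M powr (- (s / D))" "0 \<le> U x" using elim by (simp_all add: U_def)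
            ultimately have UM: "U x = u x * M powr (- (s / D))" by simp
            have "t < U x powr (- D) * \<mu> x powr s" using tx elim by simp
            also have "U x powr (- D) = u x powr (- D) * M powr s"
              unfolding UM powr_mult powr_powr using D0 by simp
            also have "u x powr (- D) * M powr s * \<mu> x powr s \<le> j powr (- D) * M powr s * \<mu> x powr s"
              using elim xQ j D0 by (intro mult_right_mono powr_mono2') auto
            also have "\<dots> = j powr (- D) * (\<mu> x * M) powr s" by (simp add: powr_mult)
            finally have "t * j powr D < (\<mu> x * M) powr s"
              using j by (simp add: powr_minus field_simps)
            then have "\<tau> < ((\<mu> x * M) powr s) powr (1 / s)"
              unfolding \<tau>_def using s t j by (intro powr_less_mono2) auto
            also have "\<dots> = \<mu> x * M" using s elim M by (simp add: powr_powr)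
            finally have "ennreal \<tau> < ennreal (\<mu> x * M)" using \<tau> by (simp add: ennreal_less_iff)
            then have "x \<in> S" using xQ elim M by (simp add: S_def ennreal_mult)
            then show "x \<in> T" using T(2) by blast
          qed
        qed
        then have "emeasure lebesgue E \<le> emeasure lebesgue T" using T(1) by (rule emeasure_mono_AE)
        also note T(3)
        also have "Cs * A / \<tau> * ?m ?Q = (c / t) powr (1 / s) * ?vol ?Q"
        proof -
          define X where "X = Cs * A * (?m ?Q / ?vol ?Q)"
          have X: "0 < X" using Cs A mQ vQ by (simp add: X_def)
          have "c / t = X powr s / (t * j powr D)" by (simp add: c_def X_def powr_minus field_simps)
          then have "(c / t) powr (1 / s) = X / \<tau>"
            unfolding \<tau>_def using X s by (simp add: powr_divide powr_powr)
          then show ?thesis using vQ by (simp add: X_def)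
        qed
        finally show "emeasure lebesgue {x \<in> ?Q. t < w m x powr (- 1 / p m)} \<le> ennreal ((c / t) powr (1 / s) * ?vol ?Q)"
          unfolding E_def .
      qed simp
      then have "AR_factor m p r w ?Q m \<le> ennreal c"
        unfolding AR_factor_def if_not_P[OF pr] s_eq .
      with part1 j A(2) show ?thesis unfolding c_def by blast
    qed
  qed

  have "\<exists>K>0. \<forall>a l. 0 < l \<longrightarrow> epow (avg lebesgue (cube a l) (\<lambda>x. ennreal (v x))) D
      * (P (cube a l) * AR_factor m p r w (cube a l) m) \<le> ennreal K"
  proof (intro exI[of _ "K1 powr D * Cs powr s * K"] conjI allI impI)
    show "0 < K1 powr D * Cs powr s * K" using K1 Cs K by simp
    fix a :: "real^'n" and l :: real assume l: "0 < l"
    let ?Q = "cube a l"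
    define y where "y = ?m ?Q / ?vol ?Q"
    have mQ: "0 < ?m ?Q" and vQ: "0 < ?vol ?Q" using l by (auto intro: m_cube_pos measure_cube_pos)
    then have y: "0 < y" by (simp add: y_def)
    have eQ: "emeasure lebesgue ?Q = ennreal (?vol ?Q)" using l by (intro emeasure_subset_cube[of _ a l]) auto
    obtain j A where j: "0 < j" and A: "0 < A"
      and c1: "(\<integral>\<^sup>+x\<in>?Q. ennreal (v x) \<partial>lebesgue) \<le> ennreal (A powr (- (s / D)) * (K1 * j * ?m ?Q))"
      and c2: "AR_factor m p r w ?Q m \<le> ennreal ((Cs * A * y) powr s * j powr (- D))"
      using claim[OF l, of a] unfolding y_def by blast
    have "avg lebesgue ?Q (\<lambda>x. ennreal (v x)) \<le> ennreal (A powr (- (s / D)) * (K1 * j * ?m ?Q)) / ennreal (?vol ?Q)"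
      unfolding avg_def eQ using c1 by (rule divide_right_mono_ennreal)
    also have "\<dots> = ennreal (A powr (- (s / D)) * (K1 * j * y))"
      using K1 j mQ vQ by (subst divide_ennreal) (auto simp: y_def)
    finally have "epow (avg lebesgue ?Q (\<lambda>x. ennreal (v x))) D \<le> epow (ennreal (A powr (- (s / D)) * (K1 * j * y))) D"
      using D0 by (intro epow_mono) auto
    also have "\<dots> = ennreal ((A powr (- (s / D)) * (K1 * j * y)) powr D)"
      using A K1 j y by (intro epow_ennreal) auto
    finally have e1: "epow (avg lebesgue ?Q (\<lambda>x. ennreal (v x))) D
      \<le> ennreal ((A powr (- (s / D)) * (K1 * j * y)) powr D)" .
    have "(\<integral>\<^sup>+x\<in>?Q. ennreal (\<mu> x) \<partial>lebesgue) = ennreal (?m ?Q)"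
      using emeasure_m[of ?Q] emeasure_eq_m[of ?Q a l] l by simp
    then have "avg lebesgue ?Q (\<lambda>x. ennreal (\<mu> x)) = ennreal y"
      unfolding avg_def y_def eQ using mQ vQ by (simp only:) (intro divide_ennreal, auto)
    then have "epow (avg lebesgue ?Q (\<lambda>x. ennreal (\<mu> x))) (1 / \<rho>) = ennreal (y powr (D + s))"
      using y by (simp add: epow_ennreal \<rho>)
    with KQ[OF l, of a] have e2: "ennreal (y powr (D + s)) * P ?Q \<le> ennreal K" by simp
    \<comment> \<open>A and j cancel between the two factors. What remains is (\<mu>(Q)/|Q|)^{D+s}
      with D + s = 1/\<rho>, exactly the power that the hypothesis on the class with last weight 1
      bounds together with the first m - 1 factors.\<close>
    have eq: "(A powr (- (s / D)) * (K1 * j * y)) powr D * ((Cs * A * y) powr s * j powr (- D))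
        = K1 powr D * Cs powr s * y powr (D + s)"
    proof -
      have f1: "(A powr (- (s / D)) * (K1 * j * y)) powr D = A powr (- s) * (K1 powr D * j powr D * y powr D)"
        using D0 by (simp add: powr_mult powr_powr)
      have f2: "(Cs * A * y) powr s = Cs powr s * A powr s * y powr s" by (simp add: powr_mult)
      have f3: "A powr (- s) * A powr s = 1" "j powr D * j powr (- D) = 1"
        using A j by (simp_all add: powr_add[symmetric])
      have "(A powr (- (s / D)) * (K1 * j * y)) powr D * ((Cs * A * y) powr s * j powr (- D))
          = K1 powr D * Cs powr s * (y powr D * y powr s)
            * (A powr (- s) * A powr s) * (j powr D * j powr (- D))"
        unfolding f1 f2 by (simp only: mult_ac)
      then show ?thesis unfolding f3 powr_add by (simp only: mult_1_right)
    qed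
    have "epow (avg lebesgue ?Q (\<lambda>x. ennreal (v x))) D * (P ?Q * AR_factor m p r w ?Q m)
      \<le> ennreal ((A powr (- (s / D)) * (K1 * j * y)) powr D) * (P ?Q * ennreal ((Cs * A * y) powr s * j powr (- D)))"
      using e1 c2 by (intro mult_mono) auto
    also have "\<dots> = ennreal ((A powr (- (s / D)) * (K1 * j * y)) powr D) * ennreal ((Cs * A * y) powr s * j powr (- D)) * P ?Q"
      by (simp only: mult_ac)
    also have "ennreal ((A powr (- (s / D)) * (K1 * j * y)) powr D) * ennreal ((Cs * A * y) powr s * j powr (- D))
        = ennreal (K1 powr D * Cs powr s * y powr (D + s))"
      unfolding eq[symmetric] by (intro ennreal_mult[symmetric]) auto
    also have "\<dots> = ennreal (K1 powr D * Cs powr s) * ennreal (y powr (D + s))"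
      by (intro ennreal_mult) auto
    also have "\<dots> * P ?Q = ennreal (K1 powr D * Cs powr s) * (ennreal (y powr (D + s)) * P ?Q)"
      by (simp only: mult.assoc)
    also have "\<dots> \<le> ennreal (K1 powr D * Cs powr s) * ennreal K"
      using e2 by (rule mult_left_mono) simp
    also have "\<dots> = ennreal (K1 powr D * Cs powr s * K)"
      using K by (intro ennreal_mult[symmetric]) auto
    finally show "epow (avg lebesgue ?Q (\<lambda>x. ennreal (v x))) D * (P ?Q * AR_factor m p r w ?Q m)
      \<le> ennreal (K1 powr D * Cs powr s * K)" .
  qed
  then show ?thesis
    unfolding v_def P_def by (intro iffD2[OF AR_class_iff[OF m p D_def]] conjI ballI w)
qed

text \<open>Take g = 0: its maximal function is 0, and \<open>epow 0 0 = 1\<close> by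
  convention.\<close>

lemma A1_in_A_hat_1:
  assumes "u \<in> A1 \<mu>"
  shows "u \<in> A_hat 1 \<mu>"
proof -
  have "maximal \<mu> (\<lambda>x. 0) x \<le> 0" for x
    unfolding maximal_def by (rule SUP_least) (simp add: avg_def)
  then have "maximal \<mu> (\<lambda>x. 0) x = 0" for x by simp
  with assms show ?thesis
    unfolding A_hat_def by (auto simp: A1_def epow_def intro!: bexI[of _ u] bexI[of _ "\<lambda>x. 0"])
qed

theorem proposition3p1:
  fixes m :: nat
    and w :: "nat \<Rightarrow> real^'n \<Rightarrow> real"
    and W :: "real^'n \<Rightarrow> real"
    and p r :: "nat \<Rightarrow> real"
  assumes "1 \<le> m"
    and "\<forall>i\<in>{1..m}. weight (w i)"
    and "1 \<le> r (m + 1)"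
  shows
    "((\<forall>i\<in>{1..<m}. 1 \<le> r i \<and> r i \<le> p i) \<and> 1 \<le> r m \<and> p m = r m \<and>
      1 / total_p m p > inv_conj (r (m + 1))
      \<longrightarrow>
      (w \<in> AR_class m p r \<longleftrightarrow>
        w(m := (\<lambda>x. 1)) \<in> AR_class m p r \<and>
        (\<lambda>x. w m x powr (rho_exp m p r / r m)) \<in> A1 (mu_weight m p r w)))
     \<and>
     ((\<forall>i\<in>{1..m}. 1 \<le> r i \<and> r i \<le> p i) \<and>
      1 / total_p m p > inv_conj (r (m + 1)) \<and>
      w(m := (\<lambda>x. 1)) \<in> AR_class m (p(m := r m)) r \<and>
      weight W \<and>
      (\<lambda>x. W x powr ((1 / inv_delta m p r (m + 1)) / r m))
        \<in> A_hat (1 + (1 / inv_delta m p r (m + 1)) * inv_delta m p r m) (mu_weight m p r w) \<and>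
      (AE x in lebesgue.
        w m x = W x powr (p m / r m) * mu_weight m p r w x powr (- (p m * inv_delta m p r m)))
      \<longrightarrow>
      w \<in> AR_class m p r)"
proof (intro conjI impI)
  have w: "weight (w i)" if "i \<in> {1..m}" for i using assms(2) that by blast
  have pos: "0 < inv_delta m p r (m + 1)" if "1 / total_p m p > inv_conj (r (m + 1))"
    using that inv_delta_last[OF assms(1), of p] by simp
  {
    assume *: "(\<forall>i\<in>{1..<m}. 1 \<le> r i \<and> r i \<le> p i) \<and> 1 \<le> r m \<and> p m = r m \<and>
      1 / total_p m p > inv_conj (r (m + 1))"
    then have r: "1 \<le> r i \<and> r i \<le> p i" if "i \<in> {1..<m}" for i using that by blast
    have rm: "1 \<le> r m" "p m = r m" and D: "0 < inv_delta m p r (m + 1)" using * pos by auto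
    have r': "1 \<le> r i \<and> r i \<le> p i" if "i \<in> {1..m}" for i
      using r[of i] rm that by (cases "i = m") auto
    have delta: "inv_delta m p r m = 0" using rm by (simp add: inv_delta_def inv_p_def)
    have rho: "1 / inv_delta m p r (m + 1) = rho_exp m p r"
    proof -
      have "1 / rho_exp m p r = inv_delta m p r (m + 1)"
        using rho_exp_eq[OF assms(1), of p r] rm by simp
      then show ?thesis by (metis divide_divide_eq_right mult_1 div_by_1)
    qed
    have wm: "weight (w m)" using w assms(1) by simp
    have mu: "weight (mu_weight m p r w)" using w by (intro weight_mu_weight) auto
    have upd: "p(m := r m) = p" using rm(2) by auto
    show "w \<in> AR_class m p r \<longleftrightarrow> w(m := (\<lambda>x. 1)) \<in> AR_class m p r \<and>
        (\<lambda>x. w m x powr (rho_exp m p r / r m)) \<in> A1 (mu_weight m p r w)"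
    proof
      assume "w \<in> AR_class m p r"
      then show "w(m := (\<lambda>x. 1)) \<in> AR_class m p r \<and>
          (\<lambda>x. w m x powr (rho_exp m p r / r m)) \<in> A1 (mu_weight m p r w)"
        using A1_of_AR_class[of m w r p] assms(1) w r rm D by blast
    next
      assume A: "w(m := (\<lambda>x. 1)) \<in> AR_class m p r \<and>
          (\<lambda>x. w m x powr (rho_exp m p r / r m)) \<in> A1 (mu_weight m p r w)"
      show "w \<in> AR_class m p r"
      \<comment> \<open>Part (b) with W = w_m: \<delta>_m is infinite, \<delta>_{m+1} = \<rho>, and
        the class with index 1 contains A_1(\<mu>).\<close>
      proof (rule AR_class_of_A_hat[OF assms(1) w r' D])
        show "w(m := (\<lambda>x. 1)) \<in> AR_class m (p(m := r m)) r" unfolding upd using A by blast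
        show "(\<lambda>x. w m x powr ((1 / inv_delta m p r (m + 1)) / r m))
            \<in> A_hat (1 + (1 / inv_delta m p r (m + 1)) * inv_delta m p r m) (mu_weight m p r w)"
          unfolding delta rho using A A1_in_A_hat_1 by auto
        \<comment> \<open>Only almost everywhere: \<open>powr\<close> with exponent 0 gives 1 where
          \<mu> is positive, but \<open>0 powr 0 = 0\<close>.\<close>
        show "AE x in lebesgue. w m x = w m x powr (p m / r m) * mu_weight m p r w x powr (- (p m * inv_delta m p r m))"
          using weight_AE_pos[OF wm] weight_AE_pos[OF mu]
          by eventually_elim (use rm delta in simp)
      qed (use wm in auto)
    qed
  }
  {
    assume *: "(\<forall>i\<in>{1..m}. 1 \<le> r i \<and> r i \<le> p i) \<and>
      1 / total_p m p > inv_conj (r (m + 1)) \<and>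
      w(m := (\<lambda>x. 1)) \<in> AR_class m (p(m := r m)) r \<and>
      weight W \<and>
      (\<lambda>x. W x powr ((1 / inv_delta m p r (m + 1)) / r m))
        \<in> A_hat (1 + (1 / inv_delta m p r (m + 1)) * inv_delta m p r m) (mu_weight m p r w) \<and>
      (AE x in lebesgue.
        w m x = W x powr (p m / r m) * mu_weight m p r w x powr (- (p m * inv_delta m p r m)))"
    show "w \<in> AR_class m p r"
      by (rule AR_class_of_A_hat[where W = W]) (use * pos w assms(1) in blast)+
  }
qed

end
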